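(* Let $T:\mathbb R\to\mathbb R$ be a surjective Markov map satisfying (A1)-(A5) (see context). Then $\mathcal I_{\mathcal D}=\mathcal D_{+\infty}\sqcup\mathcal D_{-\infty}$, where $$\mathcal D_{\pm\infty}:=\{x\in\mathbb R : \lim_{n\to\infty}T^n(x)=\pm\infty\}.$$ (Both sets are $T$-invariant.) If (A6) also holds, then $m(\mathcal D_{+\infty})\in\{0,\infty\}$ and $m(\mathcal D_{-\infty})\in\{0,\infty\}$. If (A7) holds as well, then each of the two sets $\mathcal D_{+\infty},\mathcal D_{-\infty}$ is either null or an exact component of $T$.
   Context: Conventions: $m$ is Lebesgue measure on $\mathbb R$; $\mathbb N=\{0,1,2,\dots\}$, $\mathbb Z^+=\{1,2,\dots\}$; all equalities and inclusions of Borel sets are modulo $m$-null sets. Setting: $(a_j)_{j\in\mathbb Z}$ are reals with $\lim_{j\to\pm\infty}a_j=\pm\infty$, and $I_j:=[a_j,a_{j+1}]$ are the Markov intervals (regarded as a partition of $\mathbb R$, endpoints being ignored). $T:\mathbb R\to\mathbb R$ is a surjective Markov map (values at the points $a_j$ are irrelevant; surjectivity means that each $I_k$ is contained in $TI_j$ for some $j$), with: (A1) there is $\theta>0$ with $0<a_{j+1}-a_j\le\theta$ for all $j$; (A2) $T|_{(a_j,a_{j+1})}$ has a unique extension $\tau_j:I_j\to J_j$ which is twice differentiable and bijective onto $J_j=\bigsqcup_{k=k_{1j}}^{k_{2j}}I_k$, for some integers $k_{1j}\le k_{2j}$; (A3) there is $\lambda>1$ with $|\tau_j'|\ge\lambda$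 for all $j$; (A4) there is $\eta>0$ with $|\tau_j''/(\tau_j')^2|\le\eta$ for all $j$. Conservative/dissipative parts: a Borel set $W$ is wandering if the sets $T^{-n}W$, $n\in\mathbb N$, are pairwise disjoint (mod $m$); $\mathcal D$ is the measurable union of all wandering sets and $\mathcal C:=\mathbb R\setminus\mathcal D$. A set $A$ is $T$-invariant if $T^{-1}A=A$. The invariant hull of $A$ is $\mathcal I(A):=\bigcup_{k\in\mathbb Z^+}\bigcup_{n\in\mathbb N}T^{-k}T^nA$, the smallest $T$-invariant set containing $A$. Put $\mathcal I_{\mathcal C\mathcal D}:=\mathcal I(\mathcal C)\cap\mathcal I(\mathcal D)$ and $\mathcal I_{\mathcal D}:=\mathcal I(\mathcal D)\setminus\mathcal I_{\mathcal C\mathcal D}$. Further assumptions: (A5) there is $\rho>0$ such that $|T(x)-x|\le\rho$ for all $x\in\mathcal I_{\mathcal D}$; (A6) there is $\theta_o\in(0,\theta)$ such that $\theta_o\le a_{j+1}-a_j$ for all $j$ with $m(I_j\cap\mathcal I_{\mathcal D})>0$; (A7) for all $j$ with $m(I_j\cap\mathcal I_{\mathcal D})>0$, $TI_j\supset I_j$. An ergodic component of $T$ is a $T$-invariant set $A$ with $m(A)>0$ such that every $T$-invariant subset of $A$ is null or equals $A$ mod $m$. An exact component of $T$ is an ergodic component $A$ such that $T|_A$ is exact, i.e. every set in $\bigcap_{n\ge0}(T|_A)^{-n}\mathscr B_A$ ($\mathscr B_A$ the Borel subsets of $A$) is null or equal to $A$ mod $m$. *)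

theory Defs
  imports "HOL-Analysis.Analysis"
begin

text \<open>Equalities and inclusions of Borel sets are understood modulo Lebesgue-null sets.\<close>

definition subset_mod :: "real set \<Rightarrow> real set \<Rightarrow> bool" where
  "subset_mod A B \<longleftrightarrow> (AE x in lborel. x \<in> A \<longrightarrow> x \<in> B)"

definition eq_mod :: "real set \<Rightarrow> real set \<Rightarrow> bool" where
  "eq_mod A B \<longleftrightarrow> (AE x in lborel. x \<in> A \<longleftrightarrow> x \<in> B)"

text \<open>The measurable union of a family of Borel sets is its smallest Borel upper bound modulo
  null sets. It is determined only modulo null sets, so it is a predicate on representatives.\<close>

definition is_measurable_union :: "real set set \<Rightarrow> real set \<Rightarrow> bool" where
  "is_measurable_union \<F> D \<longleftrightarrow>
     D \<in> sets borel \<and> (\<forall>W\<in>\<F>. subset_mod W D) \<and>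
     (\<forall>E\<in>sets borel. (\<forall>W\<in>\<F>. subset_mod W E) \<longrightarrow> subset_mod D E)"

lemma is_measurable_union_unique:
  assumes "is_measurable_union \<F> D" and "is_measurable_union \<F> E"
  shows "eq_mod D E"
proof -
  have "subset_mod D E" "subset_mod E D"
    using assms by (auto simp: is_measurable_union_def)
  then show ?thesis
    unfolding subset_mod_def eq_mod_def by eventually_elim auto
qed

lemma is_measurable_union_exists:
  assumes F: "\<F> \<subseteq> sets borel"
  shows "\<exists>D. is_measurable_union \<F> D"
proof -
  obtain h :: "real \<Rightarrow> ennreal" where h[measurable]: "h \<in> borel_measurable lborel"
    and fin: "integral\<^sup>N lborel h \<noteq> \<infinity>" and pos: "\<And>x. 0 < h x"
    using sigma_finite_measure.Ex_finite_integrable_function[OF lborel.sigma_finite_measure_axioms]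
    by auto
  define M where "M = density lborel h"
  have sM[measurable_cong]: "sets M = sets borel" by (simp add: M_def)
  have fM: "emeasure M A \<noteq> \<infinity>" if "A \<in> sets borel" for A
  proof -
    have "emeasure M A \<le> emeasure M (space M)" by (rule emeasure_space)
    also have "\<dots> = integral\<^sup>N lborel h"
      by (simp add: M_def emeasure_density)
    finally show ?thesis using fin by (auto simp: top_unique)
  qed
  have AEM: "(AE x in M. P x) \<longleftrightarrow> (AE x in lborel. P x)" for P
    unfolding M_def by (subst AE_density) (auto simp: pos)
  define \<G> where "\<G> = {\<Union>\<C> | \<C>. countable \<C> \<and> \<C> \<subseteq> \<F>}"
  have "{} \<in> \<G>" unfolding \<G>_def by (auto intro!: exI[of _ "{}"])
  then obtain f :: "nat \<Rightarrow> ennreal" where f: "range f \<subseteq> emeasure M ` \<G>"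
    and sup: "(SUP G\<in>\<G>. emeasure M G) = (SUP i. f i)"
    using ennreal_SUP_countable_SUP[of \<G> "emeasure M"] by blast
  have "\<forall>i. \<exists>\<C>. countable \<C> \<and> \<C> \<subseteq> \<F> \<and> f i = emeasure M (\<Union>\<C>)"
    using f unfolding \<G>_def by (auto simp: image_def subset_eq)
  then obtain c where c: "\<And>i. countable (c i)" "\<And>i. c i \<subseteq> \<F>" "\<And>i. f i = emeasure M (\<Union>(c i))"
    by metis
  define \<C> where "\<C> = (\<Union>i. c i)"
  have C: "countable \<C>" "\<C> \<subseteq> \<F>" using c by (auto simp: \<C>_def)
  have meas: "\<Union>\<B> \<in> sets borel" if "countable \<B>" "\<B> \<subseteq> \<F>" for \<B>
    using that F by (intro sets.countable_Union) auto
  have max: "emeasure M (\<Union>\<B>) \<le> emeasure M (\<Union>\<C>)" if "countable \<B>" "\<B> \<subseteq> \<F>" for \<B>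
  proof -
    have "emeasure M (\<Union>\<B>) \<le> (SUP G\<in>\<G>. emeasure M G)"
      using that unfolding \<G>_def by (intro SUP_upper) auto
    also have "\<dots> \<le> emeasure M (\<Union>\<C>)" unfolding sup
    proof (rule SUP_least)
      fix i show "f i \<le> emeasure M (\<Union>\<C>)"
        unfolding c(3) using meas[OF C] by (intro emeasure_mono) (auto simp: \<C>_def sM)
    qed
    finally show ?thesis .
  qed
  have up: "subset_mod W (\<Union>\<C>)" if W: "W \<in> \<F>" for W
  proof -
    have WC: "W \<in> sets borel" "\<Union>\<C> \<in> sets borel" using W F meas[OF C] by auto
    have "emeasure M (\<Union>\<C>) + emeasure M (W - \<Union>\<C>) = emeasure M (\<Union>\<C> \<union> (W - \<Union>\<C>))"
      using WC by (intro plus_emeasure) (auto simp: sM)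
    also have "\<Union>\<C> \<union> (W - \<Union>\<C>) = \<Union>(insert W \<C>)" by auto
    also have "emeasure M \<dots> \<le> emeasure M (\<Union>\<C>) + 0" using max[of "insert W \<C>"] C W by simp
    finally have "emeasure M (W - \<Union>\<C>) = 0"
      using fM[OF WC(2)] by (subst (asm) ennreal_add_left_cancel_le) auto
    then have "AE x in M. x \<notin> W - \<Union>\<C>"
      using WC by (intro AE_not_in) (auto simp: null_sets_def sM)
    then show ?thesis unfolding subset_mod_def AEM by eventually_elim auto
  qed
  have low: "subset_mod (\<Union>\<C>) E" if "\<forall>W\<in>\<F>. subset_mod W E" for E
  proof -
    have "AE x in lborel. \<forall>W\<in>\<C>. x \<in> W \<longrightarrow> x \<in> E"
      using that C by (intro AE_ball_countable') (auto simp: subset_mod_def)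
    then show ?thesis unfolding subset_mod_def by eventually_elim auto
  qed
  show ?thesis
    using up low meas[OF C] unfolding is_measurable_union_def by blast
qed

text \<open>The Markov intervals overlap in endpoints, which form a null set.\<close>

definition markov_interval :: "(int \<Rightarrow> real) \<Rightarrow> int \<Rightarrow> real set" where
  "markov_interval a j = {a j..a (j + 1)}"

definition wandering :: "(real \<Rightarrow> real) \<Rightarrow> real set \<Rightarrow> bool" where
  "wandering T W \<longleftrightarrow> W \<in> sets borel \<and>
     (\<forall>i k. i \<noteq> k \<longrightarrow> eq_mod ((T ^^ i) -` W \<inter> (T ^^ k) -` W) {})"

definition is_dissipative_part :: "(real \<Rightarrow> real) \<Rightarrow> real set \<Rightarrow> bool" where
  "is_dissipative_part T D \<longleftrightarrow> is_measurable_union {W. wandering T W} D"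

lemma is_dissipative_part_exists: "\<exists>D. is_dissipative_part T D"
  unfolding is_dissipative_part_def
  by (rule is_measurable_union_exists) (auto simp: wandering_def)

definition invariant_set :: "(real \<Rightarrow> real) \<Rightarrow> real set \<Rightarrow> bool" where
  "invariant_set T A \<longleftrightarrow> A \<in> sets borel \<and> eq_mod (T -` A) A"

definition invariant_hull :: "(real \<Rightarrow> real) \<Rightarrow> real set \<Rightarrow> real set" where
  "invariant_hull T A = (\<Union>k\<in>{1..}. \<Union>n. (T ^^ k) -` ((T ^^ n) ` A))"

text \<open>In the next two definitions \<open>D\<close> is (a representative of) the dissipative part, and
  \<open>- D\<close> is the conservative part.\<close>

definition hull_CD :: "(real \<Rightarrow> real) \<Rightarrow> real set \<Rightarrow> real set" where
  "hull_CD T D = invariant_hull T (- D) \<inter> invariant_hull T D"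

definition hull_D :: "(real \<Rightarrow> real) \<Rightarrow> real set \<Rightarrow> real set" where
  "hull_D T D = invariant_hull T D - hull_CD T D"

definition D_plus_inf :: "(real \<Rightarrow> real) \<Rightarrow> real set" where
  "D_plus_inf T = {x. filterlim (\<lambda>n. (T ^^ n) x) at_top sequentially}"

definition D_minus_inf :: "(real \<Rightarrow> real) \<Rightarrow> real set" where
  "D_minus_inf T = {x. filterlim (\<lambda>n. (T ^^ n) x) at_bot sequentially}"

definition ergodic_component :: "(real \<Rightarrow> real) \<Rightarrow> real set \<Rightarrow> bool" where
  "ergodic_component T A \<longleftrightarrow> invariant_set T A \<and> emeasure lborel A > 0 \<and>
     (\<forall>B. invariant_set T B \<and> subset_mod B A \<longrightarrow> B \<in> null_sets lborel \<or> eq_mod B A)"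

text \<open>The intersection over \<open>n\<close> of the \<open>\<sigma>\<close>-algebras \<open>(T|\<^sub>A)\<^sup>-\<^sup>n \<B>\<^sub>A\<close>. Membership is modulo null
  sets, because an invariant set \<open>A\<close> is mapped to itself only modulo null sets.\<close>

definition tail_sets :: "(real \<Rightarrow> real) \<Rightarrow> real set \<Rightarrow> real set set" where
  "tail_sets T A = {B \<in> sets borel. B \<subseteq> A \<and>
     (\<forall>n. \<exists>E\<in>sets borel. E \<subseteq> A \<and> eq_mod B (A \<inter> (T ^^ n) -` E))}"

definition exact_component :: "(real \<Rightarrow> real) \<Rightarrow> real set \<Rightarrow> bool" where
  "exact_component T A \<longleftrightarrow> ergodic_component T A \<and>
     (\<forall>B\<in>tail_sets T A. B \<in> null_sets lborel \<or> eq_mod B A)"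

text \<open>\<open>\<tau> j\<close> is the extension of \<open>T\<close> from the open interval \<open>(a j, a (j + 1))\<close> to the closed one (it
  is unique by continuity), with first and second derivatives \<open>\<tau>' j\<close> and \<open>\<tau>'' j\<close>, one-sided at the
  endpoints. Nothing is assumed about \<open>T\<close> at the points \<open>a j\<close>; in particular \<open>T I\<^sub>j\<close> means
  \<open>\<tau> j ` I\<^sub>j\<close>.\<close>

definition markov_branches ::
  "(int \<Rightarrow> real) \<Rightarrow> (real \<Rightarrow> real) \<Rightarrow> (int \<Rightarrow> real \<Rightarrow> real) \<Rightarrow> (int \<Rightarrow> real \<Rightarrow> real) \<Rightarrow>
     (int \<Rightarrow> real \<Rightarrow> real) \<Rightarrow> bool" where
  "markov_branches a T \<tau> \<tau>' \<tau>'' \<longleftrightarrow>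
     (\<forall>j. (\<forall>x\<in>{a j<..<a (j + 1)}. \<tau> j x = T x) \<and>
          (\<forall>x\<in>markov_interval a j.
             (\<tau> j has_real_derivative \<tau>' j x) (at x within markov_interval a j) \<and>
             (\<tau>' j has_real_derivative \<tau>'' j x) (at x within markov_interval a j)) \<and>
          (\<exists>k1 k2. k1 \<le> k2 \<and>
             bij_betw (\<tau> j) (markov_interval a j) (\<Union>k\<in>{k1..k2}. markov_interval a k)))"

end

theory Submission
  imports Defs
begin

text \<open>Call \<open>cyl w\<close> the set of points whose first \<open>n + 1\<close> iterates follow the itinerary \<open>w\<close>. By the Markov
  property \<open>T\<^sup>n\<close> maps \<open>cyl w\<close> onto the last interval of \<open>w\<close>, and (A4) bounds its distortion uniformly.

  If \<open>I\<^sub>k\<close> contains a wandering set \<open>W\<close> of positive measure, then \<open>T\<^sup>-\<^sup>n W\<close> occupies a fixed proportion of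
  \<open>T\<^sup>-\<^sup>n I\<^sub>k\<close>; as the former sets are disjoint, almost every orbit visits \<open>I\<^sub>k\<close> finitely often by
  Borel--Cantelli. Hence orbits in \<open>hull_D\<close> leave every bounded set, and (A5) forbids them to
  switch sides. Conversely, for fixed \<open>M\<close> and \<open>n\<close> the points whose orbit is in \<open>{..M}\<close> for the last time at
  time \<open>n\<close> form a wandering set, and such sets cover \<open>D_plus_inf\<close>.

  A density argument along cylinders shows that, for a set \<open>B\<close> of positive measure, some \<open>T\<^sup>n\<close> maps
  \<open>B\<close> to almost all of a cell. With (A6) this gives infinite measure. With (A7), an invariant
  set that nearly fills one cell nearly fills all later ones, because orbits have to cross them;
  two disjoint sets cannot both do so, which is ergodicity. Finally \<open>I\<^sub>j \<subseteq> T I\<^sub>j\<close> forces every tail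
  set \<open>B\<close> of positive measure to meet \<open>T\<^sup>-\<^sup>1 B\<close>; applied to \<open>B - T\<^sup>-\<^sup>1 B\<close> and \<open>T\<^sup>-\<^sup>1 B - B\<close> this makes all
  tail sets invariant, so exactness follows from ergodicity.\<close>

section \<open>Measure theory on the line\<close>

text \<open>Images of branches may be arbitrarily long, and the distortion that (A4) permits grows
  exponentially with the length of the image considered, so a single branch has no uniform bound.
  Cylinders escape this because \<open>T ^^ n\<close> sends them to one cell, of length at most
  \<theta>. Where a cell has to be followed forward, (A5) supplies a window of bounded length around
  it, and (A6) a pair of points far enough apart to bound the slope inside that window.

  \<open>T\<close> is arbitrary at the points \<open>a j\<close>, and \<tau>'' is only known to
  exist pointwise. Hence open cells are used, itineraries are considered for almost every point, and
  distortion compares difference quotients in cross-multiplied form, which composes along orbits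
  without derivatives of \<open>T ^^ n\<close>. The hull is built from forward images, so null sets
  and Borel sets have to be controlled under images as well as preimages. A sign \<open>s\<close>
  treats both ends of the line at once.\<close>

lemma AE_lborel_iff_negligible:
  fixes P :: "'a::euclidean_space \<Rightarrow> bool"
  shows "(AE x in lborel. P x) \<longleftrightarrow> negligible {x. \<not> P x}"
  by (simp add: negligible_iff_null_sets null_sets_completion_iff2 eventually_ae_filter)

lemma emeasure_disjoint_UN_mono:
  assumes I: "countable I"
    and X: "\<And>i. i \<in> I \<Longrightarrow> X i \<in> sets M" "disjoint_family_on X I"
    and Y: "\<And>i. i \<in> I \<Longrightarrow> Y i \<in> sets M" "disjoint_family_on Y I"
    and le: "\<And>i. i \<in> I \<Longrightarrow> c * emeasure M (X i) \<le> emeasure M (Y i)"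
  shows "c * emeasure M (\<Union>i\<in>I. X i) \<le> emeasure M (\<Union>i\<in>I. Y i)"
proof -
  have "c * emeasure M (\<Union>i\<in>I. X i) = (\<integral>\<^sup>+i. c * emeasure M (X i) \<partial>count_space I)"
    using X I by (simp add: emeasure_UN_countable nn_integral_cmult)
  also have "\<dots> \<le> (\<integral>\<^sup>+i. emeasure M (Y i) \<partial>count_space I)"
    using le by (intro nn_integral_mono) auto
  also have "\<dots> = emeasure M (\<Union>i\<in>I. Y i)"
    using Y I by (simp add: emeasure_UN_countable)
  finally show ?thesis .
qed

lemma emeasure_countable_cover_le:
  assumes I: "countable I" and X: "\<And>i. i \<in> I \<Longrightarrow> X i \<in> sets M" and A: "A \<subseteq> (\<Union>i\<in>I. X i)"
  shows "emeasure M A \<le> (\<integral>\<^sup>+i. emeasure M (X i) \<partial>count_space I)"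
proof -
  have m: "(\<Union>i\<in>I. X i) \<in> sets M" using I X by auto
  have "emeasure M A \<le> emeasure M (\<Union>i\<in>I. X i)" using A m by (intro emeasure_mono)
  also have "\<dots> = (\<integral>\<^sup>+x. indicator (\<Union>i\<in>I. X i) x \<partial>M)" using m by simp
  also have "\<dots> \<le> (\<integral>\<^sup>+x. (\<integral>\<^sup>+i. indicator (X i) x \<partial>count_space I) \<partial>M)"
  proof (rule nn_integral_mono)
    fix x
    show "indicator (\<Union>i\<in>I. X i) x \<le> (\<integral>\<^sup>+i. indicator (X i) x \<partial>count_space I)"
    proof (cases "x \<in> (\<Union>i\<in>I. X i)")
      case True
      then obtain k where k: "k \<in> I" "x \<in> X k" by auto
      have "(1::ennreal) = emeasure (count_space I) {k}" using k by simp
      also have "\<dots> = (\<integral>\<^sup>+i. indicator {k} i \<partial>count_space I)" using k by simp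
      also have "\<dots> \<le> (\<integral>\<^sup>+i. indicator (X i) x \<partial>count_space I)"
        using k by (intro nn_integral_mono) (auto split: split_indicator)
      finally show ?thesis using True by simp
    qed simp
  qed
  also have "\<dots> = (\<integral>\<^sup>+i. (\<integral>\<^sup>+x. indicator (X i) x \<partial>M) \<partial>count_space I)"
    using I X by (intro nn_integral_count_space_nn_integral) auto
  also have "\<dots> = (\<integral>\<^sup>+i. emeasure M (X i) \<partial>count_space I)"
    using X by (intro nn_integral_cong) auto
  finally show ?thesis .
qed

lemma emeasure_connected_ge_dist:
  fixes C :: "real set"
  assumes C: "connected C" "C \<in> sets borel" and x: "x \<in> C" "y \<in> C"
  shows "ennreal \<bar>x - y\<bar> \<le> emeasure lborel C"
proof -
  have "{min x y..max x y} \<subseteq> C"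
    using C x by (intro connected_contains_Icc) (auto simp: min_def max_def)
  then have "emeasure lborel {min x y..max x y} \<le> emeasure lborel C"
    using C by (intro emeasure_mono) auto
  then show ?thesis by (simp add: abs_real_def min_def max_def split: if_splits)
qed

text \<open>\<open>S\<close> may fail to be Borel, so it is enclosed in the interval from its
  infimum to its supremum.\<close>

lemma ex_borel_superset_emeasure_le_diameter:
  fixes S :: "real set"
  assumes "\<And>x y. x \<in> S \<Longrightarrow> y \<in> S \<Longrightarrow> ennreal \<bar>x - y\<bar> \<le> d"
  shows "\<exists>C\<in>sets borel. S \<subseteq> C \<and> emeasure lborel C \<le> d"
proof (cases "S = {} \<or> d = top")
  case True
  then show ?thesis
  proof
    assume "S = {}" then show ?thesis by (intro bexI[of _ "{}"]) auto
  next
    assume "d = top" then show ?thesis by (intro bexI[of _ UNIV]) auto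
  qed
next
  case False
  then obtain r where r: "d = ennreal r" "r \<ge> 0" by (cases d) auto
  have le: "\<bar>x - y\<bar> \<le> r" if "x \<in> S" "y \<in> S" for x y
    using assms[OF that] r by simp
  obtain z where z: "z \<in> S" using False by auto
  have ba: "bdd_above S" using le[OF _ z] by (intro bdd_aboveI[of _ "z + r"]) (auto simp: abs_le_iff algebra_simps)
  have bb: "bdd_below S" using le[OF _ z] by (intro bdd_belowI[of _ "z - r"]) (smt (verit))
  have S: "S \<subseteq> {Inf S..Sup S}" using ba bb by (auto intro: cInf_lower cSup_upper)
  have "Sup S \<le> Inf S + r"
  proof (rule cSup_least)
    fix x assume x: "x \<in> S"
    have "x - r \<le> Inf S" using z le[OF x] by (intro cInf_greatest) (auto simp: abs_le_iff algebra_simps)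
    then show "x \<le> Inf S + r" by simp
  qed (use z in auto)
  moreover have "Inf S \<le> Sup S" using z S by force
  ultimately have "emeasure lborel {Inf S..Sup S} \<le> d"
    using r by (simp add: ennreal_leI)
  then show ?thesis using S by (intro bexI[of _ "{Inf S..Sup S}"]) auto
qed

text \<open>The components of an open set \<open>U\<close> around \<open>A\<close> are intervals, so
  the part of \<open>A\<close> in one of them has an image of diameter at most \<open>L\<close>
  times its length. Summing gives \<open>L\<close> times the measure of \<open>U\<close>, which
  exceeds that of \<open>A\<close> by as little as desired. The Lipschitz bound is applied to points
  of \<open>A\<close> only.\<close>

lemma emeasure_lipschitz_image_le:
  fixes f :: "real \<Rightarrow> real"
  assumes A: "A \<in> sets borel" and L: "L \<ge> 0"
    and lip: "\<And>x y. x \<in> A \<Longrightarrow> y \<in> A \<Longrightarrow> \<bar>f x - f y\<bar> \<le> L * \<bar>x - y\<bar>"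
  shows "emeasure lborel (f ` A) \<le> ennreal L * emeasure lborel A"
proof (rule ennreal_le_epsilon)
  fix e :: real assume e: "e > 0"
  \<comment> \<open>Dividing by \<open>L + 1\<close> instead of \<open>L\<close> covers the case
    \<open>L = 0\<close>.\<close>
  define e' where "e' = e / (L + 1)"
  have e': "e' > 0" "L * e' \<le> e" using e L by (auto simp: e'_def field_simps)
  obtain U where U: "open U" "A \<subseteq> U" "emeasure lborel (U - A) < e'"
    using outer_regular_lborel[OF A e'(1)] by blast
  have cc: "countable (components U)" using U(1)
    by (intro countable_disjoint_open_subsets)
       (use pairwise_disjoint_components[of U] open_components in \<open>auto simp: disjnt_def pairwise_def\<close>)
  have Um: "U \<in> sets borel" using U by auto
  have cs: "C \<in> sets borel" "connected C" if "C \<in> components U" for C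
    using that U open_components[of U C] in_components_connected[of C U] by auto
  have "\<forall>C\<in>components U. \<exists>H\<in>sets borel. f ` (A \<inter> C) \<subseteq> H \<and> emeasure lborel H \<le> ennreal L * emeasure lborel C"
  proof
    fix C assume C: "C \<in> components U"
    show "\<exists>H\<in>sets borel. f ` (A \<inter> C) \<subseteq> H \<and> emeasure lborel H \<le> ennreal L * emeasure lborel C"
    proof (rule ex_borel_superset_emeasure_le_diameter)
      fix u v assume "u \<in> f ` (A \<inter> C)" "v \<in> f ` (A \<inter> C)"
      then obtain x y where xy: "x \<in> A" "x \<in> C" "y \<in> A" "y \<in> C" "u = f x" "v = f y" by auto
      have "ennreal \<bar>u - v\<bar> \<le> ennreal (L * \<bar>x - y\<bar>)" using lip xy by (auto intro: ennreal_leI)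
      also have "\<dots> = ennreal L * ennreal \<bar>x - y\<bar>" using L by (simp add: ennreal_mult)
      also have "\<dots> \<le> ennreal L * emeasure lborel C"
        using emeasure_connected_ge_dist[OF cs(2,1)[OF C]] xy by (intro mult_left_mono) auto
      finally show "ennreal \<bar>u - v\<bar> \<le> ennreal L * emeasure lborel C" .
    qed
  qed
  then obtain H where H: "\<And>C. C \<in> components U \<Longrightarrow> H C \<in> sets borel"
    "\<And>C. C \<in> components U \<Longrightarrow> f ` (A \<inter> C) \<subseteq> H C"
    "\<And>C. C \<in> components U \<Longrightarrow> emeasure lborel (H C) \<le> ennreal L * emeasure lborel C"
    by metis
  have "f ` A \<subseteq> (\<Union>C\<in>components U. H C)"
  proof (rule image_subsetI)
    fix x assume x: "x \<in> A"
    then have "x \<in> \<Union>(components U)" using U(2) by auto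
    then obtain C where "C \<in> components U" "x \<in> C" by blast
    then show "f x \<in> (\<Union>C\<in>components U. H C)" using H(2)[of C] x by blast
  qed
  then have "emeasure lborel (f ` A) \<le> (\<integral>\<^sup>+C. emeasure lborel (H C) \<partial>count_space (components U))"
    using H cc by (intro emeasure_countable_cover_le) auto
  also have "\<dots> \<le> (\<integral>\<^sup>+C. ennreal L * emeasure lborel C \<partial>count_space (components U))"
    using H(3) by (intro nn_integral_mono) auto
  also have "\<dots> = ennreal L * emeasure lborel (\<Union>C\<in>components U. C)"
    using cc cs pairwise_disjoint_components[of U]
    by (subst emeasure_UN_countable)
       (auto simp: nn_integral_cmult disjoint_family_on_def pairwise_def disjnt_def)
  also have "(\<Union>C\<in>components U. C) = A \<union> (U - A)" using Union_components[of U] U(2) by auto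
  also have "emeasure lborel (A \<union> (U - A)) = emeasure lborel A + emeasure lborel (U - A)"
    using A Um by (intro plus_emeasure[symmetric]) auto
  also have "ennreal L * \<dots> \<le> ennreal L * (emeasure lborel A + ennreal e')"
    using U(3) by (intro mult_left_mono add_left_mono) auto
  also have "\<dots> = ennreal L * emeasure lborel A + ennreal (L * e')"
    using L e' by (simp add: distrib_left ennreal_mult)
  also have "\<dots> \<le> ennreal L * emeasure lborel A + ennreal e"
    using e'(2) by (intro add_left_mono ennreal_leI)
  finally show "emeasure lborel (f ` A) \<le> ennreal L * emeasure lborel A + ennreal e" .
qed

text \<open>A continuous injection of an open interval is an open map, so its inverse
  \<open>g\<close> is continuous, and the image of \<open>A\<close> is a preimage under
  \<open>g\<close>.\<close>

lemma borel_continuous_inj_image: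
  fixes f :: "real \<Rightarrow> real"
  assumes f: "continuous_on {a<..<b} f" "inj_on f {a<..<b}" and A: "A \<in> sets borel" "A \<subseteq> {a<..<b}"
  shows "f ` A \<in> sets borel"
proof -
  let ?S = "{a<..<b}"
  define g where "g = inv_into ?S f"
  have g: "g (f x) = x" if "x \<in> ?S" for x using that f(2) by (simp add: g_def)
  have o: "open (f ` ?S)"
    using f by (intro injective_into_1d_imp_open_map_UNIV[where S = ?S]) auto
  have "continuous_on (f ` ?S) g"
    by (rule Further_Topology.continuous_on_inverse_open) (use f g in auto)
  then have "g \<in> borel_measurable (restrict_space borel (f ` ?S))"
    by (rule borel_measurable_continuous_on_restrict)
  then have "g -` A \<inter> space (restrict_space borel (f ` ?S)) \<in> sets (restrict_space borel (f ` ?S))"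
    using A(1) by (rule measurable_sets)
  then have "g -` A \<inter> f ` ?S \<in> sets borel"
    using o by (auto simp: sets_restrict_space space_restrict_space)
  also have "g -` A \<inter> f ` ?S = f ` A"
    using g A(2) by (auto simp: image_iff)
  finally show ?thesis .
qed

lemma countable_imp_negligible: "countable A \<Longrightarrow> negligible A"
  for A :: "'a::euclidean_space set"
  unfolding negligible_iff_null_sets by (intro null_sets_completionI countable_imp_null_set_lborel)

lemma negligible_UN_int: "(\<And>j::int. negligible (A j)) \<Longrightarrow> negligible (\<Union>j. A j)"
  by (rule negligible_countable_Union) auto

lemma measure_le_of_emeasure_le:
  assumes "emeasure M A \<le> ennreal c * emeasure M B" "A \<in> fmeasurable M" "B \<in> fmeasurable M" "c \<ge> 0"
  shows "measure M A \<le> c * measure M B"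
  using assms by (simp add: emeasure_eq_measure2 ennreal_mult'[symmetric])

text \<open>Once all |y n| exceed |\<rho>|, a change of sign would need a jump longer than
  2|\<rho>|.\<close>

lemma escapes_to_one_side:
  fixes y :: "nat \<Rightarrow> real"
  assumes big: "\<And>B. \<forall>\<^sub>F n in sequentially. \<bar>y n\<bar> > B" and step: "\<And>n. \<bar>y (Suc n) - y n\<bar> \<le> \<rho>"
  shows "\<exists>s. (s = 1 \<or> s = -1) \<and> filterlim (\<lambda>n. s * y n) at_top sequentially"
proof -
  obtain N where N: "\<And>n. n \<ge> N \<Longrightarrow> \<bar>y n\<bar> > \<bar>\<rho>\<bar>"
    using big[of "\<bar>\<rho>\<bar>"] unfolding eventually_sequentially by blast
  define s :: real where "s = (if y N > 0 then 1 else -1)"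
  have s: "s = 1 \<or> s = -1" by (simp add: s_def)
  have pos: "s * y n > 0" if "n \<ge> N" for n
    using that
  proof (induction n rule: dec_induct)
    case base then show ?case using N[of N] by (auto simp: s_def)
  next
    case (step n)
    show ?case using step.IH N[of n] N[of "Suc n"] step.hyps assms(2)[of n] s by (auto simp: abs_real_def split: if_splits)
  qed
  have "filterlim (\<lambda>n. s * y n) at_top sequentially"
    unfolding filterlim_at_top
  proof
    fix Z
    show "\<forall>\<^sub>F n in sequentially. Z \<le> s * y n"
      using big[of Z] eventually_ge_at_top[of N]
    proof eventually_elim
      case (elim n)
      then show ?case using pos[of n] s by (auto simp: abs_real_def split: if_splits)
    qed
  qed
  then show ?thesis using s by blast
qed

lemma negligible_iff_emeasure:
  "A \<in> sets borel \<Longrightarrow> negligible A \<longleftrightarrow> \<not> emeasure lborel A > 0"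
  for A :: "real set"
  unfolding negligible_iff_null_sets
  by (subst null_sets_completion_iff) (auto simp: null_sets_def zero_less_iff_neq_zero)

lemma measure_Diff_cong_AE:
  fixes A B C :: "real set"
  assumes "AE x in lborel. x \<in> B \<longleftrightarrow> x \<in> C" "A \<in> sets borel" "B \<in> sets borel" "C \<in> sets borel"
  shows "measure lborel (A - B) = measure lborel (A - C)"
proof (rule measure_eq_AE)
  show "AE x in lborel. x \<in> A - B \<longleftrightarrow> x \<in> A - C" using assms(1) by eventually_elim auto
qed (use assms in auto)

section \<open>Branches of the Markov map\<close>

locale markov_map =
  fixes a :: "int \<Rightarrow> real" and T :: "real \<Rightarrow> real"
    and \<tau> \<tau>' \<tau>'' :: "int \<Rightarrow> real \<Rightarrow> real" and \<theta> \<Lambda> \<eta> :: real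
  assumes a_top: "filterlim a at_top at_top" and a_bot: "filterlim a at_bot at_bot"
    and gap_pos: "\<And>j. 0 < a (j + 1) - a j" and gap_le: "\<And>j. a (j + 1) - a j \<le> \<theta>"
    and branches: "markov_branches a T \<tau> \<tau>' \<tau>''"
    and surjective: "\<And>k. \<exists>j. markov_interval a k \<subseteq> \<tau> j ` markov_interval a j"
    and Lambda_gt_1: "\<Lambda> > 1"
    and expanding: "\<And>j x. x \<in> markov_interval a j \<Longrightarrow> \<bar>\<tau>' j x\<bar> \<ge> \<Lambda>"
    and eta_pos: "\<eta> > 0"
    and adler: "\<And>j x. x \<in> markov_interval a j \<Longrightarrow> \<bar>\<tau>'' j x / (\<tau>' j x)\<^sup>2\<bar> \<le> \<eta>"
begin

abbreviation cell :: "int \<Rightarrow> real set" where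
  "cell j \<equiv> {a j<..<a (j + 1)}"

lemma theta_pos: "\<theta> > 0"
  using gap_pos[of 0] gap_le[of 0] by linarith

lemma a_less_Suc: "a j < a (j + 1)"
  using gap_pos[of j] by simp

lemma a_strict_mono: "strict_mono a"
proof (rule strict_monoI)
  fix i j :: int assume "i < j"
  then show "a i < a j"
  proof (induction j rule: int_gr_induct)
    case (step j) then show ?case using a_less_Suc[of j] by linarith
  qed (rule a_less_Suc)
qed

lemma a_less_iff [simp]: "a i < a j \<longleftrightarrow> i < j"
  and a_le_iff [simp]: "a i \<le> a j \<longleftrightarrow> i \<le> j"
  and a_eq_iff [simp]: "a i = a j \<longleftrightarrow> i = j"
  by (rule strict_mono_less[OF a_strict_mono] strict_mono_less_eq[OF a_strict_mono]
        strict_mono_eq[OF a_strict_mono])+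

lemma cell_unique:
  assumes "x \<in> {a i..<a (i + 1)}" "x \<in> {a j..<a (j + 1)}"
  shows "i = j"
proof (rule ccontr)
  assume "i \<noteq> j"
  then consider "i + 1 \<le> j" | "j + 1 \<le> i" by linarith
  then show False
  proof cases
    case 1 then have "a (i + 1) \<le> a j" by simp
    then show False using assms unfolding atLeastLessThan_iff by linarith
  next
    case 2 then have "a (j + 1) \<le> a i" by simp
    then show False using assms unfolding atLeastLessThan_iff by linarith
  qed
qed

lemma ex_index: "\<exists>j. x \<in> {a j..<a (j + 1)}"
proof -
  have "\<forall>\<^sub>F j in at_top. x + 1 \<le> a j" using a_top by (simp add: filterlim_at_top)
  then obtain N where N: "x + 1 \<le> a j" if "j \<ge> N" for j unfolding eventually_at_top_linorder by metis
  have "\<forall>\<^sub>F j in at_bot. a j \<le> x" using a_bot by (simp add: filterlim_at_bot)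
  then obtain M where M: "a j \<le> x" if "j \<le> M" for j unfolding eventually_at_bot_linorder by metis
  define S where "S = {j \<in> {M..N}. a j \<le> x}"
  have MN: "M \<le> N"
  proof (rule ccontr)
    assume "\<not> M \<le> N" then show False using N[of M] M[of M] by linarith
  qed
  have fin: "finite S" unfolding S_def by (rule finite_subset[of _ "{M..N}"]) auto
  have "M \<in> S" using M[of M] MN by (simp add: S_def)
  then have j: "Max S \<in> S" using fin by (intro Max_in) auto
  have "x < a (Max S + 1)"
  proof (rule ccontr)
    assume *: "\<not> x < a (Max S + 1)"
    then have "Max S + 1 < N" using N[of "Max S + 1"] by linarith
    then have "Max S + 1 \<in> S" using * j by (simp add: S_def)
    then show False using Max_ge[OF fin, of "Max S + 1"] by linarith
  qed
  then show ?thesis using j by (intro exI[of _ "Max S"]) (simp add: S_def)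
qed

text \<open>Half-open intervals make the index total; it names the open cell of \<open>x\<close>
  except at the points \<open>a j\<close>.\<close>

definition idx :: "real \<Rightarrow> int" where
  "idx x = (THE j. x \<in> {a j..<a (j + 1)})"

lemma idx_mem: "x \<in> {a (idx x)..<a (idx x + 1)}"
  unfolding idx_def
proof (rule theI')
  obtain j where j: "x \<in> {a j..<a (j + 1)}" using ex_index[of x] by (elim exE)
  show "\<exists>!j. x \<in> {a j..<a (j + 1)}"
    by (rule ex1I[of _ j], rule j, erule cell_unique[OF _ j])
qed

lemma idx_eq: "x \<in> {a j..<a (j + 1)} \<Longrightarrow> idx x = j"
  using cell_unique[OF idx_mem] .

lemma idx_eq_cell: "x \<in> cell j \<Longrightarrow> idx x = j"
  by (rule idx_eq) auto

lemma mem_cell_idx: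
  assumes "x \<notin> range a"
  shows "x \<in> cell (idx x)"
proof -
  have "x \<noteq> a (idx x)" using assms by blast
  then show ?thesis using idx_mem[of x] by auto
qed

lemma UN_markov_interval:
  assumes "k1 \<le> k2"
  shows "(\<Union>k\<in>{k1..k2}. markov_interval a k) = {a k1..a (k2 + 1)}"
proof (intro set_eqI iffI)
  fix x assume "x \<in> (\<Union>k\<in>{k1..k2}. markov_interval a k)"
  then obtain k where k: "k1 \<le> k" "k \<le> k2" "a k \<le> x" "x \<le> a (k + 1)"
    by (auto simp: markov_interval_def)
  then have "a k1 \<le> a k" "a (k + 1) \<le> a (k2 + 1)" by simp_all
  then show "x \<in> {a k1..a (k2 + 1)}" using k(3,4) unfolding atLeastAtMost_iff by linarith
next
  fix x assume "x \<in> {a k1..a (k2 + 1)}"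
  then have x: "a k1 \<le> x" "x \<le> a (k2 + 1)" by simp_all
  show "x \<in> (\<Union>k\<in>{k1..k2}. markov_interval a k)"
  \<comment> \<open>At the right end point \<open>idx x\<close> would be \<open>k2 + 1\<close>, just
    outside the range.\<close>
  proof (cases "x = a (k2 + 1)")
    case True
    then have "x \<in> markov_interval a k2" by (simp add: markov_interval_def)
    then show ?thesis using assms by (intro UN_I[of k2]) simp_all
  next
    case False
    have i: "a (idx x) \<le> x" "x < a (idx x + 1)" using idx_mem[of x] by simp_all
    then have "a (idx x) < a (k2 + 1)" "a k1 < a (idx x + 1)" using x False by linarith+
    then have "idx x \<in> {k1..k2}" unfolding a_less_iff by simp
    moreover have "x \<in> markov_interval a (idx x)" using i by (simp add: markov_interval_def)
    ultimately show ?thesis by (intro UN_I[of "idx x"])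
  qed
qed

lemma branch_eq: "x \<in> cell j \<Longrightarrow> T x = \<tau> j x"
  and branch_deriv: "x \<in> {a j..a (j + 1)} \<Longrightarrow>
    (\<tau> j has_real_derivative \<tau>' j x) (at x within {a j..a (j + 1)})"
  and branch_deriv2: "x \<in> {a j..a (j + 1)} \<Longrightarrow>
    (\<tau>' j has_real_derivative \<tau>'' j x) (at x within {a j..a (j + 1)})"
  and branch_bij: "\<exists>k1 k2. k1 \<le> k2 \<and> bij_betw (\<tau> j) {a j..a (j + 1)} {a k1..a (k2 + 1)}"
proof -
  have b: "(\<forall>x\<in>cell j. \<tau> j x = T x) \<and>
    (\<forall>x\<in>markov_interval a j. (\<tau> j has_real_derivative \<tau>' j x) (at x within markov_interval a j) \<and>
      (\<tau>' j has_real_derivative \<tau>'' j x) (at x within markov_interval a j)) \<and>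
    (\<exists>k1 k2. k1 \<le> k2 \<and> bij_betw (\<tau> j) (markov_interval a j) (\<Union>k\<in>{k1..k2}. markov_interval a k))"
    using branches unfolding markov_branches_def by (rule spec)
  show "x \<in> cell j \<Longrightarrow> T x = \<tau> j x"
    using bspec[OF conjunct1[OF b], of x] by (rule sym)
  show "x \<in> {a j..a (j + 1)} \<Longrightarrow>
    (\<tau> j has_real_derivative \<tau>' j x) (at x within {a j..a (j + 1)})"
    using conjunct1[OF bspec[OF conjunct1[OF conjunct2[OF b]]], of x]
    unfolding markov_interval_def .
  show "x \<in> {a j..a (j + 1)} \<Longrightarrow>
    (\<tau>' j has_real_derivative \<tau>'' j x) (at x within {a j..a (j + 1)})"
    using conjunct2[OF bspec[OF conjunct1[OF conjunct2[OF b]]], of x]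
    unfolding markov_interval_def .
  obtain k1 k2 where k: "k1 \<le> k2"
    "bij_betw (\<tau> j) (markov_interval a j) (\<Union>k\<in>{k1..k2}. markov_interval a k)"
    using conjunct2[OF conjunct2[OF b]] by (elim exE conjE)
  show "\<exists>k1 k2. k1 \<le> k2 \<and> bij_betw (\<tau> j) {a j..a (j + 1)} {a k1..a (k2 + 1)}"
    using k(2) unfolding UN_markov_interval[OF k(1)] unfolding markov_interval_def
    by (intro exI[of _ k1] exI[of _ k2] conjI k(1))
qed

lemma branch_cont: "continuous_on {a j..a (j + 1)} (\<tau> j)"
  and branch_deriv_cont: "continuous_on {a j..a (j + 1)} (\<tau>' j)"
  by (rule DERIV_continuous_on[OF branch_deriv] DERIV_continuous_on[OF branch_deriv2]; assumption)+

lemma branch_deriv_at: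
  assumes "x \<in> cell j"
  shows "(\<tau> j has_real_derivative \<tau>' j x) (at x)" "(\<tau>' j has_real_derivative \<tau>'' j x) (at x)"
  using branch_deriv[of x j] branch_deriv2[of x j] assms at_within_Icc_at[of "a j" x "a (j + 1)"]
  by auto

text \<open>\<tau>' is continuous, so a change of sign would force a zero. The number
  \<open>s\<close> is the orientation of the branch.\<close>

lemma branch_deriv_sign:
  "\<exists>s. (s = 1 \<or> s = -1) \<and> (\<forall>x\<in>{a j..a (j + 1)}. s * \<tau>' j x \<ge> \<Lambda>)"
proof -
  have big: "\<bar>\<tau>' j x\<bar> \<ge> \<Lambda>" if "x \<in> {a j..a (j + 1)}" for x
    using expanding[of x j] that by (simp add: markov_interval_def)
  have conn: "connected (\<tau>' j ` {a j..a (j + 1)})"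
    using branch_deriv_cont by (intro connected_continuous_image) auto
  show ?thesis
  proof (rule ccontr)
    assume *: "\<not> ?thesis"
    obtain x where x: "x \<in> {a j..a (j + 1)}" "\<tau>' j x < \<Lambda>" using * by (auto dest: spec[of _ 1])
    obtain y where y: "y \<in> {a j..a (j + 1)}" "- \<tau>' j y < \<Lambda>" using * by (auto dest: spec[of _ "-1"])
    have "\<tau>' j x \<le> 0" "0 \<le> \<tau>' j y" using big[OF x(1)] big[OF y(1)] x y Lambda_gt_1 by linarith+
    then have "0 \<in> \<tau>' j ` {a j..a (j + 1)}"
      using connected_contains_Icc[OF conn, of "\<tau>' j x" "\<tau>' j y"] x y by auto
    then obtain z where "z \<in> {a j..a (j + 1)}" "\<tau>' j z = 0" by auto
    then show False using big[of z] Lambda_gt_1 by simp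
  qed
qed

lemma branch_mvt:
  assumes "x < y" "x \<in> {a j..a (j + 1)}" "y \<in> {a j..a (j + 1)}"
  shows "\<exists>z. x < z \<and> z < y \<and> \<tau> j y - \<tau> j x = (y - x) * \<tau>' j z"
proof -
  have "continuous_on {x..y} (\<tau> j)"
    using branch_cont by (rule continuous_on_subset) (use assms in auto)
  moreover have d: "(\<tau> j has_real_derivative \<tau>' j z) (at z)" if "x < z" "z < y" for z
    using that assms by (intro branch_deriv_at) auto
  then have "\<tau> j differentiable (at z)" if "x < z" "z < y" for z
    using that real_differentiable_def by blast
  ultimately obtain l z where z: "x < z" "z < y" "DERIV (\<tau> j) z :> l" "\<tau> j y - \<tau> j x = (y - x) * l"
    using MVT[of x y "\<tau> j"] assms(1) by blast
  then have "l = \<tau>' j z" using d[of z] DERIV_unique by blast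
  then show ?thesis using z by blast
qed

lemma branch_mono:
  "\<exists>s. (s = 1 \<or> s = -1) \<and> (\<forall>x\<in>{a j..a (j + 1)}. \<forall>y\<in>{a j..a (j + 1)}. x < y \<longrightarrow>
     \<Lambda> * (y - x) \<le> s * \<tau> j y - s * \<tau> j x)"
proof -
  obtain s :: real where s: "s = 1 \<or> s = -1" "\<forall>x\<in>{a j..a (j + 1)}. s * \<tau>' j x \<ge> \<Lambda>"
    using branch_deriv_sign by blast
  have "\<Lambda> * (y - x) \<le> s * \<tau> j y - s * \<tau> j x"
    if xy: "x < y" "x \<in> {a j..a (j + 1)}" "y \<in> {a j..a (j + 1)}" for x y
  proof -
    obtain z where z: "x < z" "z < y" "\<tau> j y - \<tau> j x = (y - x) * \<tau>' j z"
      using branch_mvt[OF xy] by blast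
    have "\<Lambda> * (y - x) \<le> (s * \<tau>' j z) * (y - x)"
      using s(2) z xy by (intro mult_right_mono) auto
    also have "\<dots> = s * (\<tau> j y - \<tau> j x)" using z by simp
    finally show ?thesis by (simp add: algebra_simps)
  qed
  then show ?thesis using s(1) by blast
qed

lemma branch_expand:
  assumes "x \<in> {a j..a (j + 1)}" "y \<in> {a j..a (j + 1)}"
  shows "\<Lambda> * \<bar>x - y\<bar> \<le> \<bar>\<tau> j x - \<tau> j y\<bar>"
  using assms
proof (induction x y rule: linorder_wlog)
  case (le x y)
  obtain s :: real where s: "s = 1 \<or> s = -1"
    "\<forall>x\<in>{a j..a (j + 1)}. \<forall>y\<in>{a j..a (j + 1)}. x < y \<longrightarrow> \<Lambda> * (y - x) \<le> s * \<tau> j y - s * \<tau> j x"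
    using branch_mono by blast
  show ?case
  proof (cases "x = y")
    case False
    then have "\<Lambda> * (y - x) \<le> s * \<tau> j y - s * \<tau> j x" using s(2) le by auto
    then show ?thesis using s(1) le(1) by auto
  qed simp
qed (simp add: abs_minus_commute)

lemma branch_between:
  assumes "x \<in> {a j..a (j + 1)}" "y \<in> {a j..a (j + 1)}" "x < z" "z < y"
  shows "min (\<tau> j x) (\<tau> j y) \<le> \<tau> j z" "\<tau> j z \<le> max (\<tau> j x) (\<tau> j y)"
proof -
  obtain s :: real where s: "s = 1 \<or> s = -1"
    "\<forall>x\<in>{a j..a (j + 1)}. \<forall>y\<in>{a j..a (j + 1)}. x < y \<longrightarrow> \<Lambda> * (y - x) \<le> s * \<tau> j y - s * \<tau> j x"
    using branch_mono by blast
  have z: "z \<in> {a j..a (j + 1)}" using assms by auto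
  have "0 \<le> \<Lambda> * (z - x)" "0 \<le> \<Lambda> * (y - z)" using assms Lambda_gt_1 by auto
  then have "s * \<tau> j x \<le> s * \<tau> j z" "s * \<tau> j z \<le> s * \<tau> j y"
    using s(2) assms z by fastforce+
  then show "min (\<tau> j x) (\<tau> j y) \<le> \<tau> j z" "\<tau> j z \<le> max (\<tau> j x) (\<tau> j y)"
    using s(1) by auto
qed

text \<open>Since \<open>\<bar>(ln \<bar>\<tau>'\<bar>)'\<bar> = \<bar>\<tau>''/\<tau>'\<bar> \<le> \<eta> \<bar>\<tau>'\<bar>\<close>, both \<open>\<eta> \<bar>\<tau>\<bar> \<plusminus> ln \<bar>\<tau>'\<bar>\<close> are monotone
  along the branch.\<close>

lemma branch_ln_deriv_lipschitz:
  assumes "x \<in> {a j..a (j + 1)}" "y \<in> {a j..a (j + 1)}"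
  shows "\<bar>ln \<bar>\<tau>' j x\<bar> - ln \<bar>\<tau>' j y\<bar>\<bar> \<le> \<eta> * \<bar>\<tau> j x - \<tau> j y\<bar>"
proof -
  obtain s :: real where s: "s = 1 \<or> s = -1" "\<forall>x\<in>{a j..a (j + 1)}. s * \<tau>' j x \<ge> \<Lambda>"
    using branch_deriv_sign by blast
  \<comment> \<open>The sign \<open>c\<close> selects one of the two functions. Monotonicity is read
    off from the sign of the derivative, so \<tau>'' is never integrated.\<close>
  have main: "c * (ln (s * \<tau>' j y) - ln (s * \<tau>' j x)) \<le> \<eta> * (s * \<tau> j y - s * \<tau> j x)"
    if xy: "x \<le> y" "x \<in> {a j..a (j + 1)}" "y \<in> {a j..a (j + 1)}" and c: "c = 1 \<or> c = -1" for x y c :: real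
  proof -
    define f where "f = (\<lambda>t. \<eta> * (s * \<tau> j t) - c * ln (s * \<tau>' j t))"
    have sub: "{x..y} \<subseteq> {a j..a (j + 1)}" using xy by simp
    have ne: "\<forall>t\<in>{x..y}. s * \<tau>' j t \<noteq> 0"
    proof
      fix t assume "t \<in> {x..y}"
      then have "s * \<tau>' j t \<ge> \<Lambda>" using s(2) sub by blast
      then show "s * \<tau>' j t \<noteq> 0" using Lambda_gt_1 by linarith
    qed
    have cont: "continuous_on {x..y} f" unfolding f_def
      by (intro continuous_intros continuous_on_subset[OF branch_cont[of j] sub]
              continuous_on_subset[OF branch_deriv_cont[of j] sub] ne)
    have "f x \<le> f y"
    proof (rule DERIV_nonneg_imp_increasing_open[of x y f])
      fix t assume t: "x < t" "t < y"
      then have t': "t \<in> {a j..a (j + 1)}" "t \<in> cell j" using xy by auto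
      have ge: "s * \<tau>' j t \<ge> \<Lambda>" using s(2) t'(1) by blast
      then have pos: "s * \<tau>' j t > 0" using Lambda_gt_1 by linarith
      have der: "(f has_real_derivative \<eta> * (s * \<tau>' j t) - c * (1 / (s * \<tau>' j t) * (s * \<tau>'' j t))) (at t)"
        unfolding f_def using branch_deriv_at[OF t'(2)] pos
        by (auto intro!: derivative_eq_intros)
      have "\<bar>\<tau>'' j t\<bar> \<le> \<eta> * (\<tau>' j t)\<^sup>2"
        using adler[of t j] t' pos by (auto simp: markov_interval_def abs_divide divide_le_eq split: if_splits)
      then have "\<bar>\<tau>'' j t\<bar> \<le> \<eta> * (s * \<tau>' j t) * (s * \<tau>' j t)"
        using s(1) by (auto simp: power2_eq_square)
      then have "\<bar>\<tau>'' j t\<bar> / (s * \<tau>' j t) \<le> \<eta> * (s * \<tau>' j t)"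
        using pos by (simp add: divide_le_eq)
      moreover have "c * (1 / (s * \<tau>' j t) * (s * \<tau>'' j t)) \<le> \<bar>\<tau>'' j t\<bar> / (s * \<tau>' j t)"
        using pos s(1) c by (auto simp: divide_simps abs_real_def)
      ultimately show "\<exists>D. (f has_real_derivative D) (at t) \<and> 0 \<le> D"
        using der by (intro exI conjI) auto
    qed (use xy cont in auto)
    then show ?thesis by (simp add: f_def algebra_simps)
  qed
  have ab: "\<bar>\<tau>' j t\<bar> = s * \<tau>' j t" if "t \<in> {a j..a (j + 1)}" for t
  proof -
    have "s * \<tau>' j t \<ge> \<Lambda>" using s(2) that by blast
    then have "s * \<tau>' j t > 0" using Lambda_gt_1 by linarith
    then show ?thesis using s(1) by auto
  qed
  have sa: "\<eta> * (s * u - s * v) \<le> \<eta> * \<bar>u - v\<bar>" for u v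
    using s(1) eta_pos by (intro mult_left_mono) auto
  have key: "\<bar>ln \<bar>\<tau>' j x\<bar> - ln \<bar>\<tau>' j y\<bar>\<bar> \<le> \<eta> * \<bar>\<tau> j x - \<tau> j y\<bar>"
    if "x \<le> y" "x \<in> {a j..a (j + 1)}" "y \<in> {a j..a (j + 1)}" for x y
  proof -
    have "ln (s * \<tau>' j y) - ln (s * \<tau>' j x) \<le> \<eta> * (s * \<tau> j y - s * \<tau> j x)"
      "- (ln (s * \<tau>' j y) - ln (s * \<tau>' j x)) \<le> \<eta> * (s * \<tau> j y - s * \<tau> j x)"
      using main[OF that, of 1] main[OF that, of "-1"] by simp_all
    then show ?thesis using sa[of "\<tau> j y" "\<tau> j x"]
      unfolding ab[OF that(2)] ab[OF that(3)] abs_minus_commute[of "\<tau> j x"] by linarith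
  qed
  show ?thesis
  proof (cases "x \<le> y")
    case True then show ?thesis using key assms by blast
  next
    case False
    then have "y \<le> x" by simp
    from key[OF this assms(2,1)] show ?thesis by (simp only: abs_minus_commute)
  qed
qed

lemma branch_deriv_ratio:
  assumes "x \<in> {a j..a (j + 1)}" "y \<in> {a j..a (j + 1)}" "\<bar>\<tau> j x - \<tau> j y\<bar> \<le> d"
  shows "\<bar>\<tau>' j x\<bar> \<le> exp (\<eta> * d) * \<bar>\<tau>' j y\<bar>"
proof -
  have pos: "\<bar>\<tau>' j x\<bar> > 0" "\<bar>\<tau>' j y\<bar> > 0"
    using expanding[of x j] expanding[of y j] assms Lambda_gt_1 by (auto simp: markov_interval_def)
  have "ln \<bar>\<tau>' j x\<bar> \<le> ln \<bar>\<tau>' j y\<bar> + \<eta> * \<bar>\<tau> j x - \<tau> j y\<bar>"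
    using branch_ln_deriv_lipschitz[OF assms(1,2)] by linarith
  also have "\<dots> \<le> ln \<bar>\<tau>' j y\<bar> + \<eta> * d" using assms(3) eta_pos by simp
  finally have "exp (ln \<bar>\<tau>' j x\<bar>) \<le> exp (ln \<bar>\<tau>' j y\<bar> + \<eta> * d)" by simp
  then show ?thesis using pos by (simp add: exp_add mult.commute)
qed

text \<open>By the mean value theorem both slopes are values of \<tau>', at points whose images lie
  between the images of the respective pair and are therefore at most \<open>d\<close> apart. The
  products replace quotients, so coinciding points are no exception.\<close>

lemma branch_slope_ratio:
  assumes mem: "x \<in> {a j..a (j + 1)}" "y \<in> {a j..a (j + 1)}" "u \<in> {a j..a (j + 1)}" "v \<in> {a j..a (j + 1)}"
    and d: "\<bar>\<tau> j x - \<tau> j u\<bar> \<le> d" "\<bar>\<tau> j x - \<tau> j v\<bar> \<le> d" "\<bar>\<tau> j y - \<tau> j u\<bar> \<le> d" "\<bar>\<tau> j y - \<tau> j v\<bar> \<le> d"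
  shows "\<bar>\<tau> j x - \<tau> j y\<bar> * \<bar>u - v\<bar> \<le> exp (\<eta> * d) * (\<bar>\<tau> j u - \<tau> j v\<bar> * \<bar>x - y\<bar>)"
proof -
  have mv: "\<exists>z\<in>{a j..a (j + 1)}. \<bar>\<tau> j x - \<tau> j y\<bar> = \<bar>x - y\<bar> * \<bar>\<tau>' j z\<bar> \<and>
      min (\<tau> j x) (\<tau> j y) \<le> \<tau> j z \<and> \<tau> j z \<le> max (\<tau> j x) (\<tau> j y)"
    if xy: "x \<in> {a j..a (j + 1)}" "y \<in> {a j..a (j + 1)}" for x y
    using xy
  proof (induction x y rule: linorder_wlog)
    case (le x y)
    show ?case
    proof (cases "x = y")
      case True then show ?thesis using le by auto
    next
      case False
      then have "x < y" using le by simp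
      then obtain z where z: "x < z" "z < y" "\<tau> j y - \<tau> j x = (y - x) * \<tau>' j z"
        using branch_mvt le by blast
      have "\<bar>\<tau> j x - \<tau> j y\<bar> = \<bar>y - x\<bar> * \<bar>\<tau>' j z\<bar>"
        by (subst abs_minus_commute) (simp add: z(3) abs_mult)
      then show ?thesis using z(1,2) branch_between[OF le(2,3) z(1,2)] le
        by (intro bexI[of _ z]) (auto simp: abs_minus_commute)
    qed
  qed (simp add: abs_minus_commute min.commute max.commute)
  obtain z where z: "z \<in> {a j..a (j + 1)}" "\<bar>\<tau> j x - \<tau> j y\<bar> = \<bar>x - y\<bar> * \<bar>\<tau>' j z\<bar>"
      "min (\<tau> j x) (\<tau> j y) \<le> \<tau> j z" "\<tau> j z \<le> max (\<tau> j x) (\<tau> j y)"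
    using mv[OF mem(1,2)] by blast
  obtain w where w: "w \<in> {a j..a (j + 1)}" "\<bar>\<tau> j u - \<tau> j v\<bar> = \<bar>u - v\<bar> * \<bar>\<tau>' j w\<bar>"
      "min (\<tau> j u) (\<tau> j v) \<le> \<tau> j w" "\<tau> j w \<le> max (\<tau> j u) (\<tau> j v)"
    using mv[OF mem(3,4)] by blast
  have "\<bar>\<tau> j z - \<tau> j w\<bar> \<le> d" using z(3,4) w(3,4) d by (auto simp: min_def max_def abs_le_iff split: if_splits)
  then have "\<bar>\<tau>' j z\<bar> \<le> exp (\<eta> * d) * \<bar>\<tau>' j w\<bar>" by (rule branch_deriv_ratio[OF z(1) w(1)])
  then have "(\<bar>x - y\<bar> * \<bar>u - v\<bar>) * \<bar>\<tau>' j z\<bar> \<le> (\<bar>x - y\<bar> * \<bar>u - v\<bar>) * (exp (\<eta> * d) * \<bar>\<tau>' j w\<bar>)"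
    by (intro mult_left_mono) auto
  then show ?thesis unfolding z(2) w(2) by (simp add: mult_ac)
qed

text \<open>The constant depends on the branch, since |\<tau>'| has no common upper bound. It serves
  to show that \<open>T\<close> maps null sets to null sets.\<close>

lemma branch_lipschitz:
  "\<exists>L\<ge>0. \<forall>x\<in>{a j..a (j + 1)}. \<forall>y\<in>{a j..a (j + 1)}. \<bar>\<tau> j x - \<tau> j y\<bar> \<le> L * \<bar>x - y\<bar>"
proof -
  have "compact (\<tau>' j ` {a j..a (j + 1)})"
    using branch_deriv_cont by (intro compact_continuous_image) auto
  then obtain B where B: "\<And>z. z \<in> {a j..a (j + 1)} \<Longrightarrow> \<bar>\<tau>' j z\<bar> \<le> B"
    using compact_imp_bounded bounded_iff by (metis (no_types, lifting) image_eqI real_norm_def)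
  have B0: "B \<ge> 0" using B[of "a j"] by auto
  have "\<bar>\<tau> j x - \<tau> j y\<bar> \<le> B * \<bar>x - y\<bar>" if "x \<in> {a j..a (j + 1)}" "y \<in> {a j..a (j + 1)}" for x y
    using that
  proof (induction x y rule: linorder_wlog)
    case (le x y)
    show ?case
    proof (cases "x = y")
      case False
      then obtain z where z: "x < z" "z < y" "\<tau> j y - \<tau> j x = (y - x) * \<tau>' j z"
        using branch_mvt[of x y j] le by force
      have "\<bar>\<tau> j x - \<tau> j y\<bar> = \<bar>\<tau>' j z\<bar> * \<bar>x - y\<bar>"
        by (subst abs_minus_commute) (simp add: z(3) abs_mult abs_minus_commute)
      also have "\<dots> \<le> B * \<bar>x - y\<bar>" using B[of z] z le by (intro mult_right_mono) auto
      finally show ?thesis .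
    qed simp
  qed (simp add: abs_minus_commute)
  then show ?thesis using B0 by blast
qed

lemma branch_image_cell:
  "\<exists>k1 k2. k1 \<le> k2 \<and> \<tau> j ` {a j..a (j + 1)} = {a k1..a (k2 + 1)} \<and> T ` cell j = {a k1<..<a (k2 + 1)}"
proof -
  obtain k1 k2 where k: "k1 \<le> k2" "bij_betw (\<tau> j) {a j..a (j + 1)} {a k1..a (k2 + 1)}"
    using branch_bij by blast
  have im: "\<tau> j ` {a j..a (j + 1)} = {a k1..a (k2 + 1)}" using k(2) by (rule bij_betw_imp_surj_on)
  obtain s :: real where s: "s = 1 \<or> s = -1"
    "\<forall>x\<in>{a j..a (j + 1)}. \<forall>y\<in>{a j..a (j + 1)}. x < y \<longrightarrow> \<Lambda> * (y - x) \<le> s * \<tau> j y - s * \<tau> j x"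
    using branch_mono by blast
  have mono: "s * \<tau> j x < s * \<tau> j y" if "x < y" "x \<in> {a j..a (j + 1)}" "y \<in> {a j..a (j + 1)}" for x y
  proof -
    have "0 < \<Lambda> * (y - x)" using that Lambda_gt_1 by auto
    then show ?thesis using s(2) that by fastforce
  qed
  have ja: "a j \<le> a (j + 1)" by simp
  have T: "T ` cell j = \<tau> j ` cell j" using branch_eq by auto
  have "\<tau> j ` cell j = {a k1<..<a (k2 + 1)}"
  proof (intro set_eqI iffI)
    fix y assume "y \<in> \<tau> j ` cell j"
    then obtain x where x: "x \<in> cell j" "y = \<tau> j x" by auto
    have "s * \<tau> j (a j) < s * y" "s * y < s * \<tau> j (a (j + 1))"
      using mono[of "a j" x] mono[of x "a (j + 1)"] x ja by auto
    moreover have "\<tau> j (a j) \<in> {a k1..a (k2 + 1)}" "\<tau> j (a (j + 1)) \<in> {a k1..a (k2 + 1)}"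
      unfolding im[symmetric] using ja by (auto intro!: imageI)
    ultimately show "y \<in> {a k1<..<a (k2 + 1)}" using s(1) by auto
  next
    fix y assume y: "y \<in> {a k1<..<a (k2 + 1)}"
    then have "y \<in> \<tau> j ` {a j..a (j + 1)}" using im by auto
    then obtain x where x: "x \<in> {a j..a (j + 1)}" "y = \<tau> j x" by auto
    \<comment> \<open>If \<open>x\<close> were an end point of the cell, its value would be extreme
      on the monotone branch; but the value at \<open>p\<close> is smaller and the one at
      \<open>q\<close> is larger.\<close>
    have "a k1 \<in> \<tau> j ` {a j..a (j + 1)}" "a (k2 + 1) \<in> \<tau> j ` {a j..a (j + 1)}"
      unfolding im using k(1) by auto
    then obtain p q where pq: "p \<in> {a j..a (j + 1)}" "\<tau> j p = a k1" "q \<in> {a j..a (j + 1)}" "\<tau> j q = a (k2 + 1)"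
      by auto
    have "x \<noteq> a j"
    proof
      assume e: "x = a j"
      show False using s(1) mono[of x p] mono[of x q] pq e x y by (cases "p = x"; cases "q = x") auto
    qed
    moreover have "x \<noteq> a (j + 1)"
    proof
      assume e: "x = a (j + 1)"
      show False using s(1) mono[of p x] mono[of q x] pq e x y by (cases "p = x"; cases "q = x") auto
    qed
    ultimately show "y \<in> \<tau> j ` cell j" using x by auto
  qed
  then show ?thesis using k(1) im T by (intro exI[of _ k1] exI[of _ k2]) simp
qed

lemma cell_subset_iff: "cell i \<subseteq> {a k1<..<a (k2 + 1)} \<longleftrightarrow> k1 \<le> i \<and> i \<le> k2"
  using a_less_Suc[of i] by (auto simp: greaterThanLessThan_subseteq_greaterThanLessThan)

text \<open>The image of a cell is an open interval with end points among the \<open>a k\<close>, so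
  it cannot cover another cell partially.\<close>

lemma cell_subset_image_if_meets:
  assumes "x \<in> cell j" "T x \<in> cell i"
  shows "cell i \<subseteq> T ` cell j"
proof -
  obtain k1 k2 where k: "k1 \<le> k2" "T ` cell j = {a k1<..<a (k2 + 1)}"
    using branch_image_cell by metis
  have "T x \<in> {a k1<..<a (k2 + 1)}" using k(2) assms by blast
  then have "a k1 < a (i + 1)" "a i < a (k2 + 1)"
    using assms(2) unfolding greaterThanLessThan_iff by linarith+
  then show ?thesis unfolding k(2) cell_subset_iff a_less_iff by simp
qed

lemma cell_subset_image_iff:
  "cell i \<subseteq> T ` cell j \<longleftrightarrow> markov_interval a i \<subseteq> \<tau> j ` markov_interval a j"
proof -
  obtain k1 k2 where k: "k1 \<le> k2" "\<tau> j ` {a j..a (j + 1)} = {a k1..a (k2 + 1)}"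
     "T ` cell j = {a k1<..<a (k2 + 1)}"
    using branch_image_cell by metis
  show ?thesis
    unfolding markov_interval_def k cell_subset_iff by auto
qed

lemma cell_subset_image_between:
  assumes "cell i \<subseteq> T ` cell j" "cell k \<subseteq> T ` cell j" "i \<le> l" "l \<le> k"
  shows "cell l \<subseteq> T ` cell j"
proof -
  obtain k1 k2 where k: "k1 \<le> k2" "T ` cell j = {a k1<..<a (k2 + 1)}"
    using branch_image_cell by metis
  show ?thesis using assms unfolding k cell_subset_iff by auto
qed

lemma T_inj_cell: "inj_on T (cell j)"
proof -
  obtain k1 k2 where "bij_betw (\<tau> j) {a j..a (j + 1)} {a k1..a (k2 + 1)}"
    using branch_bij by blast
  then have "inj_on (\<tau> j) (cell j)" by (auto simp: bij_betw_def intro: inj_on_subset)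
  then show ?thesis using branch_eq by (auto simp: inj_on_def)
qed

section \<open>Cylinders and bounded distortion\<close>

lemma T_borel [measurable]: "T \<in> borel_measurable borel"
proof (rule measurable_piecewise_restrict)
  let ?C = "range (\<lambda>j. {a j}) \<union> range cell"
  show "countable ?C" by auto
  show "space borel \<subseteq> \<Union>?C"
  proof
    fix x :: real
    show "x \<in> \<Union>?C"
    proof (cases "x \<in> range a")
      case False then show ?thesis using mem_cell_idx[of x] by blast
    qed auto
  qed
  fix S assume "S \<in> ?C"
  then consider j where "S = {a j}" | j where "S = cell j" by blast
  then show "T \<in> borel_measurable (restrict_space borel S)"
  proof cases
    case (2 j)
    have "continuous_on (cell j) (\<tau> j)"
      by (rule continuous_on_subset[OF branch_cont]) auto
    then have "continuous_on (cell j) T" using branch_eq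
      by (subst continuous_on_cong[OF refl]) auto
    then show ?thesis unfolding 2 by (rule borel_measurable_continuous_on_restrict)
  qed (auto intro: borel_measurable_continuous_on_restrict)
  show "S \<inter> space borel \<in> sets borel" using \<open>S \<in> ?C\<close> by auto
qed

lemma Tn_borel [measurable]: "T ^^ n \<in> borel_measurable borel"
  by (rule measurable_compose_n) measurable

lemma vimage_borel: "E \<in> sets borel \<Longrightarrow> (T ^^ n) -` E \<in> sets borel"
  using measurable_sets[OF Tn_borel, of E n] by simp

text \<open>\<open>T\<close> is continuous and injective on each cell, and the remaining points form
  a countable set. The result is needed because \<open>invariant_hull\<close> contains forward
  images.\<close>

lemma T_image_borel:
  assumes "A \<in> sets borel" shows "T ` A \<in> sets borel"
proof -
  have A: "A = (A \<inter> range a) \<union> (\<Union>j. A \<inter> cell j)"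
    using mem_cell_idx by blast
  have c: "T ` (A \<inter> cell j) \<in> sets borel" for j
  proof (rule borel_continuous_inj_image[of "a j" "a (j + 1)"])
    have "continuous_on (cell j) (\<tau> j)"
      by (rule continuous_on_subset[OF branch_cont]) auto
    then show "continuous_on (cell j) T" using branch_eq
      by (subst continuous_on_cong[OF refl]) auto
  qed (use assms T_inj_cell in auto)
  have "T ` A = T ` (A \<inter> range a) \<union> (\<Union>j. T ` (A \<inter> cell j))"
    by (subst A) blast
  moreover have "countable (T ` (A \<inter> range a))" by (intro countable_image countable_Int2) auto
  then have "T ` (A \<inter> range a) \<in> sets borel" by (rule sets.countable[rotated]) auto
  moreover have "(\<Union>j. T ` (A \<inter> cell j)) \<in> sets borel" using c by blast
  ultimately show ?thesis by simp
qed

lemma Tn_image_borel: "A \<in> sets borel \<Longrightarrow> (T ^^ n) ` A \<in> sets borel"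
proof (induction n)
  case (Suc n)
  have "(T ^^ Suc n) ` A = T ` (T ^^ n) ` A" by (simp add: image_comp)
  then show ?case using Suc T_image_borel by simp
qed simp

lemma T_cell_expand:
  assumes "x \<in> cell j" "y \<in> cell j"
  shows "\<Lambda> * \<bar>x - y\<bar> \<le> \<bar>T x - T y\<bar>"
proof -
  have "x \<in> {a j..a (j + 1)}" "y \<in> {a j..a (j + 1)}" using assms by simp_all
  then have "\<Lambda> * \<bar>x - y\<bar> \<le> \<bar>\<tau> j x - \<tau> j y\<bar>" by (rule branch_expand)
  then show ?thesis using branch_eq assms by simp
qed

text \<open>Inverse branches are Lipschitz with constant 1/\<Lambda>, and the points outside all
  cells are countable.\<close>

lemma negligible_vimage:
  assumes N: "negligible N" shows "negligible (T -` N)"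
proof -
  have "negligible (cell j \<inter> T -` N)" for j
  proof -
    define g where "g = inv_into (cell j) T"
    have g: "g (T x) = x" if "x \<in> cell j" for x
      unfolding g_def using that T_inj_cell by simp
    have "negligible (g ` (N \<inter> T ` cell j))"
    proof (rule negligible_locally_Lipschitz_image)
      show "negligible (N \<inter> T ` cell j)" using N by (rule negligible_subset) auto
      fix u assume u: "u \<in> N \<inter> T ` cell j"
      have "norm (g v - g u) \<le> 1 / \<Lambda> * norm (v - u)" if v: "v \<in> N \<inter> T ` cell j" for v
      proof -
        obtain x y where xy: "x \<in> cell j" "u = T x" "y \<in> cell j" "v = T y" using u v by blast
        have "\<Lambda> * \<bar>y - x\<bar> \<le> \<bar>v - u\<bar>" using T_cell_expand[OF xy(3,1)] xy by simp
        then show ?thesis using xy g Lambda_gt_1 by (simp add: field_simps)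
      qed
      then show "\<exists>V B. open V \<and> u \<in> V \<and> (\<forall>v\<in>N \<inter> T ` cell j \<inter> V. norm (g v - g u) \<le> B * norm (v - u))"
        by (intro exI[of _ UNIV] exI[of _ "1 / \<Lambda>"]) auto
    qed simp
    moreover have "cell j \<inter> T -` N \<subseteq> g ` (N \<inter> T ` cell j)"
    proof
      fix x assume x: "x \<in> cell j \<inter> T -` N"
      then have "x = g (T x)" "T x \<in> N \<inter> T ` cell j" using g by auto
      then show "x \<in> g ` (N \<inter> T ` cell j)" by (rule image_eqI)
    qed
    ultimately show ?thesis by (rule negligible_subset)
  qed
  then have "negligible (range a \<union> (\<Union>j. cell j \<inter> T -` N))"
    by (intro negligible_Un negligible_UN_int countable_imp_negligible[of "range a"]) auto
  then show ?thesis by (rule negligible_subset) (use mem_cell_idx in blast)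
qed

lemma negligible_image:
  assumes N: "negligible N" shows "negligible (T ` N)"
proof -
  have "negligible (T ` (cell j \<inter> N))" for j
  proof (rule negligible_locally_Lipschitz_image)
    show "negligible (cell j \<inter> N)" using N by (rule negligible_subset) auto
    obtain L where L: "\<And>x y. x \<in> {a j..a (j + 1)} \<Longrightarrow> y \<in> {a j..a (j + 1)} \<Longrightarrow> \<bar>\<tau> j x - \<tau> j y\<bar> \<le> L * \<bar>x - y\<bar>"
      using branch_lipschitz by metis
    fix u assume u: "u \<in> cell j \<inter> N"
    have "norm (T v - T u) \<le> L * norm (v - u)" if "v \<in> cell j \<inter> N" for v
      using L[of v u] u that branch_eq[of u j] branch_eq[of v j] by simp
    then show "\<exists>V B. open V \<and> u \<in> V \<and> (\<forall>v\<in>cell j \<inter> N \<inter> V. norm (T v - T u) \<le> B * norm (v - u))"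
      by (intro exI[of _ UNIV] exI[of _ L]) auto
  qed simp
  then have "negligible (T ` range a \<union> (\<Union>j. T ` (cell j \<inter> N)))"
    by (intro negligible_Un negligible_UN_int countable_imp_negligible[of "T ` range a"]) auto
  then show ?thesis by (rule negligible_subset) (use mem_cell_idx in blast)
qed

lemma negligible_vimage_Tn: "negligible N \<Longrightarrow> negligible ((T ^^ n) -` N)"
proof (induction n)
  case (Suc n)
  have "(T ^^ Suc n) -` N = T -` (T ^^ n) -` N"
    by (auto simp: funpow_swap1)
  then show ?case using Suc negligible_vimage by (simp only:)
qed simp

lemma negligible_image_Tn: "negligible N \<Longrightarrow> negligible ((T ^^ n) ` N)"
proof (induction n)
  case (Suc n)
  have "(T ^^ Suc n) ` N = T ` (T ^^ n) ` N" by (simp add: image_comp)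
  then show ?case using Suc negligible_image by (simp only:)
qed simp

lemma AE_Tn:
  assumes "AE x in lborel. P x" shows "AE x in lborel. P ((T ^^ n) x)"
  using negligible_vimage_Tn[of "{x. \<not> P x}" n] assms
  unfolding AE_lborel_iff_negligible by (simp add: vimage_def)

lemma AE_all_Tn: "AE x in lborel. P x \<Longrightarrow> AE x in lborel. \<forall>n. P ((T ^^ n) x)"
  unfolding AE_all_countable using AE_Tn by blast

lemma AE_not_range_a: "AE x in lborel. x \<notin> range a"
  unfolding AE_lborel_iff_negligible by (simp add: countable_imp_negligible)

text \<open>These points have an itinerary for all time and so lie in the cylinder of each of their
  words.\<close>

lemma AE_regular: "AE x in lborel. \<forall>n. (T ^^ n) x \<notin> range a"
  using AE_not_range_a by (rule AE_all_Tn)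

section \<open>Cylinders and the distortion of iterates\<close>

primrec cyl :: "int list \<Rightarrow> real set" where
  "cyl [] = UNIV"
| "cyl (j # w) = cell j \<inter> T -` cyl w"

lemma cyl_iff: "x \<in> cyl w \<longleftrightarrow> (\<forall>i<length w. (T ^^ i) x \<in> cell (w ! i))"
proof (induction w arbitrary: x)
  case (Cons j w)
  have "x \<in> cyl (j # w) \<longleftrightarrow> x \<in> cell j \<and> (\<forall>i<length w. (T ^^ i) (T x) \<in> cell (w ! i))"
    using Cons by simp
  also have "\<dots> \<longleftrightarrow> (\<forall>i<length (j # w). (T ^^ i) x \<in> cell ((j # w) ! i))"
    unfolding length_Cons All_less_Suc2 by (simp add: funpow_swap1)
  finally show ?case .
qed simp

lemma cyl_borel [measurable]: "cyl w \<in> sets borel"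
proof (induction w)
  case (Cons j w)
  have "T -` cyl w \<in> sets borel" using vimage_borel[OF Cons, of 1] by simp
  then show ?case by simp
qed simp

definition word :: "nat \<Rightarrow> real \<Rightarrow> int list" where
  "word n x = map (\<lambda>i. idx ((T ^^ i) x)) [0..<n]"

lemma length_word [simp]: "length (word n x) = n"
  by (simp add: word_def)

lemma word_nth [simp]: "i < n \<Longrightarrow> word n x ! i = idx ((T ^^ i) x)"
  by (simp add: word_def)

lemma last_word [simp]: "last (word (Suc n) x) = idx ((T ^^ n) x)"
  by (simp add: word_def)

lemma mem_cyl_word: "\<forall>n. (T ^^ n) x \<notin> range a \<Longrightarrow> x \<in> cyl (word n x)"
  unfolding cyl_iff using mem_cell_idx by simp

lemma mem_cyl_nth:
  assumes "x \<in> cyl w" "i < length w" shows "w ! i = idx ((T ^^ i) x)"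
  using assms idx_eq_cell unfolding cyl_iff by metis

lemma mem_cyl_eq_word:
  assumes "x \<in> cyl w" shows "w = word (length w) x"
  by (rule nth_equalityI) (use mem_cyl_nth[OF assms] in auto)

lemma cyl_disjoint: "x \<in> cyl v \<Longrightarrow> x \<in> cyl w \<Longrightarrow> length v = length w \<Longrightarrow> v = w"
  using mem_cyl_eq_word by metis

lemma cyl_subset_cell: "w \<noteq> [] \<Longrightarrow> cyl w \<subseteq> cell (hd w)"
  by (cases w) auto

text \<open>A word of length n + 1 prescribes the times 0 to n, so it is \<open>T ^^ n\<close> that
  lands in its last cell. The three claims support each other: expansion bounds the diameter of
  \<open>cyl w\<close> by \<theta>/\<Lambda>^m, which is the \<open>d\<close> of
  \<open>branch_slope_ratio\<close> for the branch put in front, and so the exponents add up to a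
  geometric sum.\<close>

lemma cyl_structure:
  assumes "w \<noteq> []" "cyl w \<noteq> {}"
  shows "(T ^^ (length w - 1)) ` cyl w = cell (last w) \<and>
    (\<forall>x\<in>cyl w. \<forall>y\<in>cyl w. \<Lambda> ^ (length w - 1) * \<bar>x - y\<bar> \<le> \<bar>(T ^^ (length w - 1)) x - (T ^^ (length w - 1)) y\<bar>) \<and>
    (\<forall>x\<in>cyl w. \<forall>y\<in>cyl w. \<forall>u\<in>cyl w. \<forall>v\<in>cyl w.
      \<bar>(T ^^ (length w - 1)) x - (T ^^ (length w - 1)) y\<bar> * \<bar>u - v\<bar> \<le>
        exp (\<eta> * \<theta> * (\<Sum>i<length w - 1. (1 / \<Lambda>) ^ i)) *
        (\<bar>(T ^^ (length w - 1)) u - (T ^^ (length w - 1)) v\<bar> * \<bar>x - y\<bar>))"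
  using assms
proof (induction w rule: list_nonempty_induct)
  case (single j)
  then show ?case by (simp add: mult.commute)
next
  case (cons j w)
  define m where "m = length w - 1"
  have len: "length (j # w) - 1 = Suc m" using cons.hyps by (cases w) (auto simp: m_def)
  have "\<exists>x. x \<in> cell j \<inter> T -` cyl w" using cons.prems unfolding cyl.simps by blast
  then obtain x0 where x0: "x0 \<in> cell j" "T x0 \<in> cyl w" by blast
  then have "cyl w \<noteq> {}" by auto
  note IH = cons.IH[OF this, folded m_def]
  note IH1 = conjunct1[OF IH] and IH2 = conjunct1[OF conjunct2[OF IH], rule_format]
    and IH3 = conjunct2[OF conjunct2[OF IH], rule_format]
  have sub: "cyl w \<subseteq> cell (hd w)" using cons.hyps by (rule cyl_subset_cell)
  have "cell (hd w) \<subseteq> T ` cell j"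
    using x0 sub by (intro cell_subset_image_if_meets[of x0]) auto
  then have im: "T ` cyl (j # w) = cyl w" using sub unfolding cyl.simps by blast
  have Tm: "(T ^^ Suc m) x = (T ^^ m) (T x)" for x by (simp add: funpow_swap1)
  have memc: "x \<in> cell j" "T x \<in> cyl w" if "x \<in> cyl (j # w)" for x using that by auto
  have Lpos: "\<Lambda> ^ m > 0" using Lambda_gt_1 by simp
  have dist: "\<bar>p - q\<bar> \<le> \<theta> * (1 / \<Lambda>) ^ m" if pq: "p \<in> cyl w" "q \<in> cyl w" for p q
  proof -
    have "(T ^^ m) p \<in> cell (last w)" "(T ^^ m) q \<in> cell (last w)" unfolding IH1[symmetric] using pq by blast+
    then have "\<bar>(T ^^ m) p - (T ^^ m) q\<bar> \<le> \<theta>"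
      using gap_le[of "last w"] unfolding greaterThanLessThan_iff by linarith
    then have "\<Lambda> ^ m * \<bar>p - q\<bar> \<le> \<theta>" using IH2[OF pq] by linarith
    then show ?thesis using Lpos by (simp add: power_one_over field_simps)
  qed
  show ?case unfolding len
  proof (intro conjI ballI)
    have "(T ^^ Suc m) ` cyl (j # w) = (T ^^ m) ` T ` cyl (j # w)"
      unfolding image_image Tm ..
    then show "(T ^^ Suc m) ` cyl (j # w) = cell (last (j # w))"
      unfolding im IH1 using cons.hyps by simp
  next
    fix x y assume xy: "x \<in> cyl (j # w)" "y \<in> cyl (j # w)"
    have "\<Lambda> ^ Suc m * \<bar>x - y\<bar> = \<Lambda> ^ m * (\<Lambda> * \<bar>x - y\<bar>)" by simp
    also have "\<dots> \<le> \<Lambda> ^ m * \<bar>T x - T y\<bar>"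
      using Lpos memc[OF xy(1)] memc[OF xy(2)] by (intro mult_left_mono T_cell_expand) auto
    also have "\<dots> \<le> \<bar>(T ^^ Suc m) x - (T ^^ Suc m) y\<bar>"
      unfolding Tm by (rule IH2[OF memc(2)[OF xy(1)] memc(2)[OF xy(2)]])
    finally show "\<Lambda> ^ Suc m * \<bar>x - y\<bar> \<le> \<bar>(T ^^ Suc m) x - (T ^^ Suc m) y\<bar>" .
  next
    fix x y u v assume mem: "x \<in> cyl (j # w)" "y \<in> cyl (j # w)" "u \<in> cyl (j # w)" "v \<in> cyl (j # w)"
    note mx = memc[OF mem(1)] and my = memc[OF mem(2)] and mu = memc[OF mem(3)] and mv = memc[OF mem(4)]
    let ?P = "\<bar>(T ^^ m) (T x) - (T ^^ m) (T y)\<bar>" and ?Q = "\<bar>(T ^^ m) (T u) - (T ^^ m) (T v)\<bar>"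
    let ?E = "exp (\<eta> * \<theta> * (\<Sum>i<m. (1 / \<Lambda>) ^ i))" and ?e = "exp (\<eta> * (\<theta> * (1 / \<Lambda>) ^ m))"
    have A: "?P * \<bar>T u - T v\<bar> \<le> ?E * (?Q * \<bar>T x - T y\<bar>)"
      by (rule IH3[OF mx(2) my(2) mu(2) mv(2)])
    have cl: "z \<in> {a j..a (j + 1)}" if "z \<in> cell j" for z using that by auto
    have B: "\<bar>T x - T y\<bar> * \<bar>u - v\<bar> \<le> ?e * (\<bar>T u - T v\<bar> * \<bar>x - y\<bar>)"
      using branch_slope_ratio[OF cl[OF mx(1)] cl[OF my(1)] cl[OF mu(1)] cl[OF mv(1)], of "\<theta> * (1 / \<Lambda>) ^ m"]
        dist[OF mx(2) mu(2)] dist[OF mx(2) mv(2)] dist[OF my(2) mu(2)] dist[OF my(2) mv(2)]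
      unfolding branch_eq[OF mx(1), symmetric] branch_eq[OF my(1), symmetric]
        branch_eq[OF mu(1), symmetric] branch_eq[OF mv(1), symmetric] by this
    have "?P * \<bar>u - v\<bar> \<le> ?E * ?e * (?Q * \<bar>x - y\<bar>)"
    \<comment> \<open>A chain rule for slopes: the inequalities \<open>A\<close> and
      \<open>B\<close> are multiplied and |T u - T v| is cancelled, which is positive by expansion.
      For \<open>u = v\<close> both sides vanish.\<close>
    proof (cases "u = v")
      case False
      have pos: "\<bar>T u - T v\<bar> > 0"
      proof -
        have "0 < \<Lambda> * \<bar>u - v\<bar>" using False Lambda_gt_1 by simp
        then show ?thesis using T_cell_expand[OF mu(1) mv(1)] by linarith
      qed
      have "(?P * \<bar>T u - T v\<bar>) * \<bar>u - v\<bar> \<le> (?E * (?Q * \<bar>T x - T y\<bar>)) * \<bar>u - v\<bar>"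
        using A by (intro mult_right_mono) auto
      also have "\<dots> = (?E * ?Q) * (\<bar>T x - T y\<bar> * \<bar>u - v\<bar>)" by (simp only: mult_ac)
      also have "\<dots> \<le> (?E * ?Q) * (?e * (\<bar>T u - T v\<bar> * \<bar>x - y\<bar>))"
        using B by (intro mult_left_mono) auto
      finally have "(?P * \<bar>u - v\<bar>) * \<bar>T u - T v\<bar> \<le> (?E * ?e * (?Q * \<bar>x - y\<bar>)) * \<bar>T u - T v\<bar>"
        by (simp only: mult_ac)
      then show ?thesis using pos by (rule mult_right_le_imp_le)
    qed simp
    also have "?E * ?e = exp (\<eta> * \<theta> * (\<Sum>i<Suc m. (1 / \<Lambda>) ^ i))"
      unfolding exp_add[symmetric] by (simp add: algebra_simps)
    finally show "\<bar>(T ^^ Suc m) x - (T ^^ Suc m) y\<bar> * \<bar>u - v\<bar> \<le>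
        exp (\<eta> * \<theta> * (\<Sum>i<Suc m. (1 / \<Lambda>) ^ i)) * (\<bar>(T ^^ Suc m) u - (T ^^ Suc m) v\<bar> * \<bar>x - y\<bar>)"
      unfolding Tm .
  qed
qed

text \<open>The exponents of \<open>cyl_structure\<close> stay below \<eta> \<theta> times the full
  geometric series, whose sum is \<Lambda>/(\<Lambda> - 1).\<close>

definition K :: real where
  "K = exp (\<eta> * \<theta> * (\<Lambda> / (\<Lambda> - 1)))"

lemma K_ge_1: "K \<ge> 1"
  unfolding K_def using eta_pos theta_pos Lambda_gt_1 by (intro one_le_exp_iff[THEN iffD2]) simp

lemma geometric_bound: "(\<Sum>i<n. (1 / \<Lambda>) ^ i) \<le> \<Lambda> / (\<Lambda> - 1)"
proof -
  have "(\<Sum>i<n. (1 / \<Lambda>) ^ i) = (1 - (1 / \<Lambda>) ^ n) / (1 - 1 / \<Lambda>)"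
    using Lambda_gt_1 by (subst sum_gp_strict) auto
  also have "\<dots> \<le> 1 / (1 - 1 / \<Lambda>)"
    using Lambda_gt_1 by (intro divide_right_mono) auto
  also have "\<dots> = \<Lambda> / (\<Lambda> - 1)" using Lambda_gt_1 by (simp add: field_simps)
  finally show ?thesis .
qed

context
  fixes w :: "int list" and n :: nat
  assumes w: "length w = Suc n"
begin

lemma length_w: "w \<noteq> []" "length w - 1 = n"
  using w by auto

lemma cyl_image: "cyl w \<noteq> {} \<Longrightarrow> (T ^^ n) ` cyl w = cell (last w)"
  using conjunct1[OF cyl_structure[OF length_w(1)]] unfolding length_w(2) .

lemma cyl_maps_to: "x \<in> cyl w \<Longrightarrow> (T ^^ n) x \<in> cell (last w)"
  using cyl_image by blast

lemma cyl_expand: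
  assumes "x \<in> cyl w" "y \<in> cyl w"
  shows "\<Lambda> ^ n * \<bar>x - y\<bar> \<le> \<bar>(T ^^ n) x - (T ^^ n) y\<bar>"
proof -
  have "cyl w \<noteq> {}" using assms by blast
  from conjunct1[OF conjunct2[OF cyl_structure[OF length_w(1) this]]] show ?thesis
    using assms unfolding length_w(2) by blast
qed

lemma cyl_diam:
  assumes "x \<in> cyl w" "y \<in> cyl w"
  shows "\<bar>x - y\<bar> \<le> \<theta> / \<Lambda> ^ n"
proof -
  have "\<bar>(T ^^ n) x - (T ^^ n) y\<bar> \<le> \<theta>"
    using cyl_maps_to[OF assms(1)] cyl_maps_to[OF assms(2)] gap_le[of "last w"]
    unfolding greaterThanLessThan_iff by linarith
  then have "\<Lambda> ^ n * \<bar>x - y\<bar> \<le> \<theta>" using cyl_expand[OF assms] by linarith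
  then show ?thesis using Lambda_gt_1 by (simp add: pos_le_divide_eq mult.commute)
qed

lemma cyl_slope_ratio:
  assumes "x \<in> cyl w" "y \<in> cyl w" "u \<in> cyl w" "v \<in> cyl w"
  shows "\<bar>(T ^^ n) x - (T ^^ n) y\<bar> * \<bar>u - v\<bar> \<le> K * (\<bar>(T ^^ n) u - (T ^^ n) v\<bar> * \<bar>x - y\<bar>)"
proof -
  have "cyl w \<noteq> {}" using assms by blast
  from conjunct2[OF conjunct2[OF cyl_structure[OF length_w(1) this]]]
  have "\<bar>(T ^^ n) x - (T ^^ n) y\<bar> * \<bar>u - v\<bar> \<le>
      exp (\<eta> * \<theta> * (\<Sum>i<n. (1 / \<Lambda>) ^ i)) * (\<bar>(T ^^ n) u - (T ^^ n) v\<bar> * \<bar>x - y\<bar>)"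
    using assms unfolding length_w(2) by blast
  also have "\<dots> \<le> K * (\<bar>(T ^^ n) u - (T ^^ n) v\<bar> * \<bar>x - y\<bar>)"
    unfolding K_def using geometric_bound[of n] eta_pos theta_pos
    by (intro mult_right_mono exp_le_cancel_iff[THEN iffD2] mult_left_mono) auto
  finally show ?thesis .
qed

text \<open>The number \<open>c\<close> is the slope of \<open>T ^^ n\<close> over one reference
  pair. All other slopes lie between c/K and K c, so \<open>T ^^ n\<close> on the cylinder and its
  inverse are Lipschitz with constants K c and K/c.\<close>

lemma cyl_scale:
  assumes "cyl w \<noteq> {}"
  obtains c where "c > 0"
    "\<And>E. E \<in> sets borel \<Longrightarrow>
      emeasure lborel (cyl w \<inter> (T ^^ n) -` E) \<le> ennreal (K / c) * emeasure lborel (E \<inter> cell (last w))"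
    "\<And>E. E \<in> sets borel \<Longrightarrow>
      emeasure lborel (E \<inter> cell (last w)) \<le> ennreal (K * c) * emeasure lborel (cyl w \<inter> (T ^^ n) -` E)"
proof -
  obtain p q where pq: "p \<in> cell (last w)" "q \<in> cell (last w)" "p \<noteq> q"
  proof -
    obtain p where p: "a (last w) < p" "p < a (last w + 1)" using dense[OF a_less_Suc] by blast
    obtain q where q: "a (last w) < q" "q < p" using dense[OF p(1)] by blast
    show thesis by (rule that[of p q]) (use p q in auto)
  qed
  have cellE: "\<exists>x\<in>cyl w. y = (T ^^ n) x" if "y \<in> cell (last w)" for y
    using that unfolding cyl_image[OF assms, symmetric] by blast
  obtain u v where uv: "u \<in> cyl w" "v \<in> cyl w" "p = (T ^^ n) u" "q = (T ^^ n) v"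
    using cellE[OF pq(1)] cellE[OF pq(2)] by blast
  have uvne: "\<bar>u - v\<bar> > 0" "\<bar>p - q\<bar> > 0" using pq(3) uv(3,4) by auto
  define c where "c = \<bar>p - q\<bar> / \<bar>u - v\<bar>"
  have c: "c > 0" unfolding c_def using uvne by simp
  have up: "\<bar>(T ^^ n) x - (T ^^ n) y\<bar> \<le> (K * c) * \<bar>x - y\<bar>" if "x \<in> cyl w" "y \<in> cyl w" for x y
  proof -
    have "\<bar>(T ^^ n) x - (T ^^ n) y\<bar> \<le> K * (\<bar>p - q\<bar> * \<bar>x - y\<bar>) / \<bar>u - v\<bar>"
      using cyl_slope_ratio[OF that uv(1,2)] unfolding pos_le_divide_eq[OF uvne(1)] uv(3,4) .
    then show ?thesis unfolding c_def by (simp only: times_divide_eq_right times_divide_eq_left mult.assoc)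
  qed
  have lo: "\<bar>x - y\<bar> \<le> (K / c) * \<bar>(T ^^ n) x - (T ^^ n) y\<bar>" if "x \<in> cyl w" "y \<in> cyl w" for x y
  proof -
    have "\<bar>x - y\<bar> \<le> K * (\<bar>(T ^^ n) x - (T ^^ n) y\<bar> * \<bar>u - v\<bar>) / \<bar>p - q\<bar>"
      using cyl_slope_ratio[OF uv(1,2) that]
      unfolding uv(3,4) pos_le_divide_eq[OF uvne(2)[unfolded uv(3,4)]] mult.commute[of "\<bar>x - y\<bar>"] .
    also have "\<dots> = (K / c) * \<bar>(T ^^ n) x - (T ^^ n) y\<bar>" unfolding c_def by simp
    finally show ?thesis .
  qed
  have inj: "inj_on (T ^^ n) (cyl w)"
  proof (rule inj_onI)
    fix x y assume "x \<in> cyl w" "y \<in> cyl w" "(T ^^ n) x = (T ^^ n) y"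
    then show "x = y" using lo[of x y] by simp
  qed
  have imE: "(T ^^ n) ` (cyl w \<inter> (T ^^ n) -` E) = E \<inter> cell (last w)" for E
    unfolding cyl_image[OF assms, symmetric] by blast
  have K0: "K \<ge> 0" using K_ge_1 by simp
  show thesis
  proof (rule that[OF c])
    fix E :: "real set" assume E: "E \<in> sets borel"
    have m: "cyl w \<inter> (T ^^ n) -` E \<in> sets borel" using vimage_borel[OF E] by simp
    show "emeasure lborel (E \<inter> cell (last w)) \<le> ennreal (K * c) * emeasure lborel (cyl w \<inter> (T ^^ n) -` E)"
      unfolding imE[symmetric]
    proof (rule emeasure_lipschitz_image_le[OF m])
      show "0 \<le> K * c" using K0 c by simp
    qed (blast intro: up)
    define g where "g = inv_into (cyl w) (T ^^ n)"
    have g: "g ((T ^^ n) x) = x" if "x \<in> cyl w" for x using that inj by (simp add: g_def)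
    have gim: "cyl w \<inter> (T ^^ n) -` E = g ` (E \<inter> cell (last w))"
    proof (intro set_eqI iffI)
      fix x assume x: "x \<in> cyl w \<inter> (T ^^ n) -` E"
      then have "(T ^^ n) x \<in> E \<inter> cell (last w)" unfolding imE[symmetric] by (rule imageI)
      moreover have "x = g ((T ^^ n) x)" using g x by simp
      ultimately show "x \<in> g ` (E \<inter> cell (last w))" by (rule rev_image_eqI)
    next
      fix x assume "x \<in> g ` (E \<inter> cell (last w))"
      then obtain z where "z \<in> cyl w \<inter> (T ^^ n) -` E" "x = g ((T ^^ n) z)"
        unfolding imE[symmetric] by blast
      then show "x \<in> cyl w \<inter> (T ^^ n) -` E" using g by simp
    qed
    show "emeasure lborel (cyl w \<inter> (T ^^ n) -` E) \<le> ennreal (K / c) * emeasure lborel (E \<inter> cell (last w))"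
      unfolding gim
    proof (rule emeasure_lipschitz_image_le)
      fix y z assume "y \<in> E \<inter> cell (last w)" "z \<in> E \<inter> cell (last w)"
      then obtain y' z' where "y' \<in> cyl w" "y = (T ^^ n) y'" "z' \<in> cyl w" "z = (T ^^ n) z'"
        using cellE[of y] cellE[of z] by blast
      then show "\<bar>g y - g z\<bar> \<le> (K / c) * \<bar>y - z\<bar>" using lo[of y' z'] by (simp only: g)
    next
      show "E \<inter> cell (last w) \<in> sets borel" using E by simp
      show "0 \<le> K / c" using K0 c by simp
    qed
  qed
qed

end

lemma fmeasurable_subset_cell: "A \<in> sets borel \<Longrightarrow> A \<subseteq> cell j \<Longrightarrow> A \<in> fmeasurable lborel"
  by (rule fmeasurableI2[of "cell j"]) (auto simp: fmeasurable_def)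

lemma measure_cell: "measure lborel (cell j) = a (j + 1) - a j"
  by simp

lemma cyl_fmeasurable: "w \<noteq> [] \<Longrightarrow> E \<in> sets borel \<Longrightarrow> cyl w \<inter> E \<in> fmeasurable lborel"
  using cyl_subset_cell[of w] by (intro fmeasurable_subset_cell[of _ "hd w"]) auto

text \<open>Using \<open>cyl_scale\<close> once for \<open>E\<close> and once for the whole line
  eliminates the unknown scale \<open>c\<close>; each use costs a factor \<open>K\<close>. Products
  instead of proportions admit empty cylinders.\<close>

lemma cyl_measure_bounds:
  assumes w: "length w = Suc n" and E: "E \<in> sets borel"
  shows "measure lborel (cyl w \<inter> (T ^^ n) -` E) * (a (last w + 1) - a (last w)) \<le>
           K\<^sup>2 * measure lborel (E \<inter> cell (last w)) * measure lborel (cyl w)"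
    and "measure lborel (E \<inter> cell (last w)) * measure lborel (cyl w) \<le>
           K\<^sup>2 * measure lborel (cyl w \<inter> (T ^^ n) -` E) * (a (last w + 1) - a (last w))"
proof -
  let ?P = "measure lborel (cyl w \<inter> (T ^^ n) -` E)" and ?e = "measure lborel (E \<inter> cell (last w))"
    and ?g = "a (last w + 1) - a (last w)" and ?C = "measure lborel (cyl w)"
  have "?P * ?g \<le> K\<^sup>2 * ?e * ?C \<and> ?e * ?C \<le> K\<^sup>2 * ?P * ?g"
  proof (cases "cyl w = {}")
    case False
    obtain c where c: "c > 0"
      "\<And>E. E \<in> sets borel \<Longrightarrow>
        emeasure lborel (cyl w \<inter> (T ^^ n) -` E) \<le> ennreal (K / c) * emeasure lborel (E \<inter> cell (last w))"
      "\<And>E. E \<in> sets borel \<Longrightarrow>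
        emeasure lborel (E \<inter> cell (last w)) \<le> ennreal (K * c) * emeasure lborel (cyl w \<inter> (T ^^ n) -` E)"
      using cyl_scale[OF w False] by metis
    have wne: "w \<noteq> []" using w by auto
    have Kc: "K / c \<ge> 0" "K * c \<ge> 0" using c K_ge_1 by auto
    have f: "cyl w \<inter> (T ^^ n) -` F \<in> fmeasurable lborel" "F \<inter> cell (last w) \<in> fmeasurable lborel"
      if "F \<in> sets borel" for F
      using that cyl_fmeasurable[OF wne vimage_borel[OF that]]
      by (auto intro: fmeasurable_subset_cell)
    have b: "measure lborel (cyl w \<inter> (T ^^ n) -` F) \<le> K / c * measure lborel (F \<inter> cell (last w))"
      "measure lborel (F \<inter> cell (last w)) \<le> K * c * measure lborel (cyl w \<inter> (T ^^ n) -` F)"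
      if "F \<in> sets borel" for F
      using c(2,3)[OF that] f[OF that] Kc by (blast intro: measure_le_of_emeasure_le)+
    have U: "?C \<le> K / c * ?g" "?g \<le> K * c * ?C" using b[of UNIV] by simp_all
    have "?P * ?g \<le> (K / c * ?e) * (K * c * ?C)"
      using b(1)[OF E] U(2) gap_pos[of "last w"] Kc
      by (intro mult_mono mult_nonneg_nonneg[OF Kc(1)]) auto
    moreover have "?e * ?C \<le> (K * c * ?P) * (K / c * ?g)"
      using b(2)[OF E] U(1) Kc by (intro mult_mono mult_nonneg_nonneg[OF Kc(2)]) auto
    ultimately show ?thesis using c(1) by (simp add: power2_eq_square mult_ac)
  qed simp
  then show "?P * ?g \<le> K\<^sup>2 * ?e * ?C" "?e * ?C \<le> K\<^sup>2 * ?P * ?g" by auto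
qed

section \<open>Lebesgue density along cylinders\<close>

lemma ex_cell_pos:
  assumes A: "A \<in> sets borel" "emeasure lborel A > 0"
  shows "\<exists>j. emeasure lborel (A \<inter> cell j) > 0"
proof (rule ccontr)
  assume "\<not> ?thesis"
  then have "A \<inter> cell j \<in> null_sets lborel" for j
    using A by (intro null_setsI) (auto simp: zero_less_iff_neq_zero)
  then have "(\<Union>j. A \<inter> cell j) \<in> null_sets lborel" by (rule null_sets_UN)
  moreover have "range a \<in> null_sets lborel" by (rule countable_imp_null_set_lborel) simp
  ultimately have "(\<Union>j. A \<inter> cell j) \<union> range a \<in> null_sets lborel" by (rule null_sets.Un)
  moreover have "A \<subseteq> (\<Union>j. A \<inter> cell j) \<union> range a" using mem_cell_idx by blast
  ultimately have "A \<in> null_sets lborel" using A(1) null_sets_subset by (metis sets_lborel)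
  then show False using A(2) by auto
qed

lemma disjoint_family_cyl_length: "disjoint_family_on cyl {w. length w = n \<and> P w}"
  unfolding disjoint_family_on_def using cyl_disjoint by blast

lemma cyl_union_emeasure_le:
  assumes S: "disjoint_family_on cyl S" and B: "B \<in> sets borel"
    and le: "\<And>w. w \<in> S \<Longrightarrow> c * emeasure lborel (cyl w) \<le> emeasure lborel (cyl w \<inter> B)"
  shows "c * emeasure lborel (\<Union>w\<in>S. cyl w) \<le> emeasure lborel ((\<Union>w\<in>S. cyl w) \<inter> B)"
proof -
  have "c * emeasure lborel (\<Union>w\<in>S. cyl w) \<le> emeasure lborel (\<Union>w\<in>S. cyl w \<inter> B)"
    using S B le by (intro emeasure_disjoint_UN_mono) (auto simp: disjoint_family_on_def)
  also have "(\<Union>w\<in>S. cyl w \<inter> B) = (\<Union>w\<in>S. cyl w) \<inter> B" by blast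
  finally show ?thesis .
qed

lemma cyl_union_borel: "(\<Union>w\<in>S. cyl w) \<in> sets borel"
  by (intro sets.countable_UN') auto

text \<open>If every cylinder of \<open>S\<close> had at least the proportion \<open>e\<close>
  outside \<open>B\<close>, so would their disjoint union. The empty word is excluded because its
  cylinder is the whole line, to which \<open>measure\<close> gives the default value 0.\<close>

lemma ex_dense_cyl:
  assumes S: "disjoint_family_on cyl S" "[] \<notin> S" and B: "B \<in> sets borel" and e: "e > 0"
    and less: "emeasure lborel ((\<Union>w\<in>S. cyl w) - B) < ennreal e * emeasure lborel (\<Union>w\<in>S. cyl w)"
  shows "\<exists>w\<in>S. measure lborel (cyl w - B) < e * measure lborel (cyl w)"
proof (rule ccontr)
  assume contr: "\<not> ?thesis"
  have "ennreal e * emeasure lborel (cyl w) \<le> emeasure lborel (cyl w \<inter> - B)" if w: "w \<in> S" for w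
  proof -
    have "w \<noteq> []" using w S by auto
    then have f: "cyl w \<in> fmeasurable lborel" "cyl w - B \<in> fmeasurable lborel"
      using cyl_fmeasurable[of w UNIV] cyl_fmeasurable[of w "- B"] B by (simp_all add: Diff_eq)
    have "e * measure lborel (cyl w) \<le> measure lborel (cyl w - B)" using contr w by force
    then have "ennreal (e * measure lborel (cyl w)) \<le> ennreal (measure lborel (cyl w - B))"
      by (rule ennreal_leI)
    then show ?thesis using f e by (simp add: emeasure_eq_measure2 ennreal_mult Diff_eq)
  qed
  then have "ennreal e * emeasure lborel (\<Union>w\<in>S. cyl w) \<le> emeasure lborel ((\<Union>w\<in>S. cyl w) \<inter> - B)"
    using S B by (intro cyl_union_emeasure_le) auto
  then show False using less by (simp add: Diff_eq)
qed

lemma eventually_cyl_subset_open: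
  assumes x: "\<forall>n. (T ^^ n) x \<notin> range a" and U: "open U" "x \<in> U"
  shows "\<forall>\<^sub>F n in sequentially. cyl (word (Suc n) x) \<subseteq> U"
proof -
  obtain e where e: "e > 0" "ball x e \<subseteq> U" using U open_contains_ball by blast
  have "(\<lambda>n. \<theta> * (1 / \<Lambda>) ^ n) \<longlonglongrightarrow> \<theta> * 0"
    using Lambda_gt_1 by (intro tendsto_mult tendsto_const LIMSEQ_power_zero) auto
  then have "\<forall>\<^sub>F n in sequentially. \<theta> * (1 / \<Lambda>) ^ n < e"
    using e(1) by (simp add: order_tendstoD(2))
  then show ?thesis
  proof eventually_elim
    case (elim n)
    show ?case
    proof
      fix y assume "y \<in> cyl (word (Suc n) x)"
      then have "\<bar>x - y\<bar> \<le> \<theta> / \<Lambda> ^ n"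
        using mem_cyl_word[OF x] by (intro cyl_diam[of "word (Suc n) x"]) auto
      then have "\<bar>x - y\<bar> < e" using elim by (simp add: power_one_over)
      then show "y \<in> U" using e(2) by (auto simp: dist_real_def)
    qed
  qed
qed

text \<open>A version of the Lebesgue density theorem along cylinders: most of an open set close to \<open>A\<close>
  is exhausted by the cylinders of a given large length that it contains.\<close>

lemma eventually_ex_dense_cyl:
  assumes A: "A \<in> sets borel" "emeasure lborel A > 0" and e: "e > 0"
  shows "\<forall>\<^sub>F n in sequentially. \<exists>w. length w = Suc n \<and>
           measure lborel (cyl w - A) < e * measure lborel (cyl w)"
proof -
  obtain j where j: "emeasure lborel (A \<inter> cell j) > 0" using ex_cell_pos A by blast
  define A' where "A' = A \<inter> cell j"
  have A': "A' \<in> fmeasurable lborel" "A' \<in> sets borel"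
    using A by (auto simp: A'_def intro: fmeasurable_subset_cell)
  define m where "m = measure lborel A'"
  have m: "m > 0" using j A' by (simp add: m_def A'_def[symmetric] emeasure_eq_measure2)
  \<comment> \<open>The bound is chosen against \<open>G n\<close> below: once \<open>G n\<close>
    has measure above m/2, the excess of \<open>U\<close> is less than \<open>e\<close> times the
    measure of \<open>V n\<close>.\<close>
  obtain U where U: "open U" "A' \<subseteq> U" "emeasure lborel (U - A') < ennreal (e * (m / 2))"
    using outer_regular_lborel[OF A'(2), of "e * (m / 2)"] e m by auto
  define S where "S n = {w. length w = Suc n \<and> cyl w \<subseteq> U}" for n
  define V where "V n = (\<Union>w\<in>S n. cyl w)" for n
  have V: "V n \<in> sets borel" "V n \<subseteq> U" for n
    unfolding V_def by (auto intro!: cyl_union_borel simp: S_def)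
  \<comment> \<open>Asking for all later lengths makes \<open>G\<close> increasing by construction;
    since cylinders shrink to points, it exhausts \<open>A'\<close> up to a null set.\<close>
  define G where "G n = A' \<inter> (\<Inter>m\<in>{n..}. V m)" for n
  have G: "G n \<in> sets borel" for n
    unfolding G_def using A' V by (intro sets.Int sets.countable_INT'') auto
  have inc: "incseq G" by (rule incseq_SucI) (auto simp: G_def)
  have UG: "(\<Union>n. G n) \<subseteq> A'" by (auto simp: G_def)
  have UGm: "(\<Union>n. G n) \<in> sets borel" using G by auto
  have "AE x in lborel. x \<in> A' \<longrightarrow> x \<in> (\<Union>n. G n)"
    using AE_regular
  proof eventually_elim
    case (elim x)
    show ?case
    proof
      assume x: "x \<in> A'"
      then have "\<forall>\<^sub>F n in sequentially. cyl (word (Suc n) x) \<subseteq> U"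
        using eventually_cyl_subset_open[OF elim U(1)] U(2) by blast
      then obtain n where n: "\<And>k. k \<ge> n \<Longrightarrow> cyl (word (Suc k) x) \<subseteq> U"
        unfolding eventually_sequentially by blast
      have "x \<in> V k" if "k \<ge> n" for k
        unfolding V_def S_def using n[OF that] mem_cyl_word[OF elim, of "Suc k"]
        by (intro UN_I[of "word (Suc k) x"]) auto
      then show "x \<in> (\<Union>n. G n)" using x by (auto simp: G_def)
    qed
  qed
  then have "measure lborel (\<Union>n. G n) = m"
    unfolding m_def using UG UGm A' by (intro measure_eq_AE) auto
  moreover have "emeasure lborel (\<Union>n. G n) \<noteq> \<infinity>"
    using fmeasurableI2[OF A'(1) UG] UGm by (auto simp: fmeasurable_def)
  ultimately have "(\<lambda>n. measure lborel (G n)) \<longlonglongrightarrow> m"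
    using Lim_measure_incseq[OF _ inc, of lborel] G by auto
  then have "\<forall>\<^sub>F n in sequentially. m / 2 < measure lborel (G n)"
    using m by (intro order_tendstoD(1)) auto
  then show ?thesis
  proof eventually_elim
    case (elim n)
    have Gn: "G n \<subseteq> A'" "G n \<subseteq> V n" by (auto simp: G_def)
    have "emeasure lborel (V n - A) \<le> emeasure lborel (U - A')"
      using V(2)[of n] U(1) A' by (intro emeasure_mono) (auto simp: A'_def)
    also have "\<dots> < ennreal (e * (m / 2))" by (rule U(3))
    also have "\<dots> \<le> ennreal (e * measure lborel (G n))"
      using elim e by (intro ennreal_leI mult_left_mono) auto
    also have "\<dots> = ennreal e * emeasure lborel (G n)"
      using fmeasurableI2[OF A'(1) Gn(1)] G e by (simp add: emeasure_eq_measure2 ennreal_mult)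
    also have "\<dots> \<le> ennreal e * emeasure lborel (V n)"
      using Gn(2) V by (intro mult_left_mono emeasure_mono) auto
    finally have "\<exists>w\<in>S n. measure lborel (cyl w - A) < e * measure lborel (cyl w)"
      unfolding V_def using A e disjoint_family_cyl_length[of "Suc n"]
      by (intro ex_dense_cyl) (auto simp: S_def)
    then show ?case by (auto simp: S_def)
  qed
qed

text \<open>Bounded distortion is applied to the complement of \<open>E\<close>. The strict
  inequality in the hypothesis excludes null cylinders, so the measure of the cylinder can be
  cancelled.\<close>

lemma dense_cyl_push:
  assumes w: "length w = Suc n" and E: "E \<in> sets borel"
    and less: "measure lborel (cyl w - (T ^^ n) -` E) < e * measure lborel (cyl w)"
  shows "measure lborel (cell (last w) - E) \<le> K\<^sup>2 * e * (a (last w + 1) - a (last w))"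
proof -
  let ?C = "measure lborel (cyl w)" and ?g = "a (last w + 1) - a (last w)"
  have E': "- E \<in> sets borel" using E by auto
  have "measure lborel (- E \<inter> cell (last w)) * ?C \<le> K\<^sup>2 * measure lborel (cyl w \<inter> (T ^^ n) -` (- E)) * ?g"
    by (rule cyl_measure_bounds(2)[OF w E'])
  also have "cyl w \<inter> (T ^^ n) -` (- E) = cyl w - (T ^^ n) -` E" by auto
  also have "K\<^sup>2 * measure lborel (cyl w - (T ^^ n) -` E) * ?g \<le> K\<^sup>2 * (e * ?C) * ?g"
    using less gap_pos[of "last w"] by (intro mult_right_mono mult_left_mono) auto
  finally have "measure lborel (- E \<inter> cell (last w)) * ?C \<le> (K\<^sup>2 * e * ?g) * ?C"
    by (simp only: mult_ac)
  moreover have "?C > 0"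
  proof (rule ccontr)
    assume "\<not> ?C > 0"
    then have "?C = 0" using measure_nonneg[of lborel "cyl w"] by linarith
    then show False using less measure_nonneg[of lborel "cyl w - (T ^^ n) -` E"] by simp
  qed
  ultimately have "measure lborel (- E \<inter> cell (last w)) \<le> K\<^sup>2 * e * ?g"
    by (rule mult_right_le_imp_le)
  also have "- E \<inter> cell (last w) = cell (last w) - E" by blast
  finally show ?thesis .
qed

text \<open>By bounded distortion a fixed proportion of the points visiting \<open>I\<^sub>k\<close> at time \<open>n\<close> lies in
  \<open>T\<^sup>-\<^sup>n W\<close>, and these sets are disjoint.\<close>

lemma finite_visits:
  assumes W: "wandering T W" "emeasure lborel (W \<inter> cell k) > 0"
  shows "AE x in lborel. \<forall>\<^sub>F n in sequentially. (T ^^ n) x \<notin> cell k"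
proof -
  have Wb: "W \<in> sets borel" using W(1) by (simp add: wandering_def)
  define m where "m = measure lborel (W \<inter> cell k)"
  have m: "m > 0"
    using W(2) fmeasurable_subset_cell[of "W \<inter> cell k" k] Wb
    by (simp add: m_def emeasure_eq_measure2)
  define g where "g = a (k + 1) - a k"
  have g: "g > 0" using gap_pos[of k] by (simp add: g_def)
  \<comment> \<open>By bounded distortion T^-n W fills at least this proportion of every cylinder of
    length n + 1 that ends in \<open>k\<close>.\<close>
  define c where "c = m / (K\<^sup>2 * g)"
  have K2: "K\<^sup>2 > 0" using K_ge_1 by simp
  have c: "c > 0" using m K2 g by (simp add: c_def)
  \<comment> \<open>The preimages of a wandering set are disjoint only modulo null sets; removing
    all overlaps makes them disjoint.\<close>
  define N0 where "N0 = (\<Union>(i, l)\<in>{(i :: nat, l). i \<noteq> l}. (T ^^ i) -` W \<inter> (T ^^ l) -` W)"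
  have N0: "N0 \<in> null_sets lborel"
    unfolding N0_def
  proof (rule null_sets_UN')
    fix p :: "nat \<times> nat" assume "p \<in> {(i, l). i \<noteq> l}"
    then obtain i l where p: "p = (i, l)" "i \<noteq> l" by auto
    have "AE x in lborel. x \<notin> (T ^^ i) -` W \<inter> (T ^^ l) -` W"
      using W(1) p(2) by (simp add: wandering_def eq_mod_def)
    moreover have "(T ^^ i) -` W \<inter> (T ^^ l) -` W \<in> sets borel"
      using vimage_borel[OF Wb] by auto
    ultimately show "(case p of (i, l) \<Rightarrow> (T ^^ i) -` W \<inter> (T ^^ l) -` W) \<in> null_sets lborel"
      using p AE_iff_null_sets[of "(T ^^ i) -` W \<inter> (T ^^ l) -` W" lborel] by simp
  qed simp
  \<comment> \<open>Fixing the starting cell \<open>L\<close> keeps the total measure finite, so the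
    disjoint sets \<open>C n\<close> have summable measures.\<close>
  have cellL: "AE x in lborel. x \<in> cell L \<longrightarrow> (\<forall>\<^sub>F n in sequentially. (T ^^ n) x \<notin> cell k)" for L
  proof -
    define S where "S n = {w. length w = Suc n \<and> hd w = L \<and> last w = k}" for n
    define V where "V n = (\<Union>w\<in>S n. cyl w)" for n
    define C where "C n = cell L \<inter> (T ^^ n) -` W - N0" for n
    have VL: "V n \<subseteq> cell L" for n
    proof
      fix x assume "x \<in> V n"
      then obtain w where w: "length w = Suc n" "hd w = L" "x \<in> cyl w" by (auto simp: V_def S_def)
      then have "w \<noteq> []" by auto
      then show "x \<in> cell L" using cyl_subset_cell w by blast
    qed
    have V: "V n \<in> sets borel" for n unfolding V_def by (rule cyl_union_borel)
    have Vf: "V n \<in> fmeasurable lborel" for n using V VL by (rule fmeasurable_subset_cell)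
    have TW: "cell L \<inter> (T ^^ n) -` W \<in> sets borel" for n using vimage_borel[OF Wb] by auto
    have C: "C n \<in> sets borel" for n unfolding C_def using TW N0 by (intro sets.Diff) auto
    have "disjoint_family C"
      unfolding disjoint_family_on_def C_def N0_def by blast
    moreover have "emeasure lborel (\<Union>n. C n) \<noteq> \<infinity>"
    proof -
      have "(\<Union>n. C n) \<in> fmeasurable lborel"
      proof (rule fmeasurable_subset_cell)
        show "(\<Union>n. C n) \<in> sets borel" by (intro sets.countable_UN) (use C in auto)
        show "(\<Union>n. C n) \<subseteq> cell L" by (auto simp: C_def)
      qed
      then show ?thesis by (auto simp: fmeasurable_def)
    qed
    ultimately have sC: "summable (\<lambda>n. measure lborel (C n))"
      using measure_UNION[of C lborel] C by (auto simp: sums_iff)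
    have CW: "measure lborel (cell L \<inter> (T ^^ n) -` W) = measure lborel (C n)" for n
      unfolding C_def using TW by (intro measure_Diff_null_set[OF _ N0, symmetric]) auto
    have VC: "measure lborel (V n) \<le> (1 / c) * measure lborel (C n)" for n
    proof -
      have le: "ennreal c * emeasure lborel (cyl w) \<le> emeasure lborel (cyl w \<inter> (T ^^ n) -` W)"
        if w: "w \<in> S n" for w
      proof -
        have w': "length w = Suc n" "last w = k" "w \<noteq> []" using w by (auto simp: S_def)
        have f: "cyl w \<in> fmeasurable lborel" "cyl w \<inter> (T ^^ n) -` W \<in> fmeasurable lborel"
          using cyl_fmeasurable[OF w'(3), of UNIV] cyl_fmeasurable[OF w'(3) vimage_borel[OF Wb]] by simp_all
        have "m * measure lborel (cyl w) \<le> K\<^sup>2 * measure lborel (cyl w \<inter> (T ^^ n) -` W) * g"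
          using cyl_measure_bounds(2)[OF w'(1) Wb] unfolding w'(2) m_def g_def .
        also have "\<dots> = (K\<^sup>2 * g) * measure lborel (cyl w \<inter> (T ^^ n) -` W)" by (simp only: mult_ac)
        finally have "m * measure lborel (cyl w) / (K\<^sup>2 * g) \<le> measure lborel (cyl w \<inter> (T ^^ n) -` W)"
          using K2 g by (subst pos_divide_le_eq) (auto simp: mult_ac)
        then have "c * measure lborel (cyl w) \<le> measure lborel (cyl w \<inter> (T ^^ n) -` W)"
          by (simp add: c_def)
        then have "ennreal (c * measure lborel (cyl w)) \<le> ennreal (measure lborel (cyl w \<inter> (T ^^ n) -` W))"
          by (rule ennreal_leI)
        then show ?thesis using f c by (simp add: emeasure_eq_measure2 ennreal_mult)
      qed
      have "ennreal c * emeasure lborel (V n) \<le> emeasure lborel (V n \<inter> (T ^^ n) -` W)"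
        unfolding V_def
        using disjoint_family_cyl_length[of "Suc n"] vimage_borel[OF Wb] le
        by (intro cyl_union_emeasure_le) (auto simp: S_def)
      also have "\<dots> \<le> emeasure lborel (cell L \<inter> (T ^^ n) -` W)"
        using VL[of n] TW by (intro emeasure_mono) auto
      finally have *: "ennreal c * emeasure lborel (V n) \<le> emeasure lborel (cell L \<inter> (T ^^ n) -` W)" .
      have "cell L \<inter> (T ^^ n) -` W \<in> fmeasurable lborel"
        using TW by (rule fmeasurable_subset_cell) auto
      then have "ennreal (c * measure lborel (V n)) \<le> ennreal (measure lborel (C n))"
        using * Vf[of n] c by (simp add: emeasure_eq_measure2 ennreal_mult CW)
      then have "c * measure lborel (V n) \<le> measure lborel (C n)" by simp
      then show ?thesis using c by (simp add: pos_le_divide_eq mult.commute)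
    qed
    have "summable (\<lambda>n. measure lborel (V n))"
      by (rule summable_comparison_test'[OF summable_mult[OF sC, of "1 / c"], of 0])
         (use VC in simp)
    then have "AE x in lborel. eventually (\<lambda>n. x \<in> space lborel - V n) sequentially"
      using V Vf by (intro borel_cantelli_AE1) (auto simp: fmeasurable_def)
    then show ?thesis using AE_regular
    proof eventually_elim
      case (elim x)
      show ?case
      proof
        assume x: "x \<in> cell L"
        show "\<forall>\<^sub>F n in sequentially. (T ^^ n) x \<notin> cell k"
          using elim(1)
        proof eventually_elim
          case (elim n)
          show ?case
          proof
            assume n: "(T ^^ n) x \<in> cell k"
            have "hd (word (Suc n) x) = idx x" unfolding word_def by (simp add: upt_rec)
            then have "word (Suc n) x \<in> S n"
              using idx_eq_cell[OF n] idx_eq_cell[OF x] by (simp add: S_def)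
            moreover have "x \<in> cyl (word (Suc n) x)"
              using \<open>\<forall>n. (T ^^ n) x \<notin> range a\<close> by (rule mem_cyl_word)
            ultimately show False using elim by (auto simp: V_def)
          qed
        qed
      qed
    qed
  qed
  have "AE x in lborel. \<forall>L. x \<in> cell L \<longrightarrow> (\<forall>\<^sub>F n in sequentially. (T ^^ n) x \<notin> cell k)"
    unfolding AE_all_countable using cellL by blast
  then show ?thesis using AE_not_range_a
    by eventually_elim (use mem_cell_idx in blast)
qed

section \<open>Escaping points and the hull of the dissipative part\<close>

lemma measure_cell_split:
  assumes E: "E \<in> sets borel"
  shows "measure lborel (cell k - E) + measure lborel (E \<inter> cell k) = a (k + 1) - a k"
proof -
  have "cell k - E \<in> fmeasurable lborel" "E \<inter> cell k \<in> fmeasurable lborel"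
    using E by (auto intro: fmeasurable_subset_cell)
  then have "measure lborel ((cell k - E) \<union> (E \<inter> cell k)) = measure lborel (cell k - E) + measure lborel (E \<inter> cell k)"
    by (intro measure_Union) (auto simp: fmeasurable_def)
  moreover have "(cell k - E) \<union> (E \<inter> cell k) = cell k" by blast
  ultimately show ?thesis by (simp only: measure_cell)
qed

definition esc :: "real \<Rightarrow> real set" where
  "esc s = {x. filterlim (\<lambda>n. s * (T ^^ n) x) at_top sequentially}"

lemma esc_plus: "D_plus_inf T = esc 1"
  by (simp add: D_plus_inf_def esc_def)

lemma esc_minus: "D_minus_inf T = esc (-1)"
  by (simp add: D_minus_inf_def esc_def filterlim_uminus_at_bot)

lemma mem_esc_T [simp]: "T x \<in> esc s \<longleftrightarrow> x \<in> esc s"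
proof -
  have "(\<lambda>n. s * (T ^^ n) (T x)) = (\<lambda>n. s * (T ^^ Suc n) x)" by (simp add: funpow_swap1)
  then show ?thesis
    unfolding esc_def mem_Collect_eq by (simp only: filterlim_sequentially_Suc[of "\<lambda>n. s * (T ^^ n) x"])
qed

lemma mem_esc_Tn [simp]: "(T ^^ n) x \<in> esc s \<longleftrightarrow> x \<in> esc s"
  by (induction n) auto

lemma esc_borel [measurable]: "esc s \<in> sets borel"
proof -
  have "esc s = {x. \<forall>Z::nat. \<exists>N. \<forall>n\<ge>N. real Z \<le> s * (T ^^ n) x}"
    unfolding esc_def filterlim_at_top eventually_sequentially
    by (auto, meson order_trans real_arch_simple)
  also have "\<dots> \<in> sets borel" by measurable
  finally show ?thesis .
qed

lemma esc_invariant: "invariant_set T (esc s)"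
proof -
  have "T -` esc s = esc s" by auto
  then show ?thesis by (simp add: invariant_set_def eq_mod_def)
qed

lemma esc_eventually_gt: "x \<in> esc s \<Longrightarrow> \<forall>\<^sub>F n in sequentially. s * (T ^^ n) x > B"
  unfolding esc_def filterlim_at_top_dense by blast

section \<open>Wandering sets, invariant hulls and surjectivity\<close>

lemma wandering_vimage:
  assumes "wandering T W" shows "wandering T ((T ^^ n) -` W)"
  unfolding wandering_def
proof (intro conjI allI impI)
  show "(T ^^ n) -` W \<in> sets borel" using assms vimage_borel by (simp add: wandering_def)
  fix i k :: nat assume "i \<noteq> k"
  have "(T ^^ j) -` (T ^^ n) -` W = (T ^^ (n + j)) -` W" for j
    by (simp add: vimage_comp funpow_add o_def)
  then show "eq_mod ((T ^^ i) -` (T ^^ n) -` W \<inter> (T ^^ k) -` (T ^^ n) -` W) {}"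
    using assms \<open>i \<noteq> k\<close> unfolding wandering_def by (metis add_left_cancel)
qed

definition last_below :: "real \<Rightarrow> real \<Rightarrow> real set" where
  "last_below s M = {x. s * x \<le> M \<and> (\<forall>n\<ge>1. s * (T ^^ n) x > M)}"

text \<open>An orbit has at most one last time below \<open>M\<close>, so the preimages are disjoint
  without exception.\<close>

lemma wandering_last_below: "wandering T (last_below s M)"
  unfolding wandering_def
proof (intro conjI allI impI)
  show "last_below s M \<in> sets borel" unfolding last_below_def by measurable
  have disj: "(T ^^ i) -` last_below s M \<inter> (T ^^ k) -` last_below s M = {}" if "i < k" for i k :: nat
  proof (rule ccontr)
    assume "\<not> ?thesis"
    then obtain x where x: "(T ^^ i) x \<in> last_below s M" "(T ^^ k) x \<in> last_below s M" by auto
    have "(T ^^ (k - i)) ((T ^^ i) x) = (T ^^ k) x"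
      using that funpow_add[of "k - i" i T] by (simp add: o_def)
    moreover have "s * (T ^^ (k - i)) ((T ^^ i) x) > M"
      using x(1) that unfolding last_below_def by simp
    ultimately show False using x(2) by (simp add: last_below_def)
  qed
  fix i k :: nat assume "i \<noteq> k"
  then have "(T ^^ i) -` last_below s M \<inter> (T ^^ k) -` last_below s M = {}"
    using disj[of i k] disj[of k i] by (cases "i < k") auto
  then show "eq_mod ((T ^^ i) -` last_below s M \<inter> (T ^^ k) -` last_below s M) {}"
    by (simp add: eq_mod_def)
qed

lemma esc_subset_last_below: "esc s \<subseteq> (\<Union>n. \<Union>M::nat. (T ^^ n) -` last_below s (real M))"
proof
  fix x assume x: "x \<in> esc s"
  \<comment> \<open>The threshold depends on \<open>x\<close>: it lies above \<open>s * x\<close>,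
    so that time 0 is below it and a last such time exists.\<close>
  obtain M :: nat where M: "s * x \<le> real M" using real_arch_simple by blast
  obtain N where N: "\<And>n. n \<ge> N \<Longrightarrow> s * (T ^^ n) x > real M"
    using esc_eventually_gt[OF x] unfolding eventually_sequentially by blast
  define J where "J = {n. s * (T ^^ n) x \<le> real M}"
  have "J \<subseteq> {..N}"
  proof
    fix n assume "n \<in> J"
    then show "n \<in> {..N}" using N[of n] by (cases "n \<le> N") (auto simp: J_def)
  qed
  then have fin: "finite J" by (rule finite_subset) simp
  have "0 \<in> J" using M by (simp add: J_def)
  then have mem: "Max J \<in> J" using fin by (intro Max_in) auto
  have "s * (T ^^ n) ((T ^^ Max J) x) > real M" if "n \<ge> 1" for n
  proof (rule ccontr)
    assume "\<not> ?thesis"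
    then have "n + Max J \<in> J" by (simp add: J_def funpow_add)
    then have "n + Max J \<le> Max J" using fin by (rule Max_ge[rotated])
    then show False using that by simp
  qed
  then have "(T ^^ Max J) x \<in> last_below s (real M)"
    using mem by (simp add: last_below_def J_def)
  then show "x \<in> (\<Union>n. \<Union>M::nat. (T ^^ n) -` last_below s (real M))" by blast
qed

text \<open>Pointwise invariance, not just modulo null sets: one direction raises \<open>k\<close>
  by one, the other raises \<open>n\<close>.\<close>

lemma invariant_hull_T: "T x \<in> invariant_hull T A \<longleftrightarrow> x \<in> invariant_hull T A"
proof
  assume "T x \<in> invariant_hull T A"
  then obtain k n where k: "k \<ge> 1" "(T ^^ k) (T x) \<in> (T ^^ n) ` A" by (auto simp: invariant_hull_def)
  then have "(T ^^ Suc k) x \<in> (T ^^ n) ` A" by (simp add: funpow_swap1)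
  moreover have "Suc k \<in> {1..}" by simp
  ultimately show "x \<in> invariant_hull T A" unfolding invariant_hull_def by blast
next
  assume "x \<in> invariant_hull T A"
  then obtain k n where k: "k \<ge> 1" "(T ^^ k) x \<in> (T ^^ n) ` A" by (auto simp: invariant_hull_def)
  then obtain y where y: "y \<in> A" "(T ^^ k) x = (T ^^ n) y" by auto
  then have "(T ^^ k) (T x) = (T ^^ Suc n) y" by (simp add: funpow_swap1[symmetric])
  then have "(T ^^ k) (T x) \<in> (T ^^ Suc n) ` A" using y(1) by (rule image_eqI)
  then show "T x \<in> invariant_hull T A" unfolding invariant_hull_def using k(1) by blast
qed

lemma subset_invariant_hull: "A \<subseteq> invariant_hull T A"
proof
  fix x assume "x \<in> A"
  then have "(T ^^ 1) x \<in> (T ^^ 1) ` A" by blast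
  then show "x \<in> invariant_hull T A" unfolding invariant_hull_def by blast
qed

lemma invariant_hull_borel:
  assumes "A \<in> sets borel" shows "invariant_hull T A \<in> sets borel"
  unfolding invariant_hull_def
  using assms by (intro sets.countable_UN'' sets.countable_UN' vimage_borel Tn_image_borel) auto

lemma hull_D_eq: "hull_D T D = invariant_hull T D - invariant_hull T (- D)"
  by (auto simp: hull_D_def hull_CD_def)

lemma hull_D_T [simp]: "T x \<in> hull_D T D \<longleftrightarrow> x \<in> hull_D T D"
  by (simp add: hull_D_eq invariant_hull_T)

lemma hull_D_Tn [simp]: "(T ^^ n) x \<in> hull_D T D \<longleftrightarrow> x \<in> hull_D T D"
  by (induction n) auto

lemma hull_D_subset: "hull_D T D \<subseteq> D"
  using subset_invariant_hull[of "- D"] by (auto simp: hull_D_eq)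

lemma hull_D_borel: "D \<in> sets borel \<Longrightarrow> hull_D T D \<in> sets borel"
  unfolding hull_D_eq by (intro sets.Diff invariant_hull_borel) auto

lemma near_full_measure_pos:
  assumes E: "E \<in> sets borel"
    and near: "measure lborel (cell j - E) \<le> e * (a (j + 1) - a j)" "e \<le> 1 / 2"
  shows "measure lborel (E \<inter> cell j) > 0"
proof -
  define g where "g = a (j + 1) - a j"
  have g: "g > 0" using gap_pos[of j] unfolding g_def .
  have "e * g \<le> 1 / 2 * g" using near(2) g by (intro mult_right_mono) auto
  then show ?thesis
    using measure_cell_split[OF E, of j] near(1) g unfolding g_def[symmetric] by linarith
qed

lemma ex_cell_preimage: "\<exists>j. cell k \<subseteq> T ` cell j"
  using surjective[of k] by (simp add: cell_subset_image_iff)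

text \<open>Here surjectivity enters: up to the points \<open>a j\<close>, \<open>X\<close> is the
  image of its preimage. Thus sets of positive measure can be pulled back to time 0 without becoming
  null.\<close>

lemma negligible_of_vimage:
  assumes "negligible (T -` X)" shows "negligible X"
proof -
  have "X \<subseteq> T ` (T -` X) \<union> range a"
  proof
    fix x assume x: "x \<in> X"
    show "x \<in> T ` (T -` X) \<union> range a"
    proof (cases "x \<in> range a")
      case False
      then have "x \<in> cell (idx x)" by (rule mem_cell_idx)
      then obtain y where "x = T y" using ex_cell_preimage[of "idx x"] by blast
      then show ?thesis using x by blast
    qed simp
  qed
  moreover have "negligible (T ` (T -` X) \<union> range a)"
    using negligible_image[OF assms] countable_imp_negligible[of "range a"] by (intro negligible_Un) auto
  ultimately show ?thesis by (rule negligible_subset[rotated])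
qed

lemma negligible_of_vimage_Tn: "negligible ((T ^^ n) -` X) \<Longrightarrow> negligible X"
proof (induction n)
  case (Suc n)
  have "(T ^^ Suc n) -` X = T -` (T ^^ n) -` X" by (auto simp: funpow_swap1)
  then show ?case using Suc negligible_of_vimage by (simp only:)
qed simp

lemma vimage_Tn_pos:
  assumes "X \<in> sets borel" "emeasure lborel X > 0"
  shows "emeasure lborel ((T ^^ n) -` X) > 0"
  using assms negligible_of_vimage_Tn[of n X] negligible_iff_emeasure vimage_borel by blast

end

locale dissipative_markov_map = markov_map +
  fixes D :: "real set" and \<rho> :: real
  assumes D: "is_dissipative_part T D"
    and rho_pos: "\<rho> > 0"
    and displacement: "AE x in lborel. x \<in> hull_D T D \<longrightarrow> \<bar>T x - x\<bar> \<le> \<rho>"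
begin

lemma D_borel [measurable]: "D \<in> sets borel"
  using D by (simp add: is_dissipative_part_def is_measurable_union_def)

lemma wandering_subset_D: "wandering T W \<Longrightarrow> AE x in lborel. x \<in> W \<longrightarrow> x \<in> D"
  using D by (simp add: is_dissipative_part_def is_measurable_union_def subset_mod_def)

text \<open>By minimality of \<open>D\<close>: otherwise \<open>D - cell k\<close> would still bound
  all wandering sets.\<close>

lemma ex_wandering_in_cell:
  assumes pos: "emeasure lborel (D \<inter> cell k) > 0"
  shows "\<exists>W. wandering T W \<and> emeasure lborel (W \<inter> cell k) > 0"
proof (rule ccontr)
  assume contr: "\<not> ?thesis"
  have "subset_mod W (D - cell k)" if W: "wandering T W" for W
  proof -
    have "W \<in> sets borel" using W by (simp add: wandering_def)
    then have "W \<inter> cell k \<in> null_sets lborel" using contr W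
      by (intro null_setsI) (auto simp: zero_less_iff_neq_zero)
    then have "AE x in lborel. x \<notin> W \<inter> cell k" by (rule AE_not_in)
    then show ?thesis unfolding subset_mod_def using wandering_subset_D[OF W]
      by eventually_elim auto
  qed
  then have "subset_mod D (D - cell k)"
    using D unfolding is_dissipative_part_def is_measurable_union_def by auto
  then have "AE x in lborel. x \<notin> D \<inter> cell k" unfolding subset_mod_def by eventually_elim auto
  then have "D \<inter> cell k \<in> null_sets lborel" by (subst AE_iff_null_sets) auto
  then show False using pos by auto
qed

lemma esc_subset_D: "AE x in lborel. x \<in> esc s \<longrightarrow> x \<in> D"
proof -
  have "AE x in lborel. \<forall>n. \<forall>M::nat. x \<in> (T ^^ n) -` last_below s (real M) \<longrightarrow> x \<in> D"
    unfolding AE_all_countable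
    by (intro allI wandering_subset_D wandering_vimage wandering_last_below)
  then show ?thesis by eventually_elim (use esc_subset_last_below in blast)
qed

text \<open>Besides lying in \<open>D\<close>, a point must avoid the hull of the complement of
  \<open>D\<close>. As \<open>esc s\<close> is exactly invariant, a violation involves the null set
  \<open>N\<close>, and null sets stay null under images and preimages.\<close>

lemma esc_subset_hull_D: "AE x in lborel. x \<in> esc s \<longrightarrow> x \<in> hull_D T D"
proof -
  define N where "N = esc s - D"
  have N: "negligible N" using esc_subset_D[of s] unfolding AE_lborel_iff_negligible N_def
    by (simp add: set_diff_eq)
  have "AE x in lborel. x \<notin> (T ^^ k) -` (T ^^ n) ` N" for k n
    unfolding AE_lborel_iff_negligible using negligible_vimage_Tn[OF negligible_image_Tn[OF N], of k n] by (simp add: vimage_def)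
  then have "AE x in lborel. \<forall>k n. x \<notin> (T ^^ k) -` (T ^^ n) ` N" by (simp add: AE_all_countable)
  then show ?thesis using esc_subset_D[of s]
  proof eventually_elim
    case (elim x)
    show ?case
    proof
      assume x: "x \<in> esc s"
      have "x \<notin> invariant_hull T (- D)"
      proof
        assume "x \<in> invariant_hull T (- D)"
        then obtain k n y where y: "y \<notin> D" "(T ^^ k) x = (T ^^ n) y" by (auto simp: invariant_hull_def)
        have "(T ^^ n) y \<in> esc s" using x unfolding y(2)[symmetric] by simp
        then have "y \<in> N" using y(1) by (simp add: N_def)
        then show False using elim(1) y(2) by (metis image_eqI vimageI)
      qed
      then show "x \<in> hull_D T D" unfolding hull_D_eq using elim(2) x subset_invariant_hull by blast
    qed
  qed
qed

lemma hull_D_step: "AE x in lborel. x \<in> hull_D T D \<longrightarrow> (\<forall>n. \<bar>(T ^^ Suc n) x - (T ^^ n) x\<bar> \<le> \<rho>)"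
  using AE_all_Tn[OF displacement] by eventually_elim simp

text \<open>Cells of two kinds: if \<open>D\<close> has positive measure in a cell, a wandering set
  does too and visits are finite in number; if its part there is null, almost no orbit inside
  \<open>D\<close> ever enters the cell.\<close>

lemma hull_D_subset_esc: "AE x in lborel. x \<in> hull_D T D \<longrightarrow> x \<in> esc 1 \<or> x \<in> esc (-1)"
proof -
  have vis: "AE x in lborel. \<forall>k. emeasure lborel (D \<inter> cell k) > 0 \<longrightarrow>
      (\<forall>\<^sub>F n in sequentially. (T ^^ n) x \<notin> cell k)"
    unfolding AE_all_countable
  proof
    fix k
    show "AE x in lborel. emeasure lborel (D \<inter> cell k) > 0 \<longrightarrow> (\<forall>\<^sub>F n in sequentially. (T ^^ n) x \<notin> cell k)"
    proof (cases "emeasure lborel (D \<inter> cell k) > 0")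
      case True
      then obtain W where "wandering T W" "emeasure lborel (W \<inter> cell k) > 0"
        using ex_wandering_in_cell by blast
      then have "AE x in lborel. \<forall>\<^sub>F n in sequentially. (T ^^ n) x \<notin> cell k" by (rule finite_visits)
      then show ?thesis by simp
    qed simp
  qed
  have "AE x in lborel. \<forall>k. emeasure lborel (D \<inter> cell k) = 0 \<longrightarrow> x \<notin> D \<inter> cell k"
    unfolding AE_all_countable
  proof
    fix k
    show "AE x in lborel. emeasure lborel (D \<inter> cell k) = 0 \<longrightarrow> x \<notin> D \<inter> cell k"
    proof (cases "emeasure lborel (D \<inter> cell k) = 0")
      case True
      then have "D \<inter> cell k \<in> null_sets lborel" by (intro null_setsI) auto
      then have "AE x in lborel. x \<notin> D \<inter> cell k" by (rule AE_not_in)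
      then show ?thesis by eventually_elim simp
    qed simp
  qed
  then have "AE x in lborel. \<forall>n. \<forall>k. emeasure lborel (D \<inter> cell k) = 0 \<longrightarrow> (T ^^ n) x \<notin> D \<inter> cell k"
    by (rule AE_all_Tn)
  with vis hull_D_step AE_regular show ?thesis
  proof eventually_elim
    case (elim x)
    show ?case
    proof
      assume x: "x \<in> hull_D T D"
      have inD: "(T ^^ n) x \<in> D" for n using x hull_D_subset[of D] hull_D_Tn[of n x D] by blast
      have fin: "\<forall>\<^sub>F n in sequentially. (T ^^ n) x \<notin> cell k" for k
      proof (cases "\<exists>n. (T ^^ n) x \<in> cell k")
        case True
        then obtain n where "(T ^^ n) x \<in> D \<inter> cell k" using inD by blast
        then have "emeasure lborel (D \<inter> cell k) \<noteq> 0" using elim(4) by blast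
        then show ?thesis using elim(1) by (simp add: zero_less_iff_neq_zero)
      qed simp
      \<comment> \<open>The cells with index from \<open>idx (-B)\<close> to \<open>idx B\<close>
        are finitely many and cover the interval from -B to B up to end points.\<close>
      have big: "\<forall>\<^sub>F n in sequentially. \<bar>(T ^^ n) x\<bar> > B" for B
      proof -
        have "\<forall>\<^sub>F n in sequentially. \<forall>k\<in>{idx (-B)..idx B}. (T ^^ n) x \<notin> cell k"
          using fin by (intro eventually_ball_finite) auto
        then show ?thesis
        proof eventually_elim
          case (elim n)
          show ?case
          proof (rule ccontr)
            assume "\<not> ?thesis"
            then have B: "- B \<le> (T ^^ n) x" "(T ^^ n) x \<le> B" by auto
            let ?k = "idx ((T ^^ n) x)"
            have m: "a ?k \<le> (T ^^ n) x" "(T ^^ n) x < a (?k + 1)" using idx_mem[of "(T ^^ n) x"] by simp_all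
            have "a (idx (-B)) \<le> - B" "B < a (idx B + 1)" using idx_mem[of "-B"] idx_mem[of B] by simp_all
            then have "a (idx (-B)) < a (?k + 1)" "a ?k < a (idx B + 1)" using m B by linarith+
            then have "?k \<in> {idx (-B)..idx B}" unfolding a_less_iff by simp
            moreover have "(T ^^ n) x \<in> cell ?k"
              using \<open>\<forall>n. (T ^^ n) x \<notin> range a\<close> by (intro mem_cell_idx) blast
            ultimately show False using elim by blast
          qed
        qed
      qed
      have "\<exists>s. (s = 1 \<or> s = -1) \<and> filterlim (\<lambda>n. s * (T ^^ n) x) at_top sequentially"
        using elim(2) x by (intro escapes_to_one_side[of _ \<rho>] big) blast
      then show "x \<in> esc 1 \<or> x \<in> esc (-1)" unfolding esc_def by blast
    qed
  qed
qed

lemma eq_mod_hull_D: "eq_mod (hull_D T D) (esc 1 \<union> esc (-1))"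
  unfolding eq_mod_def using hull_D_subset_esc esc_subset_hull_D[of 1] esc_subset_hull_D[of "-1"]
  by eventually_elim blast

lemma hull_D_meas [measurable]: "hull_D T D \<in> sets borel"
  by (rule hull_D_borel) measurable

lemma esc_cell_imp_hull_D_cell:
  assumes "emeasure lborel (esc s \<inter> cell j) > 0"
  shows "emeasure lborel (hull_D T D \<inter> cell j) > 0"
proof -
  have "AE x in lborel. x \<in> esc s \<inter> cell j \<longrightarrow> x \<in> hull_D T D \<inter> cell j"
    using esc_subset_hull_D[of s] by eventually_elim blast
  then have "emeasure lborel (esc s \<inter> cell j) \<le> emeasure lborel (hull_D T D \<inter> cell j)"
    by (rule emeasure_mono_AE) auto
  then show ?thesis using assms by (rule order_less_le_trans[rotated])
qed

text \<open>Far out there are cells half filled by \<open>esc s\<close>, and by (A6) these have a definite length.\<close>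

lemma esc_emeasure_infinite:
  assumes gap: "\<And>j. emeasure lborel (hull_D T D \<inter> cell j) > 0 \<Longrightarrow> \<theta>\<^sub>o \<le> a (j + 1) - a j"
    and \<theta>\<^sub>o: "\<theta>\<^sub>o > 0" and s: "s = 1 \<or> s = -1" and pos: "emeasure lborel (esc s) > 0"
  shows "emeasure lborel (esc s) = \<infinity>"
proof (rule ccontr)
  assume fin: "emeasure lborel (esc s) \<noteq> \<infinity>"
  \<comment> \<open>The margin \<theta> is one cell length: a cell with a point beyond
    \<open>N\<close> lies entirely beyond N - \<theta>.\<close>
  define F where "F N = esc s \<inter> {x. s * x > real N - \<theta>}" for N :: nat
  have F: "F N \<in> sets borel" for N unfolding F_def by measurable
  have "(\<lambda>N. measure lborel (F N)) \<longlonglongrightarrow> measure lborel (\<Inter>N. F N)"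
  proof (rule Lim_measure_decseq)
    show "decseq F" by (rule decseq_SucI) (auto simp: F_def)
    show "emeasure lborel (F N) \<noteq> \<infinity>" for N
      using fin emeasure_mono[of "F N" "esc s" lborel] by (auto simp: F_def top_unique)
  qed (use F in auto)
  moreover have "(\<Inter>N. F N) = {}"
  proof (rule ccontr)
    assume "\<not> ?thesis"
    then obtain x where x: "\<And>N::nat. s * x > real N - \<theta>" by (auto simp: F_def)
    obtain N :: nat where "s * x + \<theta> \<le> real N" using real_arch_simple by blast
    then show False using x[of N] by linarith
  qed
  ultimately have "(\<lambda>N. measure lborel (F N)) \<longlonglongrightarrow> 0" by simp
  then have "\<forall>\<^sub>F N in sequentially. measure lborel (F N) < \<theta>\<^sub>o / 2"
    using \<theta>\<^sub>o by (intro order_tendstoD(2)) auto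
  then obtain N where N: "measure lborel (F N) < \<theta>\<^sub>o / 2" by (auto simp: eventually_sequentially)
  \<comment> \<open>Density is applied to orbits that stay beyond \<open>N\<close> from time
    \<open>m\<close> on; with n at least m this places the last cell of the cylinder far
    out.\<close>
  define A where "A m = {x\<in>esc s. \<forall>n\<ge>m. s * (T ^^ n) x > real N}" for m
  have A: "A m \<in> sets borel" for m unfolding A_def by measurable
  have "(\<Union>m. A m) = esc s"
    using esc_eventually_gt[of _ s "real N"] by (auto simp: A_def eventually_sequentially)
  have "\<exists>m. emeasure lborel (A m) > 0"
  proof (rule ccontr)
    assume "\<not> ?thesis"
    then have "A m \<in> null_sets lborel" for m using A by (intro null_setsI) (auto simp: zero_less_iff_neq_zero)
    then have "(\<Union>m. A m) \<in> null_sets lborel" by (rule null_sets_UN)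
    then show False using pos unfolding \<open>(\<Union>m. A m) = esc s\<close> by auto
  qed
  then obtain m where m: "emeasure lborel (A m) > 0" by blast
  \<comment> \<open>After the factor \<open>K\<^sup>2\<close> of \<open>dense_cyl_push\<close>, at
    most half of the last cell is missed.\<close>
  define e where "e = 1 / (2 * K\<^sup>2)"
  have K2: "K\<^sup>2 \<ge> 1" using K_ge_1 by (simp add: one_le_power)
  then have "2 * K\<^sup>2 > 0" "1 \<le> 2 * K\<^sup>2" by linarith+
  then have e: "e > 0" "e \<le> 1" "K\<^sup>2 * e = 1 / 2"
    using K2 unfolding e_def by (auto simp: pos_divide_le_eq)
  obtain n w where w: "n \<ge> m" "length w = Suc n" "measure lborel (cyl w - A m) < e * measure lborel (cyl w)"
    using eventually_conj[OF eventually_ge_at_top[of m] eventually_ex_dense_cyl[OF A m e(1)]]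
    unfolding eventually_sequentially by blast
  have wne: "w \<noteq> []" using w(2) by auto
  let ?k = "last w"
  have fm: "cyl w - B \<in> fmeasurable lborel" if "B \<in> sets borel" for B
    using cyl_fmeasurable[OF wne, of "- B"] that by (simp add: Diff_eq)
  have "measure lborel (cyl w - (T ^^ n) -` esc s) \<le> measure lborel (cyl w - A m)"
    using fm[OF A[of m]] fm[of "esc s"] by (intro measure_mono_fmeasurable) (auto simp: A_def vimage_def)
  also note w(3)
  finally have "measure lborel (cell ?k - esc s) \<le> K\<^sup>2 * e * (a (?k + 1) - a ?k)"
    by (rule dense_cyl_push[OF w(2) esc_borel])
  moreover define g where "g = a (?k + 1) - a ?k"
  moreover define mE where "mE = measure lborel (esc s \<inter> cell ?k)"
  ultimately have half: "g / 2 \<le> mE"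
    using measure_cell_split[OF esc_borel, of ?k s] unfolding e(3) by simp
  have ef: "esc s \<inter> cell ?k \<in> fmeasurable lborel" by (rule fmeasurable_subset_cell[of _ ?k]) auto
  have "g > 0" using gap_pos[of ?k] unfolding g_def .
  then have "mE > 0" using half by linarith
  then have "emeasure lborel (esc s \<inter> cell ?k) > 0" using ef by (simp add: emeasure_eq_measure2 mE_def)
  then have "\<theta>\<^sub>o \<le> g" unfolding g_def using esc_cell_imp_hull_D_cell gap by blast
  then have big: "\<theta>\<^sub>o / 2 \<le> mE" using half by linarith
  \<comment> \<open>A point of \<open>A m\<close> in the cylinder is what locates the last cell
    beyond N - \<theta>.\<close>
  have "cyl w \<inter> A m \<noteq> {}"
  proof
    assume "cyl w \<inter> A m = {}"
    then have "cyl w - A m = cyl w" by blast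
    then have "measure lborel (cyl w) < e * measure lborel (cyl w)" using w(3) by simp
    moreover have "e * measure lborel (cyl w) \<le> 1 * measure lborel (cyl w)"
      using e by (intro mult_right_mono) auto
    ultimately show False by simp
  qed
  then obtain x where x: "x \<in> cyl w" "x \<in> A m" by blast
  have "(T ^^ n) x \<in> cell ?k" using x(1) by (rule cyl_maps_to[OF w(2)])
  moreover have "s * (T ^^ n) x > real N" using x(2) w(1) by (simp add: A_def)
  ultimately have "s * y > real N - \<theta>" if "y \<in> cell ?k" for y
    using s gap_le[of ?k] that by auto
  then have "esc s \<inter> cell ?k \<subseteq> F N" by (auto simp: F_def)
  moreover have "F N \<in> fmeasurable lborel"
    using fin emeasure_mono[of "F N" "esc s" lborel] F by (auto simp: F_def fmeasurable_def top_unique less_top)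
  ultimately have "mE \<le> measure lborel (F N)"
    unfolding mE_def using ef by (intro measure_mono_fmeasurable) auto
  then show False using big N by linarith
qed

end

section \<open>Ergodicity and exactness\<close>

locale regular_dissipative_markov_map = dissipative_markov_map +
  fixes \<theta>\<^sub>o s :: real
  assumes theta_o_pos: "\<theta>\<^sub>o > 0"
    and gap_ge: "\<And>j. emeasure lborel (hull_D T D \<inter> cell j) > 0 \<Longrightarrow> \<theta>\<^sub>o \<le> a (j + 1) - a j"
    and cell_covers: "\<And>j. emeasure lborel (hull_D T D \<inter> cell j) > 0 \<Longrightarrow> cell j \<subseteq> T ` cell j"
    and s: "s = 1 \<or> s = -1"
begin

text \<open>Here \<theta> + 2 (\<rho> + \<theta>) bounds the length \<open>d\<close> of a cell
  widened by \<rho> + \<theta> on both sides. Two points more than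
  \<open>\<theta>\<^sub>o / 4\<close> apart with images in that window give a slope below
  \<open>4 * d / \<theta>\<^sub>o\<close>, and exp (\<eta> d) is the distortion within the
  window.\<close>

definition M :: real where
  "M = 4 * exp (\<eta> * (\<theta> + 2 * (\<rho> + \<theta>))) * (\<theta> + 2 * (\<rho> + \<theta>)) / \<theta>\<^sub>o"

lemma M_pos: "M > 0"
  unfolding M_def using theta_pos rho_pos theta_o_pos by simp

text \<open>(A5) bounds the image of the part of \<open>I\<^sub>j\<close> lying in \<open>T\<^sup>-\<^sup>1 E\<close>, hence, by bounded distortion,
  the slope of \<open>T\<close> on the preimages of all cells near \<open>I\<^sub>j\<close>.\<close>

lemma near_full_image:
  assumes E: "E \<in> sets borel" "E \<subseteq> esc s"
    and near: "measure lborel (cell j - T -` E) \<le> e * (a (j + 1) - a j)" "e \<le> 1 / 2"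
    and gap: "\<theta>\<^sub>o \<le> a (j + 1) - a j"
    and k: "cell k \<subseteq> T ` cell j" "cell k \<subseteq> {a j - (\<rho> + \<theta>)..a (j + 1) + (\<rho> + \<theta>)}"
  shows "measure lborel (cell k - E) \<le> M * measure lborel (cell j - T -` E)"
proof -
  define Q where "Q = {a j - (\<rho> + \<theta>)..a (j + 1) + (\<rho> + \<theta>)}"
  define d where "d = \<theta> + 2 * (\<rho> + \<theta>)"
  define S where "S = cell j \<inter> T -` Q"
  have TE: "T -` E \<in> sets borel" "T -` Q \<in> sets borel"
    using vimage_borel[of E 1] vimage_borel[of Q 1] E by (auto simp: Q_def)
  have Sf: "S \<in> fmeasurable lborel" "S \<in> sets borel"
    using TE by (auto simp: S_def intro: fmeasurable_subset_cell)
  have dQ: "\<bar>y - z\<bar> \<le> d" if "y \<in> Q" "z \<in> Q" for y z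
    using that gap_le[of j] by (auto simp: Q_def d_def)
  \<comment> \<open>Points of \<open>esc s\<close> move by at most \<rho>, so \<open>S\<close>
    contains almost all of T^-1 E in the cell and thus has at least half the length of the
    cell.\<close>
  have "AE x in lborel. x \<in> T -` E \<inter> cell j \<longrightarrow> x \<in> S"
    using displacement esc_subset_hull_D[of s]
  proof eventually_elim
    case (elim x)
    show ?case
    proof
      assume x: "x \<in> T -` E \<inter> cell j"
      then have "x \<in> esc s" using E(2) by auto
      then have "\<bar>T x - x\<bar> \<le> \<rho>" using elim by simp
      then show "x \<in> S" using x theta_pos by (auto simp: S_def Q_def)
    qed
  qed
  then have "emeasure lborel (T -` E \<inter> cell j) \<le> emeasure lborel S"
    using Sf by (intro emeasure_mono_AE) auto
  moreover have TEf: "T -` E \<inter> cell j \<in> fmeasurable lborel"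
    using TE by (intro fmeasurable_subset_cell[of _ j]) auto
  ultimately have "measure lborel (T -` E \<inter> cell j) \<le> measure lborel S"
    using Sf by (simp add: emeasure_eq_measure2)
  moreover have "e * (a (j + 1) - a j) \<le> 1 / 2 * (a (j + 1) - a j)"
    using near(2) gap_pos[of j] by (intro mult_right_mono) auto
  ultimately have Sm: "\<theta>\<^sub>o / 2 \<le> measure lborel S"
    using measure_cell_split[OF TE(1), of j] near(1) gap by (simp add: field_simps)
  \<comment> \<open>A set of measure at least \<open>\<theta>\<^sub>o / 2\<close> cannot have
    diameter \<open>\<theta>\<^sub>o / 4\<close>; this yields the reference pair for the
    slope.\<close>
  have "\<exists>u\<in>S. \<exists>v\<in>S. \<bar>u - v\<bar> > \<theta>\<^sub>o / 4"
  proof (rule ccontr)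
    assume contr: "\<not> ?thesis"
    obtain C where C: "C \<in> sets borel" "S \<subseteq> C" "emeasure lborel C \<le> ennreal (\<theta>\<^sub>o / 4)"
      using ex_borel_superset_emeasure_le_diameter[of S "ennreal (\<theta>\<^sub>o / 4)"] contr
      by (force intro!: ennreal_leI simp: not_less)
    then have "emeasure lborel S \<le> ennreal (\<theta>\<^sub>o / 4)"
      using emeasure_mono[of S C lborel] by (auto intro: order_trans)
    then have "measure lborel S \<le> \<theta>\<^sub>o / 4"
      using Sf theta_o_pos by (simp add: emeasure_eq_measure2)
    then show False using Sm theta_o_pos by linarith
  qed
  then obtain u v where uv: "u \<in> S" "v \<in> S" "\<bar>u - v\<bar> > \<theta>\<^sub>o / 4" by blast
  have Tc: "T x = \<tau> j x" "x \<in> {a j..a (j + 1)}" "T x \<in> Q" if "x \<in> S" for x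
    using that branch_eq by (auto simp: S_def)
  have lip: "\<bar>T x - T y\<bar> \<le> M * \<bar>x - y\<bar>" if x: "x \<in> S" and y: "y \<in> S" for x y
  proof -
    have tau_d: "\<bar>\<tau> j p - \<tau> j q\<bar> \<le> d" if "p \<in> S" "q \<in> S" for p q
      using dQ[OF Tc(3)[OF that(1)] Tc(3)[OF that(2)]] unfolding Tc(1)[OF that(1)] Tc(1)[OF that(2)] .
    have "\<bar>T x - T y\<bar> * \<bar>u - v\<bar> \<le> exp (\<eta> * d) * (\<bar>T u - T v\<bar> * \<bar>x - y\<bar>)"
      unfolding Tc(1)[OF x] Tc(1)[OF y] Tc(1)[OF uv(1)] Tc(1)[OF uv(2)]
      by (rule branch_slope_ratio) (use Tc(2) tau_d x y uv in blast)+
    also have "\<dots> \<le> exp (\<eta> * d) * (d * \<bar>x - y\<bar>)"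
      using dQ[OF Tc(3)[OF uv(1)] Tc(3)[OF uv(2)]] by (intro mult_left_mono mult_right_mono) auto
    finally have "\<bar>T x - T y\<bar> * \<bar>u - v\<bar> \<le> exp (\<eta> * d) * (d * \<bar>x - y\<bar>)" .
    moreover have "\<bar>T x - T y\<bar> * (\<theta>\<^sub>o / 4) \<le> \<bar>T x - T y\<bar> * \<bar>u - v\<bar>"
      using uv(3) by (intro mult_left_mono) auto
    ultimately have "\<bar>T x - T y\<bar> * \<theta>\<^sub>o \<le> 4 * exp (\<eta> * d) * d * \<bar>x - y\<bar>" by simp
    then have "\<bar>T x - T y\<bar> \<le> 4 * exp (\<eta> * d) * d * \<bar>x - y\<bar> / \<theta>\<^sub>o"
      using theta_o_pos by (subst pos_le_divide_eq) auto
    then show ?thesis unfolding M_def d_def[symmetric] by simp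
  qed
  have SE: "S - T -` E \<in> sets borel" using Sf TE by auto
  \<comment> \<open>Since \<open>cell k\<close> lies in the window, the preimages in
    \<open>cell j\<close> of its missing points lie in \<open>S\<close>, where \<open>M\<close> is a
    Lipschitz constant.\<close>
  have "cell k - E \<subseteq> T ` (S - T -` E)"
  proof
    fix y assume y: "y \<in> cell k - E"
    then obtain x where x: "x \<in> cell j" "y = T x" using k(1) by blast
    have "y \<in> Q" using y k(2) unfolding Q_def by blast
    then have "x \<in> S - T -` E" using x y unfolding S_def by simp
    then show "y \<in> T ` (S - T -` E)" using x(2) by (rule rev_image_eqI)
  qed
  then have "emeasure lborel (cell k - E) \<le> emeasure lborel (T ` (S - T -` E))"
    using T_image_borel[OF SE] by (intro emeasure_mono) auto
  also have "\<dots> \<le> ennreal M * emeasure lborel (S - T -` E)"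
    using lip M_pos by (intro emeasure_lipschitz_image_le SE) auto
  also have "\<dots> \<le> ennreal M * emeasure lborel (cell j - T -` E)"
    using TE by (intro mult_left_mono emeasure_mono) (auto simp: S_def)
  finally show ?thesis
    using E TE M_pos by (intro measure_le_of_emeasure_le fmeasurable_subset_cell[of "cell k - E" k]
        fmeasurable_subset_cell[of "cell j - T -` E" j]) auto
qed

text \<open>Makes (A6) and (A7) available at any cell that a subset of \<open>esc s\<close> nearly
  fills.\<close>

lemma pos_of_near_full:
  assumes E: "E \<in> sets borel" "E \<subseteq> esc s"
    and near: "measure lborel (cell j - E) \<le> e * (a (j + 1) - a j)" "e \<le> 1 / 2"
  shows "emeasure lborel (hull_D T D \<inter> cell j) > 0"
proof (rule esc_cell_imp_hull_D_cell)
  have "measure lborel (E \<inter> cell j) > 0" by (rule near_full_measure_pos[OF E(1) near])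
  moreover have "E \<inter> cell j \<in> fmeasurable lborel" "esc s \<inter> cell j \<in> fmeasurable lborel"
    using E by (auto intro: fmeasurable_subset_cell)
  moreover from this have "measure lborel (E \<inter> cell j) \<le> measure lborel (esc s \<inter> cell j)"
    using E(2) by (intro measure_mono_fmeasurable) auto
  ultimately show "emeasure lborel (esc s \<inter> cell j) > 0"
    by (simp add: emeasure_eq_measure2)
qed

text \<open>Exact invariance of \<open>esc s\<close> makes the intersection with it in
  \<open>tail_sets\<close> redundant once \<open>E n\<close> lies in \<open>esc s\<close>.\<close>

lemma tail_sets_witness:
  assumes "B \<in> tail_sets T (esc s)"
  obtains E where "\<And>n. E n \<in> sets borel" "\<And>n. E n \<subseteq> esc s"
    "\<And>n. AE x in lborel. x \<in> B \<longleftrightarrow> (T ^^ n) x \<in> E n"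
proof -
  have "\<forall>n. \<exists>E\<in>sets borel. E \<subseteq> esc s \<and> eq_mod B (esc s \<inter> (T ^^ n) -` E)"
    using assms by (simp add: tail_sets_def)
  then obtain E where E: "\<And>n. E n \<in> sets borel" "\<And>n. E n \<subseteq> esc s"
    "\<And>n. eq_mod B (esc s \<inter> (T ^^ n) -` E n)" by metis
  have "esc s \<inter> (T ^^ n) -` E n = (T ^^ n) -` E n" for n using E(2)[of n] mem_esc_Tn[of n _ s] by blast
  then have "AE x in lborel. x \<in> B \<longleftrightarrow> (T ^^ n) x \<in> E n" for n
    using E(3)[of n] by (simp add: eq_mod_def)
  then show thesis using E that by blast
qed

lemma tail_setsI:
  assumes "B \<in> sets borel" "B \<subseteq> esc s"
    and "\<And>n. E n \<in> sets borel" "\<And>n. E n \<subseteq> esc s" "\<And>n. AE x in lborel. x \<in> B \<longleftrightarrow> (T ^^ n) x \<in> E n"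
  shows "B \<in> tail_sets T (esc s)"
  unfolding tail_sets_def mem_Collect_eq
proof (intro conjI allI)
  fix n
  have "esc s \<inter> (T ^^ n) -` E n = (T ^^ n) -` E n" using assms(4)[of n] mem_esc_Tn[of n _ s] by blast
  then show "\<exists>E\<in>sets borel. E \<subseteq> esc s \<and> eq_mod B (esc s \<inter> (T ^^ n) -` E)"
    using assms(3-5)[of n] by (intro bexI[of _ "E n"]) (auto simp: eq_mod_def)
qed (use assms in auto)

lemma tail_sets_vimage:
  assumes B: "B \<in> tail_sets T (esc s)" shows "T -` B \<in> tail_sets T (esc s)"
proof -
  obtain E where E: "\<And>n. E n \<in> sets borel" "\<And>n. E n \<subseteq> esc s"
    "\<And>n. AE x in lborel. x \<in> B \<longleftrightarrow> (T ^^ n) x \<in> E n"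
    using tail_sets_witness[OF B] by blast
  have Bb: "B \<in> sets borel" "B \<subseteq> esc s" using B by (auto simp: tail_sets_def)
  show ?thesis
  proof (rule tail_setsI)
    show "T -` B \<in> sets borel" "T -` E n \<in> sets borel" for n
      using vimage_borel[of _ 1] Bb E by auto
    show "T -` B \<subseteq> esc s" "T -` E n \<subseteq> esc s" for n
      using Bb(2) E(2)[of n] by auto
    show "AE x in lborel. x \<in> T -` B \<longleftrightarrow> (T ^^ n) x \<in> T -` E n" for n
      using AE_Tn[OF E(3)[of n], of 1] by eventually_elim (simp add: funpow_swap1)
  qed
qed

lemma tail_sets_Diff:
  assumes B: "B \<in> tail_sets T (esc s)" and C: "C \<in> tail_sets T (esc s)"
  shows "B - C \<in> tail_sets T (esc s)"
proof -
  obtain E where E: "\<And>n. E n \<in> sets borel" "\<And>n. E n \<subseteq> esc s"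
    "\<And>n. AE x in lborel. x \<in> B \<longleftrightarrow> (T ^^ n) x \<in> E n"
    using tail_sets_witness[OF B] by blast
  obtain F where F: "\<And>n. F n \<in> sets borel" "\<And>n. F n \<subseteq> esc s"
    "\<And>n. AE x in lborel. x \<in> C \<longleftrightarrow> (T ^^ n) x \<in> F n"
    using tail_sets_witness[OF C] by blast
  show ?thesis
  proof (rule tail_setsI[where E = "\<lambda>n. E n - F n"])
    show "AE x in lborel. x \<in> B - C \<longleftrightarrow> (T ^^ n) x \<in> E n - F n" for n
      using E(3)[of n] F(3)[of n] by eventually_elim simp
    show "E n - F n \<subseteq> esc s" for n using E(2)[of n] by blast
  qed (use B C E F in \<open>auto simp: tail_sets_def\<close>)
qed

text \<open>Both \<open>E\<^sub>n\<close> and \<open>T\<^sup>-\<^sup>1 E\<^sub>n\<^sub>+\<^sub>1\<close> nearly fill some cell, and since that cell is covered by its image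
  so does \<open>E\<^sub>n\<^sub>+\<^sub>1\<close>; pulling \<open>E\<^sub>n \<inter> E\<^sub>n\<^sub>+\<^sub>1\<close> back to time \<open>0\<close> gives a piece of \<open>B \<inter> T\<^sup>-\<^sup>1 B\<close>.\<close>

lemma tail_set_recurs:
  assumes B: "B \<in> tail_sets T (esc s)" "emeasure lborel B > 0"
  shows "emeasure lborel (B \<inter> T -` B) > 0"
proof -
  obtain E where E: "\<And>n. E n \<in> sets borel" "\<And>n. E n \<subseteq> esc s"
    "\<And>n. AE x in lborel. x \<in> B \<longleftrightarrow> (T ^^ n) x \<in> E n"
    using tail_sets_witness[OF B(1)] by blast
  have Bb: "B \<in> sets borel" using B by (auto simp: tail_sets_def)
  have TB: "T -` B \<in> sets borel" using vimage_borel[OF Bb, of 1] by simp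
  have K2: "K\<^sup>2 > 0" using K_ge_1 by simp
  \<comment> \<open>In the same cell \<open>E n\<close> will miss a proportion e' and
    \<open>E (Suc n)\<close> at most M e'; the choice makes (1 + M) e' equal to 1/2.\<close>
  define e where "e = 1 / (2 * K\<^sup>2 * (1 + M))"
  have e: "e > 0" unfolding e_def using K2 M_pos by simp
  define e' where "e' = K\<^sup>2 * e"
  have e'eq: "e' = 1 / (2 * (1 + M))" unfolding e'_def e_def using K2 by simp
  have e'_le: "e' \<le> 1 / 2" "(1 + M) * e' = 1 / 2"
    unfolding e'eq using M_pos by (auto simp: field_simps)
  obtain n w where w: "length w = Suc n" "measure lborel (cyl w - B) < e * measure lborel (cyl w)"
    using eventually_ex_dense_cyl[OF Bb B(2) e] unfolding eventually_sequentially by blast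
  let ?k = "last w"
  have TE: "T -` E (Suc n) \<in> sets borel" using vimage_borel[OF E(1), of 1] by simp
  \<comment> \<open>One cylinder serves both sets, since \<open>B\<close> is modulo null sets the
    preimage of \<open>E n\<close> at time n and of \<open>E (Suc n)\<close> at time n + 1.\<close>
  have "measure lborel (cyl w - (T ^^ n) -` E n) = measure lborel (cyl w - B)"
    using E(3)[of n] by (intro measure_Diff_cong_AE) (auto simp: Bb vimage_borel E(1) intro: AE_mp)
  then have 1: "measure lborel (cell ?k - E n) \<le> e' * (a (?k + 1) - a ?k)"
    unfolding e'_def using w by (intro dense_cyl_push[OF w(1) E(1)]) simp
  have "measure lborel (cyl w - (T ^^ n) -` (T -` E (Suc n))) = measure lborel (cyl w - B)"
    using E(3)[of "Suc n"] by (intro measure_Diff_cong_AE) (auto simp: Bb vimage_borel TE intro: AE_mp)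
  then have 2: "measure lborel (cell ?k - T -` E (Suc n)) \<le> e' * (a (?k + 1) - a ?k)"
    unfolding e'_def using w by (intro dense_cyl_push[OF w(1) TE]) simp
  have pos: "emeasure lborel (hull_D T D \<inter> cell ?k) > 0"
    by (rule pos_of_near_full[OF E(1,2) 1 e'_le(1)])
  have "measure lborel (cell ?k - E (Suc n)) \<le> M * measure lborel (cell ?k - T -` E (Suc n))"
    using rho_pos theta_pos
    by (intro near_full_image[OF E(1,2) 2 e'_le(1) gap_ge[OF pos] cell_covers[OF pos]]) auto
  also have "\<dots> \<le> M * (e' * (a (?k + 1) - a ?k))"
    using 2 M_pos by (intro mult_left_mono) auto
  finally have 3: "measure lborel (cell ?k - E (Suc n)) \<le> M * (e' * (a (?k + 1) - a ?k))" .
  let ?X = "E n \<inter> E (Suc n)"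
  have X: "?X \<in> sets borel" using E(1) by auto
  have "measure lborel (cell ?k - ?X) \<le> measure lborel ((cell ?k - E n) \<union> (cell ?k - E (Suc n)))"
    using E(1) X by (intro measure_mono_fmeasurable fmeasurable_subset_cell[of _ ?k]) auto
  also have "\<dots> \<le> measure lborel (cell ?k - E n) + measure lborel (cell ?k - E (Suc n))"
    using E(1) by (intro measure_Un_le) auto
  also have "\<dots> \<le> ((1 + M) * e') * (a (?k + 1) - a ?k)"
    using 1 3 by (simp add: algebra_simps)
  finally have "measure lborel (?X \<inter> cell ?k) > 0"
    unfolding e'_le(2) by (rule near_full_measure_pos[OF X]) simp
  then have "emeasure lborel (?X \<inter> cell ?k) > 0"
    using fmeasurable_subset_cell[of "?X \<inter> cell ?k" ?k] X by (simp add: emeasure_eq_measure2)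
  also have "emeasure lborel (?X \<inter> cell ?k) \<le> emeasure lborel ?X"
    using X by (intro emeasure_mono) auto
  \<comment> \<open>Seen from time n + 1, \<open>E (Suc n)\<close> pulls back to \<open>B\<close>
    and \<open>E n\<close> to T^-1 B.\<close>
  finally have "emeasure lborel ((T ^^ Suc n) -` ?X) > 0" by (rule vimage_Tn_pos[OF X])
  also have "emeasure lborel ((T ^^ Suc n) -` ?X) \<le> emeasure lborel (B \<inter> T -` B)"
  proof (rule emeasure_mono_AE)
    show "AE x in lborel. x \<in> (T ^^ Suc n) -` ?X \<longrightarrow> x \<in> B \<inter> T -` B"
      using E(3)[of "Suc n"] AE_Tn[OF E(3)[of n], of 1]
      by eventually_elim (simp add: funpow_swap1)
  qed (use Bb TB in auto)
  finally show ?thesis .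
qed

text \<open>Each of the two differences is disjoint from its own preimage, so recurrence of tail
  sets makes it null.\<close>

lemma tail_set_invariant:
  assumes B: "B \<in> tail_sets T (esc s)" shows "invariant_set T B"
proof -
  have Bb: "B \<in> sets borel" using B by (auto simp: tail_sets_def)
  have TB: "T -` B \<in> sets borel" using vimage_borel[OF Bb, of 1] by simp
  have null: "AE x in lborel. x \<notin> C" if C: "C \<in> tail_sets T (esc s)" "C \<inter> T -` C = {}" for C
  proof -
    have "\<not> emeasure lborel C > 0"
    proof
      assume "emeasure lborel C > 0"
      from tail_set_recurs[OF C(1) this] show False unfolding C(2) by simp
    qed
    then have "emeasure lborel C = 0" unfolding zero_less_iff_neq_zero by blast
    then have "C \<in> null_sets lborel" using C(1) by (intro null_setsI) (auto simp: tail_sets_def)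
    then show ?thesis by (rule AE_not_in)
  qed
  have "AE x in lborel. x \<notin> B - T -` B"
    by (intro null tail_sets_Diff tail_sets_vimage B) auto
  moreover have "AE x in lborel. x \<notin> T -` B - B"
    by (intro null tail_sets_Diff tail_sets_vimage B) auto
  ultimately have "AE x in lborel. x \<in> T -` B \<longleftrightarrow> x \<in> B" by eventually_elim auto
  then show ?thesis using Bb by (simp add: invariant_set_def eq_mod_def)
qed

section \<open>Crossing a cell, and ergodicity\<close>

lemma hull_D_orbit_cells:
  "AE x in lborel. x \<in> hull_D T D \<longrightarrow> (\<forall>n k. (T ^^ n) x \<in> cell k \<longrightarrow> emeasure lborel (hull_D T D \<inter> cell k) > 0)"
proof -
  have "AE x in lborel. \<forall>k. \<not> emeasure lborel (hull_D T D \<inter> cell k) > 0 \<longrightarrow> x \<notin> hull_D T D \<inter> cell k"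
    unfolding AE_all_countable
  proof
    fix k
    show "AE x in lborel. \<not> emeasure lborel (hull_D T D \<inter> cell k) > 0 \<longrightarrow> x \<notin> hull_D T D \<inter> cell k"
    proof (cases "emeasure lborel (hull_D T D \<inter> cell k) = 0")
      case True
      then have "hull_D T D \<inter> cell k \<in> null_sets lborel" by (intro null_setsI) auto
      then have "AE x in lborel. x \<notin> hull_D T D \<inter> cell k" by (rule AE_not_in)
      then show ?thesis by eventually_elim simp
    qed (simp add: zero_less_iff_neq_zero)
  qed
  from AE_all_Tn[OF this] show ?thesis by eventually_elim (use hull_D_Tn in blast)
qed

lemma sign_mult_near: "\<bar>y - p\<bar> \<le> d \<Longrightarrow> s * y - d \<le> s * p"
  using s by auto

text \<open>Cells lying before \<open>cell k\<close> in direction \<open>s\<close> from which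
  \<open>near_full_image\<close> can be applied to it: covering and window are the two geometric
  hypotheses of that lemma.\<close>

definition crossing :: "int \<Rightarrow> int set" where
  "crossing k = {p. s * a p < s * a k \<and> cell k \<subseteq> T ` cell p \<and>
     cell k \<subseteq> {a p - (\<rho> + \<theta>)..a (p + 1) + (\<rho> + \<theta>)}}"

text \<open>A path to \<open>s \<infinity>\<close> that starts before \<open>I\<^sub>k\<close> has to jump over (or onto) it, and by (A7) the image
  of the cell from which it jumps contains everything in between.\<close>

lemma orbit_crosses:
  assumes x: "x \<in> esc s" "x \<in> cell j" "s * a j < s * a k"
    and reg: "\<forall>n. (T ^^ n) x \<notin> range a"
    and step: "\<forall>n. \<bar>(T ^^ Suc n) x - (T ^^ n) x\<bar> \<le> \<rho>"
    and pos: "\<forall>n k. (T ^^ n) x \<in> cell k \<longrightarrow> emeasure lborel (hull_D T D \<inter> cell k) > 0"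
  shows "\<exists>n. idx ((T ^^ n) x) \<in> crossing k"
proof -
  define i where "i n = idx ((T ^^ n) x)" for n
  have mem: "(T ^^ n) x \<in> cell (i n)" for n unfolding i_def using reg by (intro mem_cell_idx) blast
  have mem': "a (i n) < (T ^^ n) x" "(T ^^ n) x < a (i n + 1)" for n using mem[of n] by simp_all
  have i0: "i 0 = j" unfolding i_def using idx_eq_cell[OF x(2)] by simp
  have "\<exists>n. s * a k \<le> s * a (i n)"
  proof -
    obtain n where n: "s * (T ^^ n) x > s * a k + \<theta>"
      using esc_eventually_gt[OF x(1), of "s * a k + \<theta>"] unfolding eventually_sequentially by blast
    have "\<bar>(T ^^ n) x - a (i n)\<bar> \<le> \<theta>" using mem'[of n] gap_le[of "i n"] by linarith
    from sign_mult_near[OF this] have "s * a k \<le> s * a (i n)" using n by linarith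
    then show ?thesis by blast
  qed
  then obtain n where n: "s * a k \<le> s * a (i n)" "\<And>m. m < n \<Longrightarrow> \<not> s * a k \<le> s * a (i m)"
    using exists_least_iff[of "\<lambda>n. s * a k \<le> s * a (i n)"] by blast
  have "n \<noteq> 0" using n(1) x(3) i0 by (cases n) auto
  then obtain m where m: "n = Suc m" by (cases n) auto
  let ?p = "i m"
  have before: "s * a ?p < s * a k" using n(2)[of m] m by simp
  have btw: "?p < k \<and> k \<le> i n \<or> i n \<le> k \<and> k < ?p"
    using s before n(1) by auto
  have "cell ?p \<subseteq> T ` cell ?p" using cell_covers pos mem by blast
  moreover have "cell (i n) \<subseteq> T ` cell ?p"
    using mem[of n] mem[of m] unfolding m by (intro cell_subset_image_if_meets[of "(T ^^ m) x"]) auto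
  ultimately have cov: "cell k \<subseteq> T ` cell ?p"
    using btw cell_subset_image_between[of ?p ?p "i n" k] cell_subset_image_between[of "i n" ?p ?p k]
    by (elim disjE conjE) simp_all
  have st: "\<bar>(T ^^ n) x - (T ^^ m) x\<bar> \<le> \<rho>" using step unfolding m by blast
  \<comment> \<open>The near end of I_k comes before the landing point, which is within \<rho> of a
    point of I_p; its far end is at most one cell length further.\<close>
  have "a ?p - (\<rho> + \<theta>) \<le> a k \<and> a (k + 1) \<le> a (?p + 1) + (\<rho> + \<theta>)"
    using btw
  proof (elim disjE conjE)
    assume "?p < k" "k \<le> i n"
    then have "a ?p \<le> a k" "a k \<le> a (i n)" by simp_all
    then show ?thesis using mem'[of n] mem'[of m] gap_le[of k] st rho_pos theta_pos
      unfolding abs_le_iff by (intro conjI; linarith)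
  next
    assume "i n \<le> k" "k < ?p"
    then have "a (i n + 1) \<le> a (k + 1)" "a (k + 1) \<le> a (?p + 1)" by simp_all
    then show ?thesis using mem'[of n] mem'[of m] gap_le[of k] st rho_pos theta_pos
      unfolding abs_le_iff by (intro conjI; linarith)
  qed
  then have "cell k \<subseteq> {a ?p - (\<rho> + \<theta>)..a (?p + 1) + (\<rho> + \<theta>)}"
    unfolding subset_iff atLeastAtMost_iff greaterThanLessThan_iff by (meson less_imp_le order_trans)
  then show ?thesis using before cov unfolding crossing_def i_def by blast
qed

text \<open>Stop the orbits starting in \<open>I\<^sub>j\<close> when they are about to cross \<open>I\<^sub>k\<close>. The stopped cylinders are
  disjoint and exhaust almost all of \<open>I\<^sub>j \<inter> B\<close>, so \<open>B\<close> nearly fills one of them.\<close>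

lemma invariant_near_full_beyond:
  assumes B: "B \<in> sets borel" "B \<subseteq> esc s" "emeasure lborel B > 0"
    and inv: "AE x in lborel. T x \<in> B \<longleftrightarrow> x \<in> B" and \<delta>: "\<delta> > 0"
  shows "\<exists>j. \<forall>k. s * a j < s * a k \<longrightarrow> measure lborel (cell k - B) \<le> \<delta>"
proof -
  have K2: "K\<^sup>2 \<ge> 1" using K_ge_1 by (simp add: one_le_power)
  have K0: "K \<noteq> 0" using K_ge_1 by linarith
  \<comment> \<open>The first bound leaves at least half of the crossing cell filled, as
    \<open>near_full_image\<close> requires; the second turns its conclusion into \<delta>. The
    factor 3 in both is lost in passing from I_j to a stopped cylinder.\<close>
  define e where "e = min (1 / (6 * K\<^sup>2)) (\<delta> / (3 * M * K\<^sup>2 * \<theta>))"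
  have "K\<^sup>2 > 0" using K2 by linarith
  then have "1 / (6 * K\<^sup>2) > 0" "\<delta> / (3 * M * K\<^sup>2 * \<theta>) > 0"
    using \<delta> M_pos theta_pos by (intro divide_pos_pos mult_pos_pos; simp)+
  then have e0: "e > 0" unfolding e_def by simp
  have e1: "3 * (K\<^sup>2 * e) \<le> 1 / 2"
  proof -
    have "3 * (K\<^sup>2 * e) \<le> 3 * (K\<^sup>2 * (1 / (6 * K\<^sup>2)))" unfolding e_def using K2 by (intro mult_left_mono) auto
    also have "\<dots> = 1 / 2" using K0 by simp
    finally show ?thesis .
  qed
  have e2: "M * (K\<^sup>2 * (3 * e) * \<theta>) \<le> \<delta>"
  proof -
    have "M * (K\<^sup>2 * (3 * e) * \<theta>) \<le> M * (K\<^sup>2 * (3 * (\<delta> / (3 * M * K\<^sup>2 * \<theta>))) * \<theta>)"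
      unfolding e_def using K2 M_pos theta_pos by (intro mult_left_mono mult_right_mono) auto
    also have "\<dots> = \<delta>" using K0 M_pos theta_pos by simp
    finally show ?thesis .
  qed
  have "e * 1 \<le> e * K\<^sup>2" using e0 K2 by (intro mult_left_mono) auto
  then have e3: "3 * e \<le> 1 / 2" "e < 1 / 2" using e1 by (auto simp: mult.commute)
  have invn: "AE x in lborel. (T ^^ n) x \<in> B \<longleftrightarrow> x \<in> B" for n
  proof (induction n)
    case (Suc n)
    from AE_Tn[OF inv, of n] Suc show ?case by eventually_elim simp
  qed simp
  have TnB: "(T ^^ n) -` B \<in> sets borel" for n by (rule vimage_borel[OF B(1)])
  have same: "measure lborel (A - (T ^^ n) -` B) = measure lborel (A - B)" if "A \<in> sets borel" for A n
    by (rule measure_Diff_cong_AE) (use invn[of n] that TnB B(1) in auto)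
  \<comment> \<open>Compensates in advance for the factor \<open>K\<^sup>2\<close> of
    \<open>dense_cyl_push\<close>.\<close>
  define e' where "e' = e / K\<^sup>2"
  have e': "e' > 0" "K\<^sup>2 * e' = e" unfolding e'_def using e0 K0 by auto
  obtain n w where w: "length w = Suc n" "measure lborel (cyl w - B) < e' * measure lborel (cyl w)"
    using eventually_ex_dense_cyl[OF B(1,3) e'(1)] unfolding eventually_sequentially by blast
  define j where "j = last w"
  have near: "measure lborel (cell j - B) \<le> e * (a (j + 1) - a j)"
    using dense_cyl_push[OF w(1) B(1), of e'] w(2) same[of "cyl w" n] unfolding j_def e'(2) by simp
  have "measure lborel (cell k - B) \<le> \<delta>" if k: "s * a j < s * a k" for k
  proof -
    define S where "S = {w. w \<noteq> [] \<and> hd w = j \<and> last w \<in> crossing k \<and>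
      (\<forall>i<length w - 1. w ! i \<notin> crossing k)}"
    define V where "V = (\<Union>w\<in>S. cyl w)"
    have V: "V \<in> sets borel" unfolding V_def by (rule cyl_union_borel)
    have Vj: "V \<subseteq> cell j" unfolding V_def S_def using cyl_subset_cell by blast
    have disj: "disjoint_family_on cyl S"
    proof -
      \<comment> \<open>Were \<open>v\<close> shorter, its last letter would be a crossing letter of
        \<open>w\<close> before the end of \<open>w\<close>.\<close>
      have no: "\<not> length v < length w" if v: "v \<in> S" "x \<in> cyl v" and w: "w \<in> S" "x \<in> cyl w" for v w x
      proof
        assume less: "length v < length w"
        have vne: "v \<noteq> []" using v(1) by (simp add: S_def)
        then have l: "length v - 1 < length v" by simp
        have "w ! (length v - 1) = v ! (length v - 1)"
          using mem_cyl_nth[OF v(2) l] mem_cyl_nth[OF w(2), of "length v - 1"] less by linarith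
        also have "\<dots> = last v" using vne by (simp add: last_conv_nth)
        finally have "w ! (length v - 1) \<in> crossing k" using v(1) by (simp add: S_def)
        moreover have "length v - 1 < length w - 1" using vne less by (cases v) auto
        ultimately show False using w(1) unfolding S_def by blast
      qed
      show ?thesis unfolding disjoint_family_on_def
      proof (intro ballI impI equals0I)
        fix v w x assume "v \<in> S" "w \<in> S" "v \<noteq> w" "x \<in> cyl v \<inter> cyl w"
        then show False using no[of v x w] no[of w x v] cyl_disjoint[of x v w] by auto
      qed
    qed
    have "AE x in lborel. x \<in> B \<inter> cell j \<longrightarrow> x \<in> V"
      using AE_regular hull_D_step hull_D_orbit_cells esc_subset_hull_D[of s]
    proof eventually_elim
      case (elim x)
      show ?case
      proof
        assume x: "x \<in> B \<inter> cell j"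
        then have xe: "x \<in> esc s" "x \<in> cell j" using B(2) by auto
        have xh: "x \<in> hull_D T D" using elim(4) xe by blast
        have "\<exists>n. idx ((T ^^ n) x) \<in> crossing k"
          using elim(2,3) xh by (intro orbit_crosses[OF xe k elim(1)]) blast+
        then obtain n where n: "idx ((T ^^ n) x) \<in> crossing k" "\<And>m. m < n \<Longrightarrow> idx ((T ^^ m) x) \<notin> crossing k"
          using exists_least_iff[of "\<lambda>n. idx ((T ^^ n) x) \<in> crossing k"] by blast
        have "hd (word (Suc n) x) = j" unfolding word_def using idx_eq_cell[OF xe(2)] by (simp add: upt_rec)
        moreover have "word (Suc n) x \<noteq> []" by (simp add: word_def)
        ultimately have "word (Suc n) x \<in> S" using n by (simp add: S_def)
        then show "x \<in> V" unfolding V_def using mem_cyl_word[OF elim(1)] by blast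
      qed
    qed
    then have "emeasure lborel (B \<inter> cell j) \<le> emeasure lborel V"
      using V by (intro emeasure_mono_AE) auto
    moreover have fm: "B \<inter> cell j \<in> fmeasurable lborel" "V \<in> fmeasurable lborel" "V - B \<in> fmeasurable lborel"
      "cell j - B \<in> fmeasurable lborel"
      using V Vj B(1) by (auto intro!: fmeasurable_subset_cell[of _ j])
    ultimately have BV: "measure lborel (B \<inter> cell j) \<le> measure lborel V"
      by (simp add: emeasure_eq_measure2)
    have "measure lborel (V - B) \<le> measure lborel (cell j - B)"
      using Vj fm by (intro measure_mono_fmeasurable) auto
    define g where "g = a (j + 1) - a j"
    have g: "g > 0" using gap_pos[of j] unfolding g_def .
    have "measure lborel (V - B) \<le> e * g"
      using \<open>measure lborel (V - B) \<le> measure lborel (cell j - B)\<close> near unfolding g_def by linarith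
    \<comment> \<open>More than half of I_j is filled by \<open>B\<close> and hence by
      \<open>V\<close>, so e g is below 2 e times the measure of \<open>V\<close>.\<close>
    moreover have "e * g < 3 * e * measure lborel V"
    proof -
      have "e * g < 1 / 2 * g" using e3(2) g by (intro mult_strict_right_mono) auto
      moreover have "measure lborel (cell j - B) \<le> e * g" using near unfolding g_def .
      ultimately have "g / 2 < measure lborel V"
        using measure_cell_split[OF B(1), of j] BV unfolding g_def[symmetric] by linarith
      then have "e * (g / 2) < e * measure lborel V" using e0 by simp
      moreover have "e * g > 0" using e0 g by simp
      ultimately show ?thesis by simp
    qed
    ultimately have VB: "measure lborel (V - B) < 3 * e * measure lborel V" by linarith
    then have "0 < 3 * e * measure lborel V" using measure_nonneg[of lborel "V - B"] by linarith
    then have "ennreal (measure lborel (V - B)) < ennreal (3 * e * measure lborel V)"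
      using VB by (rule ennreal_lessI)
    then have "emeasure lborel (V - B) < ennreal (3 * e) * emeasure lborel V"
      using fm e0 by (simp add: emeasure_eq_measure2 ennreal_mult)
    then obtain v where v: "v \<in> S" "measure lborel (cyl v - B) < 3 * e * measure lborel (cyl v)"
      using ex_dense_cyl[OF disj _ B(1), of "3 * e"] e0 unfolding V_def by (auto simp: S_def)
    define p where "p = last v"
    obtain m where m: "length v = Suc m" using v(1) by (cases v) (auto simp: S_def)
    have p: "p \<in> crossing k" using v(1) by (simp add: S_def p_def)
    have near_p: "measure lborel (cell p - B) \<le> K\<^sup>2 * (3 * e) * (a (p + 1) - a p)"
      using dense_cyl_push[OF m B(1), of "3 * e"] v(2) same[of "cyl v" m] unfolding p_def by simp
    have half: "K\<^sup>2 * (3 * e) \<le> 1 / 2" using e1 by (simp add: mult_ac)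
    have pos: "emeasure lborel (hull_D T D \<inter> cell p) > 0"
      by (rule pos_of_near_full[OF B(1,2) near_p half])
    \<comment> \<open>\<open>near_full_image\<close> asks for T^-1 B in I_p; by invariance that is
      \<open>B\<close> itself up to a null set.\<close>
    have near_p': "measure lborel (cell p - T -` B) \<le> K\<^sup>2 * (3 * e) * (a (p + 1) - a p)"
      using near_p same[of "cell p" 1] by simp
    have "measure lborel (cell k - B) \<le> M * measure lborel (cell p - T -` B)"
      using p by (intro near_full_image[OF B(1,2) near_p' half gap_ge[OF pos]]) (auto simp only: crossing_def mem_Collect_eq)
    also have "\<dots> \<le> M * (K\<^sup>2 * (3 * e) * (a (p + 1) - a p))"
      using near_p' M_pos by (intro mult_left_mono) auto
    also have "\<dots> \<le> M * (K\<^sup>2 * (3 * e) * \<theta>)"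
      using gap_le[of p] M_pos e0 by (intro mult_left_mono) auto
    also note e2
    finally show ?thesis .
  qed
  then show ?thesis by blast
qed

text \<open>Found along a single typical escaping orbit; positivity of the hull there makes the
  lower length bound of (A6) available.\<close>

lemma ex_far_cell:
  assumes "emeasure lborel (esc s) > 0"
  shows "\<exists>k. s * a i < s * a k \<and> s * a j < s * a k \<and> emeasure lborel (hull_D T D \<inter> cell k) > 0"
proof -
  have "\<exists>x. x \<in> esc s \<and> (\<forall>n. (T ^^ n) x \<notin> range a) \<and>
    (\<forall>n k. (T ^^ n) x \<in> cell k \<longrightarrow> emeasure lborel (hull_D T D \<inter> cell k) > 0)"
  proof (rule ccontr)
    assume contr: "\<not> ?thesis"
    have "AE x in lborel. x \<notin> esc s"
      using AE_regular hull_D_orbit_cells esc_subset_hull_D[of s]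
      by eventually_elim (use contr in blast)
    then have "esc s \<in> null_sets lborel" by (subst AE_iff_null_sets) auto
    then show False using assms by auto
  qed
  then obtain x where x: "x \<in> esc s" "\<And>n. (T ^^ n) x \<notin> range a"
    "\<And>n k. (T ^^ n) x \<in> cell k \<Longrightarrow> emeasure lborel (hull_D T D \<inter> cell k) > 0" by blast
  obtain n where n: "s * (T ^^ n) x > max (s * a i) (s * a j) + \<theta>"
    using esc_eventually_gt[OF x(1), of "max (s * a i) (s * a j) + \<theta>"] unfolding eventually_sequentially by blast
  define k where "k = idx ((T ^^ n) x)"
  have k: "(T ^^ n) x \<in> cell k" unfolding k_def using x(2) by (rule mem_cell_idx)
  define y where "y = (T ^^ n) x"
  have y: "a k < y" "y < a (k + 1)" "s * y > max (s * a i) (s * a j) + \<theta>"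
    using k n by (simp_all only: y_def greaterThanLessThan_iff)
  have "\<bar>y - a k\<bar> \<le> \<theta>" using y(1,2) gap_le[of k] by linarith
  then have "s * y - \<theta> \<le> s * a k" by (rule sign_mult_near)
  then have "s * a i < s * a k" "s * a j < s * a k" using y(3) by linarith+
  then show ?thesis using x(3)[OF k] by blast
qed

lemma esc_ergodic:
  assumes B: "invariant_set T B" "subset_mod B (esc s)"
  shows "B \<in> null_sets lborel \<or> eq_mod B (esc s)"
proof (rule ccontr)
  assume contr: "\<not> ?thesis"
  have Bb: "B \<in> sets borel" and inv: "AE x in lborel. T x \<in> B \<longleftrightarrow> x \<in> B"
    using B(1) by (auto simp: invariant_set_def eq_mod_def)
  have sub: "AE x in lborel. x \<in> B \<longrightarrow> x \<in> esc s" using B(2) by (simp add: subset_mod_def)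
  have pos: "emeasure lborel C > 0" if "C \<in> sets borel" "\<not> (AE x in lborel. x \<notin> C)" for C :: "real set"
    using that AE_iff_null_sets[of C lborel] by (auto simp: null_sets_def zero_less_iff_neq_zero)
  have B1: "emeasure lborel (B \<inter> esc s) > 0"
  proof (rule pos)
    show "\<not> (AE x in lborel. x \<notin> B \<inter> esc s)"
    proof
      assume "AE x in lborel. x \<notin> B \<inter> esc s"
      then have "AE x in lborel. x \<notin> B" using sub by eventually_elim auto
      then show False using contr Bb AE_iff_null_sets[of B lborel] by auto
    qed
  qed (use Bb in auto)
  have B2: "emeasure lborel (esc s - B) > 0"
  proof (rule pos)
    show "\<not> (AE x in lborel. x \<notin> esc s - B)"
    proof
      assume "AE x in lborel. x \<notin> esc s - B"
      then have "eq_mod B (esc s)" unfolding eq_mod_def using sub by eventually_elim auto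
      then show False using contr by auto
    qed
  qed (use Bb in auto)
  have "AE x in lborel. T x \<in> B \<inter> esc s \<longleftrightarrow> x \<in> B \<inter> esc s" using inv by eventually_elim simp
  then obtain j1 where j1: "\<And>k. s * a j1 < s * a k \<Longrightarrow> measure lborel (cell k - B \<inter> esc s) \<le> \<theta>\<^sub>o / 4"
    using invariant_near_full_beyond[OF _ _ B1, of "\<theta>\<^sub>o / 4"] Bb theta_o_pos by auto
  have "AE x in lborel. T x \<in> esc s - B \<longleftrightarrow> x \<in> esc s - B" using inv by eventually_elim simp
  then obtain j2 where j2: "\<And>k. s * a j2 < s * a k \<Longrightarrow> measure lborel (cell k - (esc s - B)) \<le> \<theta>\<^sub>o / 4"
    using invariant_near_full_beyond[OF _ _ B2, of "\<theta>\<^sub>o / 4"] Bb theta_o_pos by auto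
  have "emeasure lborel (B \<inter> esc s) \<le> emeasure lborel (esc s)" by (intro emeasure_mono) auto
  then have "emeasure lborel (esc s) > 0" using B1 by (rule order_less_le_trans[rotated])
  then obtain k where k: "s * a j1 < s * a k" "s * a j2 < s * a k" "emeasure lborel (hull_D T D \<inter> cell k) > 0"
    using ex_far_cell by blast
  \<comment> \<open>Two disjoint sets together miss all of the cell, yet each misses at most a
    quarter of \<open>\<theta>\<^sub>o\<close>, while the cell has length at least
    \<open>\<theta>\<^sub>o\<close>.\<close>
  have "a (k + 1) - a k = measure lborel (cell k)" by simp
  also have "\<dots> \<le> measure lborel ((cell k - B \<inter> esc s) \<union> (cell k - (esc s - B)))"
    using Bb by (intro measure_mono_fmeasurable fmeasurable_subset_cell[of _ k]) auto
  also have "\<dots> \<le> measure lborel (cell k - B \<inter> esc s) + measure lborel (cell k - (esc s - B))"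
    using Bb by (intro measure_Un_le) auto
  also have "\<dots> \<le> \<theta>\<^sub>o / 4 + \<theta>\<^sub>o / 4" by (intro add_mono j1 j2 k)
  finally show False using gap_ge[OF k(3)] theta_o_pos by linarith
qed

lemma esc_exact: "esc s \<in> null_sets lborel \<or> exact_component T (esc s)"
proof (cases "emeasure lborel (esc s) > 0")
  case True
  then have "ergodic_component T (esc s)"
    unfolding ergodic_component_def using esc_invariant esc_ergodic by blast
  moreover have "B \<in> null_sets lborel \<or> eq_mod B (esc s)" if B: "B \<in> tail_sets T (esc s)" for B
  proof -
    have "subset_mod B (esc s)" using B by (auto simp: tail_sets_def subset_mod_def)
    then show ?thesis using tail_set_invariant[OF B] esc_ergodic by blast
  qed
  ultimately show ?thesis by (simp add: exact_component_def)
qed (auto simp: null_sets_def zero_less_iff_neq_zero)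

end

theorem theorem2p11:
  fixes a :: "int \<Rightarrow> real" and T :: "real \<Rightarrow> real"
    and \<tau> \<tau>' \<tau>'' :: "int \<Rightarrow> real \<Rightarrow> real"
    and \<theta> \<Lambda> \<eta> \<rho> :: real and D :: "real set"
  assumes a_top: "filterlim a at_top at_top" and a_bot: "filterlim a at_bot at_bot"
    and A1: "\<theta> > 0" "\<And>j. 0 < a (j + 1) - a j" "\<And>j. a (j + 1) - a j \<le> \<theta>"
    and A2: "markov_branches a T \<tau> \<tau>' \<tau>''"
    and surjective: "\<And>k. \<exists>j. markov_interval a k \<subseteq> \<tau> j ` markov_interval a j"
    and A3: "\<Lambda> > 1" "\<And>j x. x \<in> markov_interval a j \<Longrightarrow> \<bar>\<tau>' j x\<bar> \<ge> \<Lambda>"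
    and A4: "\<eta> > 0" "\<And>j x. x \<in> markov_interval a j \<Longrightarrow> \<bar>\<tau>'' j x / (\<tau>' j x)\<^sup>2\<bar> \<le> \<eta>"
    and D: "is_dissipative_part T D"
    and A5: "\<rho> > 0" "AE x in lborel. x \<in> hull_D T D \<longrightarrow> \<bar>T x - x\<bar> \<le> \<rho>"
  shows "eq_mod (hull_D T D) (D_plus_inf T \<union> D_minus_inf T) \<and>
     D_plus_inf T \<inter> D_minus_inf T = {} \<and>
     invariant_set T (D_plus_inf T) \<and> invariant_set T (D_minus_inf T) \<and>
     ((\<exists>\<theta>\<^sub>o. 0 < \<theta>\<^sub>o \<and> \<theta>\<^sub>o < \<theta> \<and>
         (\<forall>j. emeasure lborel (markov_interval a j \<inter> hull_D T D) > 0 \<longrightarrow>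
            \<theta>\<^sub>o \<le> a (j + 1) - a j)) \<longrightarrow>
       emeasure lborel (D_plus_inf T) \<in> {0, \<infinity>} \<and>
       emeasure lborel (D_minus_inf T) \<in> {0, \<infinity>} \<and>
       ((\<forall>j. emeasure lborel (markov_interval a j \<inter> hull_D T D) > 0 \<longrightarrow>
            markov_interval a j \<subseteq> \<tau> j ` markov_interval a j) \<longrightarrow>
         (D_plus_inf T \<in> null_sets lborel \<or> exact_component T (D_plus_inf T)) \<and>
         (D_minus_inf T \<in> null_sets lborel \<or> exact_component T (D_minus_inf T))))"
proof -
  interpret dissipative_markov_map a T \<tau> \<tau>' \<tau>'' \<theta> \<Lambda> \<eta> D \<rho>
    by unfold_locales (fact a_top a_bot A1(2) A1(3) A2 surjective A3(1) A3(2) A4(1) A4(2) D A5(1) A5(2))+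
  have cell_interval: "emeasure lborel (markov_interval a j \<inter> hull_D T D) > 0"
    if "emeasure lborel (hull_D T D \<inter> cell j) > 0" for j
  proof -
    have "emeasure lborel (hull_D T D \<inter> cell j) \<le> emeasure lborel (markov_interval a j \<inter> hull_D T D)"
      by (intro emeasure_mono) (auto simp: markov_interval_def)
    then show ?thesis using that by (rule order_less_le_trans[rotated])
  qed
  have disjoint: "esc 1 \<inter> esc (-1) = {}"
  proof (rule ccontr)
    assume "\<not> ?thesis"
    then obtain x where x: "x \<in> esc 1" "x \<in> esc (-1)" by blast
    then have "\<forall>\<^sub>F n in sequentially. 1 * (T ^^ n) x > 0 \<and> -1 * (T ^^ n) x > 0"
      by (intro eventually_conj esc_eventually_gt)
    then show False by (auto simp: eventually_sequentially)
  qed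
  have measure: "emeasure lborel (esc s) \<in> {0, \<infinity>}"
    if "0 < \<theta>\<^sub>o" "s = 1 \<or> s = -1"
      "\<forall>j. emeasure lborel (markov_interval a j \<inter> hull_D T D) > 0 \<longrightarrow> \<theta>\<^sub>o \<le> a (j + 1) - a j" for \<theta>\<^sub>o s
    using esc_emeasure_infinite[OF _ that(1,2)] that(3) cell_interval
    by (cases "emeasure lborel (esc s) = 0") (auto simp: zero_less_iff_neq_zero)
  have exact: "esc s \<in> null_sets lborel \<or> exact_component T (esc s)"
    if "0 < \<theta>\<^sub>o" "s = 1 \<or> s = -1"
      "\<forall>j. emeasure lborel (markov_interval a j \<inter> hull_D T D) > 0 \<longrightarrow> \<theta>\<^sub>o \<le> a (j + 1) - a j"
      "\<forall>j. emeasure lborel (markov_interval a j \<inter> hull_D T D) > 0 \<longrightarrow>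
            markov_interval a j \<subseteq> \<tau> j ` markov_interval a j" for \<theta>\<^sub>o s
  proof -
    interpret regular_dissipative_markov_map a T \<tau> \<tau>' \<tau>'' \<theta> \<Lambda> \<eta> D \<rho> \<theta>\<^sub>o s
      by unfold_locales (use that cell_interval in \<open>auto simp only: cell_subset_image_iff\<close>)
    show ?thesis by (rule esc_exact)
  qed
  show ?thesis
    unfolding esc_plus esc_minus
  proof (intro conjI impI)
    assume "\<exists>\<theta>\<^sub>o>0. \<theta>\<^sub>o < \<theta> \<and> (\<forall>j. 0 < emeasure lborel (markov_interval a j \<inter> hull_D T D) \<longrightarrow>
      \<theta>\<^sub>o \<le> a (j + 1) - a j)"
    then obtain \<theta>\<^sub>o where \<theta>\<^sub>o: "0 < \<theta>\<^sub>o"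
      "\<forall>j. emeasure lborel (markov_interval a j \<inter> hull_D T D) > 0 \<longrightarrow> \<theta>\<^sub>o \<le> a (j + 1) - a j" by blast
    show "emeasure lborel (esc 1) \<in> {0, \<infinity>}" "emeasure lborel (esc (-1)) \<in> {0, \<infinity>}"
      using measure[OF \<theta>\<^sub>o(1) _ \<theta>\<^sub>o(2)] by blast+
    assume "\<forall>j. 0 < emeasure lborel (markov_interval a j \<inter> hull_D T D) \<longrightarrow>
      markov_interval a j \<subseteq> \<tau> j ` markov_interval a j"
    from exact[OF \<theta>\<^sub>o(1) _ \<theta>\<^sub>o(2) this]
    show "esc 1 \<in> null_sets lborel \<or> exact_component T (esc 1)"
      "esc (-1) \<in> null_sets lborel \<or> exact_component T (esc (-1))" by blast+
  qed (fact eq_mod_hull_D disjoint esc_invariant)+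
qed

end
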